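(* For $n\geq 3$, the formulas below define a symmetric, continuous extension of the area function $D_0\colon\mathcal{AC}_n\to(0,\infty)$ to $\mathcal{AC}_n\cup\mathcal{HC}_n\cup\mathcal{HI}_n$. For $(d_0,\ldots,d_{n-1})\in\mathcal{HC}_n$ with maximal entry $d_{i_0}$, define $$D_0(d_0,\ldots,d_{n-1})=(n-2)\pi+2\left[\sin^{-1}\left(\frac{1}{\cosh(d_{i_0}/2)}\right)-\sum_{i\neq i_0}\sin^{-1}\left(\frac{1}{\cosh(d_i/2)}\right)\right].$$ For $(d_0,\ldots,d_{n-1})\in\mathcal{HI}_n$ with $d_{i_0}=d_{i_0+1}=\infty$ (indices mod $n$), take $$D_0(d_0,\ldots,d_{n-1})=(n-2)\pi-2\sum_{i\neq i_0,i_0+1}\sin^{-1}\left(\frac{1}{\cosh(d_i/2)}\right).$$ Moreover, given $(d_0,\ldots,d_{n-1})$ and $(d_0',\ldots,d_{n-1}')$ in $\mathcal{HC}_n\cup\mathcal{HI}_n$, if up to a fixed permutation $d_i\leq d_i'$ for each $i$, and $d_i<d_i'$ for some $i$, then $D_0(d_0,\ldots,d_{n-1})<D_0(d_0',\ldots,d_{n-1}')$.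
   Context: Define $$\mathcal{AC}_n=\Big\{(d_0,\ldots,d_{n-1})\in(0,\infty)^n : \sinh(d_i/2)<\sum_{j\neq i}\sinh(d_j/2)\text{ for each } i\Big\},$$ $$\mathcal{HC}_n=\Big\{(d_0,\ldots,d_{n-1})\in(0,\infty)^n : \sinh(d_{i_0}/2)=\sum_{i\neq i_0}\sinh(d_i/2),\text{ where } d_{i_0}=\max_i d_i\Big\},$$ and let $\mathcal{HI}_n$ be the set of $(d_0,\ldots,d_{n-1})\in(0,\infty]^n$ such that, for some $i_0$, $d_{i_0}=d_{i_0+1}=\infty$ (indices mod $n$) and all other entries are finite. The union $\mathcal{AC}_n\cup\mathcal{HC}_n\cup\mathcal{HI}_n$ has the subspace topology from $(0,\infty]^n$. "Symmetric" means the function takes equal values at points that differ by a permutation of entries. A cyclic $n$-gon in the hyperbolic plane $\mathbb{H}^2$ with side length collection $(d_0,\ldots,d_{n-1})$ is a set $\{x_0,\ldots,x_{n-1}\}$ of points on a hyperbolic metric circle, cyclically ordered counterclockwise (for each $i$ with $1\le i\le n-1$, the counterclockwise half-open arc $(x_{i-1},x_i]$ contains no $x_j$ with $j\neq i$), such that $\mathrm{dist}(x_{i-1},x_i)=d_i$ for $i>0$ and $\mathrm{dist}(x_{n-1},x_0)=d_0$. The set $\mathcal{AC}_n$ is exactly the set of side length collections of cyclic $n$-gons, which are determined up to isometry by side length collection; for $\mathbf{d}\in\mathcal{AC}_n$, $D_0(\mathbf{d})$ is the hyperbolic area of the convex hull of a cyclic $n$-gon with side length collection $\mathbf{d}$.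 *)

theory Defs
  imports "HOL-Analysis.Analysis" "HOL-Complex_Analysis.Riemann_Mapping"
begin

text \<open>The hyperbolic plane is the Poincare disc \<^term>\<open>ball (0::complex) 1\<close> with curvature \<open>-1\<close>.
  The library map \<^term>\<open>Moebius_function 0 w\<close> is the orientation-preserving isometry
  \<open>z \<mapsto> (z - w) / (1 - cnj w * z)\<close>, which takes \<open>w\<close> to \<open>0\<close>.\<close>

definition hdist :: "complex \<Rightarrow> complex \<Rightarrow> real" where
  "hdist z w = 2 * artanh (norm (Moebius_function 0 w z))"

definition hyp_area :: "complex measure" where
  "hyp_area = density lborel
     (\<lambda>z. ennreal (indicator (ball 0 1) z * (4 / (1 - (norm z)\<^sup>2)\<^sup>2)))"

definition hsegment :: "complex \<Rightarrow> complex \<Rightarrow> complex set" where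
  "hsegment x y = {z \<in> ball 0 1. hdist x z + hdist z y = hdist x y}"

definition hconvex :: "complex set \<Rightarrow> bool" where
  "hconvex S \<longleftrightarrow> S \<subseteq> ball 0 1 \<and> (\<forall>x\<in>S. \<forall>y\<in>S. hsegment x y \<subseteq> S)"

definition hcircle :: "complex \<Rightarrow> real \<Rightarrow> complex set" where
  "hcircle c r = {z \<in> ball 0 1. hdist c z = r}"

text \<open>Polar coordinates at \<open>c\<close>: since \<^term>\<open>Moebius_function 0 (- c)\<close> is the orientation-preserving
  isometry taking \<open>0\<close> to \<open>c\<close>, \<open>t \<mapsto> hpolar c r t\<close> runs counterclockwise, with period \<open>2\<pi>\<close>, once
  around \<^term>\<open>hcircle c r\<close>.\<close>

definition hpolar :: "complex \<Rightarrow> real \<Rightarrow> real \<Rightarrow> complex" where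
  "hpolar c r t = Moebius_function 0 (- c) (of_real (tanh (r / 2)) * cis t)"

text \<open>The half-open arc \<open>(a, b]\<close> of \<^term>\<open>hcircle c r\<close>; for \<open>a = b\<close> it is the whole circle.\<close>

definition ccw_arc :: "complex \<Rightarrow> real \<Rightarrow> complex \<Rightarrow> complex \<Rightarrow> complex set" where
  "ccw_arc c r a b = {hpolar c r t |s t u.
     a = hpolar c r s \<and> b = hpolar c r u \<and> s < t \<and> t \<le> u \<and> u \<le> s + 2 * pi}"

text \<open>A point of \<open>(0,\<infinity>]\<^sup>n\<close> is a function \<^typ>\<open>nat \<Rightarrow> ereal\<close> in
  \<^term>\<open>{..<n} \<rightarrow>\<^sub>E {0::ereal<..}\<close>. Off \<^term>\<open>{..<n}\<close> it has the fixed value \<^term>\<open>undefined\<close>, so the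
  product topology of \<^typ>\<open>nat \<Rightarrow> ereal\<close> induces the topology of the \<open>n\<close>-fold product.\<close>

definition cyclic_ngon :: "nat \<Rightarrow> (nat \<Rightarrow> ereal) \<Rightarrow> (nat \<Rightarrow> complex) \<Rightarrow> bool" where
  "cyclic_ngon n d x \<longleftrightarrow>
     (\<exists>c\<in>ball 0 1. \<exists>r>0. (\<forall>i<n. x i \<in> hcircle c r) \<and>
        (\<forall>i\<in>{1..<n}. \<forall>j<n. j \<noteq> i \<longrightarrow> x j \<notin> ccw_arc c r (x (i - 1)) (x i))) \<and>
     (\<forall>i\<in>{1..<n}. ereal (hdist (x (i - 1)) (x i)) = d i) \<and>
     ereal (hdist (x (n - 1)) (x 0)) = d 0"

definition half_sinh :: "ereal \<Rightarrow> real" where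
  "half_sinh a = sinh (real_of_ereal a / 2)"

definition AC :: "nat \<Rightarrow> (nat \<Rightarrow> ereal) set" where
  "AC n = {d \<in> {..<n} \<rightarrow>\<^sub>E {0<..<\<infinity>}.
     \<forall>i<n. half_sinh (d i) < (\<Sum>j\<in>{..<n} - {i}. half_sinh (d j))}"

definition HC :: "nat \<Rightarrow> (nat \<Rightarrow> ereal) set" where
  "HC n = {d \<in> {..<n} \<rightarrow>\<^sub>E {0<..<\<infinity>}.
     \<exists>i0<n. d i0 = Max (d ` {..<n}) \<and>
       half_sinh (d i0) = (\<Sum>i\<in>{..<n} - {i0}. half_sinh (d i))}"

definition HI :: "nat \<Rightarrow> (nat \<Rightarrow> ereal) set" where
  "HI n = {d \<in> {..<n} \<rightarrow>\<^sub>E {0<..}.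
     \<exists>i0<n. d i0 = \<infinity> \<and> d ((i0 + 1) mod n) = \<infinity> \<and>
       (\<forall>i\<in>{..<n} - {i0, (i0 + 1) mod n}. d i < \<infinity>)}"

text \<open>The area function on \<^term>\<open>AC n\<close>; the description makes sense because a cyclic \<open>n\<close>-gon exists
  for each \<open>d \<in> AC n\<close> and is determined by \<open>d\<close> up to isometry.\<close>

definition cyclic_area :: "nat \<Rightarrow> (nat \<Rightarrow> ereal) \<Rightarrow> real" where
  "cyclic_area n d =
     (THE a. \<exists>x. cyclic_ngon n d x \<and> a = measure hyp_area (hconvex hull (x ` {..<n})))"

definition horo_angle :: "ereal \<Rightarrow> real" where
  "horo_angle a = arcsin (1 / cosh (real_of_ereal a / 2))"

end

theory Submission
  imports Defs
begin

text \<open>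
  A cyclic polygon with sides \<open>d\<^sub>i\<close> on a circle of radius \<open>r\<close> subtends half central angles
  \<open>\<alpha>\<^sub>i \<in> (0, \<pi>)\<close> with \<open>\<Sum> \<alpha>\<^sub>i = \<pi>\<close> and \<open>sinh (d\<^sub>i / 2) = sinh r sin \<alpha>\<^sub>i\<close>; concavity of
  \<open>x \<mapsto> arcsin (t sin x)\<close> on \<open>[0, \<pi>]\<close> makes the \<open>\<alpha>\<^sub>i\<close> unique. In the Klein model the convex hull
  is the Euclidean hull of points on a Euclidean circle, that is, a disc minus disjoint circular caps,
  and Fubini gives the area of a cap. The outcome is
  \<open>D = 2 (\<Sum> arccos (cos \<alpha>\<^sub>i / cosh (d\<^sub>i / 2)) - \<pi>)\<close>.
  This formula extends: on \<open>HC\<close> put \<open>\<alpha> = \<pi>\<close> at the longest side and \<open>\<alpha> = 0\<close> elsewhere, on \<open>HI\<close> put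
  \<open>\<alpha> = 0\<close> and \<open>1 / cosh \<infinity> = 0\<close>. Continuity then amounts to that of the angles, which are the unique
  solution of a closed condition in a compact set, or, near \<open>HI\<close>, are squeezed to \<open>0\<close>. On
  \<open>HC \<union> HI\<close> the formula becomes a sum of arctangents of \<open>sinh (d\<^sub>i / 2)\<close>, whence monotonicity.
\<close>

section \<open>Half central angles\<close>

text \<open>Each summand \<open>arccos (cos \<alpha> / cosh (d / 2))\<close> is
  \<open>\<pi> / 2 - \<beta>\<close>, where \<beta> is the base angle of the isosceles triangle over
  the side, since \<open>cos \<alpha> = cosh (d / 2) sin \<beta>\<close> in its right-angled half.
  Adding up such triangles requires knowing on which side of the centre the longest side lies.
  Subtracting caps from the disc is uniform in the half angle, and the sign of
  \<open>cos \<alpha>\<close> does the bookkeeping. At \<open>HI\<close> the angle equations cannot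
  be carried to the limit. For polygons with finite sides that approach \<open>HI\<close>, the
  angles of the two long sides together approach \<pi>, but their shares depend on the approach;
  only the angles of the other sides converge. The value 0 assigned to all angles is nevertheless
  adequate, because \<open>1 / cosh (d / 2)\<close> tends to 0 at the long sides and suppresses
  their cosines.\<close>

lemma strictly_subadditive:
  fixes g g' :: "real \<Rightarrow> real"
  assumes cont: "continuous_on {0..b} g" and g0: "g 0 = 0"
    and der: "\<And>x. 0 < x \<Longrightarrow> x < b \<Longrightarrow> (g has_real_derivative g' x) (at x)"
    and dec: "\<And>x y. 0 < x \<Longrightarrow> x < y \<Longrightarrow> y < b \<Longrightarrow> g' y < g' x"
    and xy: "0 < x" "0 < y" "x + y \<le> b"
  shows "g (x + y) < g x + g y"
proof -
  \<comment> \<open>A decreasing derivative makes increments over a step of length \<open>x\<close>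
    shrink as they move to the right; the increment at 0 is \<open>g x\<close> because
    \<open>g 0 = 0\<close>.\<close>
  let ?\<phi> = "\<lambda>u. g (x + u) - g u"
  have "?\<phi> y < ?\<phi> 0"
  proof (rule DERIV_neg_imp_decreasing_open[OF xy(2), where f = ?\<phi>])
    fix u assume u: "0 < u" "u < y"
    have "(?\<phi> has_real_derivative g' (x + u) - g' u) (at u)"
      using der[of "x + u"] der[of u] u xy by (auto intro!: derivative_eq_intros simp: DERIV_shift add.commute)
    moreover have "g' (x + u) - g' u < 0" using dec[of u "x + u"] u xy by auto
    ultimately show "\<exists>z. (?\<phi> has_real_derivative z) (at u) \<and> z < 0" by blast
  next
    show "continuous_on {0..y} ?\<phi>"
      by (intro continuous_intros continuous_on_compose2[OF cont]) (use xy in auto)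
  qed
  then show ?thesis using g0 by simp
qed

text \<open>Stated once for the four concave functions of the development: \<open>sin\<close>,
  \<open>arctan\<close>, \<open>arcsin (t * sin x)\<close> and \<open>arctan (C * tan x)\<close>. A
  single summand would give equality, hence the bound on the cardinality.\<close>

lemma strictly_subadditive_sum:
  fixes g g' :: "real \<Rightarrow> real"
  assumes cont: "continuous_on {0..b} g" and g0: "g 0 = 0"
    and der: "\<And>x. 0 < x \<Longrightarrow> x < b \<Longrightarrow> (g has_real_derivative g' x) (at x)"
    and dec: "\<And>x y. 0 < x \<Longrightarrow> x < y \<Longrightarrow> y < b \<Longrightarrow> g' y < g' x"
    and fin: "finite I" and card: "card I \<ge> 2"
    and pos: "\<And>i. i \<in> I \<Longrightarrow> 0 < x i" and le: "sum x I \<le> b"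
  shows "g (sum x I) < (\<Sum>i\<in>I. g (x i))"
proof -
  \<comment> \<open>Empty and one-element sums give equality, so induction over subsets delivers
    only the weak inequality; strictness comes from splitting off one index at the end.\<close>
  have weak: "g (sum x J) \<le> (\<Sum>i\<in>J. g (x i))" if "finite J" "J \<subseteq> I" for J
    using that
  proof (induction J)
    case (insert j J)
    show ?case
    proof (cases "J = {}")
      case False
      have "0 < sum x J" using insert False pos by (intro sum_pos) auto
      moreover have "x j + sum x J \<le> b"
        using sum_mono2[OF fin insert.prems, of x] pos insert.hyps le by fastforce
      moreover have "0 < x j" using insert pos by auto
      ultimately have "g (x j + sum x J) < g (x j) + g (sum x J)"
        using strictly_subadditive[OF cont g0 der dec] by blast
      then show ?thesis using insert by simp
    qed (use insert in simp)
  qed (simp add: g0)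
  obtain j where j: "j \<in> I" using card by fastforce
  have ne: "I - {j} \<noteq> {}" using card card_mono[of "{j}" I] by auto
  have "0 < sum x (I - {j})" using ne fin pos by (intro sum_pos) auto
  moreover have eq: "sum x I = x j + sum x (I - {j})" using j fin by (simp add: sum.remove)
  ultimately have "g (sum x I) < g (x j) + g (sum x (I - {j}))"
    using strictly_subadditive[OF cont g0 der dec, of "x j" "sum x (I - {j})"] pos[OF j] le by simp
  also have "\<dots> \<le> g (x j) + (\<Sum>i\<in>I - {j}. g (x i))" using weak[of "I - {j}"] fin by auto
  also have "\<dots> = (\<Sum>i\<in>I. g (x i))" using j fin by (simp add: sum.remove)
  finally show ?thesis .
qed

lemma sin_sum_less:
  assumes "finite I" "card I \<ge> 2" "\<And>i. i \<in> I \<Longrightarrow> 0 < x i" "sum x I \<le> pi"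
  shows "sin (sum x I) < (\<Sum>i\<in>I. sin (x i :: real))"
  by (rule strictly_subadditive_sum[where b = pi and g = sin and g' = cos and x = x])
    (use assms in \<open>auto intro!: continuous_intros derivative_eq_intros simp: cos_monotone_0_pi\<close>)

lemma arctan_sum_less:
  assumes "finite I" "card I \<ge> 2" "\<And>i. i \<in> I \<Longrightarrow> 0 < x i"
  shows "arctan (sum x I) < (\<Sum>i\<in>I. arctan (x i :: real))"
  by (rule strictly_subadditive_sum[where b = "sum x I" and g = arctan and x = x and g' = "\<lambda>x. inverse (1 + x\<^sup>2)"])
    (use assms in \<open>auto intro!: continuous_intros derivative_eq_intros
       simp: power_strict_mono add_pos_nonneg\<close>)

text \<open>Lowering \<kappa> by a factor \<open>t\<close> turns an acute angle \<open>x\<close>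
  into \<open>arcsin (t * sin x)\<close>. Strictness hinges on \<open>t < 1\<close>: for
  \<open>t = 1\<close> the function is the identity up to \<open>pi / 2\<close>, while here the
  second derivative carries the factor \<open>1 - t\<^sup>2\<close>.\<close>

lemma arcsin_mult_sin_sum_less:
  assumes "finite I" "card I \<ge> 2" "\<And>i. i \<in> I \<Longrightarrow> 0 < x i" "sum x I \<le> pi" and t: "0 < t" "t < 1"
  shows "arcsin (t * sin (sum x I)) < (\<Sum>i\<in>I. arcsin (t * sin (x i :: real)))"
proof (rule strictly_subadditive_sum[where b = pi and g = "\<lambda>x. arcsin (t * sin x)" and x = x and g' = "\<lambda>x. t * cos x / sqrt (1 - (t * sin x)\<^sup>2)"])
  have less: "\<bar>t * sin x\<bar> < 1" for x :: real
  proof -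
    have "\<bar>t\<bar> * \<bar>sin x\<bar> \<le> \<bar>t\<bar> * 1" using t by (intro mult_left_mono) auto
    then show ?thesis using t unfolding abs_mult by linarith
  qed
  have pos: "0 < 1 - (t * sin x)\<^sup>2" for x
    using less[of x] by (simp add: abs_square_less_1)
  show "continuous_on {0..pi} (\<lambda>x. arcsin (t * sin x))"
    using less by (intro continuous_intros) (auto simp: abs_less_iff less_imp_le abs_le_iff minus_le_iff)
  show "((\<lambda>x. arcsin (t * sin x)) has_real_derivative t * cos x / sqrt (1 - (t * sin x)\<^sup>2)) (at x)" for x
    using less[of x] by (auto intro!: derivative_eq_intros simp: abs_less_iff field_simps)
  fix x y :: real assume xy: "0 < x" "x < y" "y < pi"
  have key: "t * cos y / sqrt (1 - (t * sin y)\<^sup>2) < t * cos x / sqrt (1 - (t * sin x)\<^sup>2)"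
    (is "?g y < ?g x")
  proof (rule DERIV_neg_imp_decreasing_open[OF xy(2), where f = ?g])
    fix u assume u: "x < u" "u < y"
    define w where "w = sqrt (1 - (t * sin u)\<^sup>2)"
    have w: "w > 0" "w\<^sup>2 = 1 - (t * sin u)\<^sup>2" using pos[of u] by (auto simp: w_def)
    have su: "0 < sin u" using u xy by (intro sin_gt_zero) auto
    have "(?g has_real_derivative - t * sin u * (1 - t\<^sup>2) / w ^ 3) (at u)"
    proof -
      have "(?g has_real_derivative (- t * sin u * w - t * cos u * (- (2 * (t * sin u) * (t * cos u)) * (inverse w / 2))) / (w * w)) (at u)"
        using pos[of u] w unfolding w_def
        by (auto intro!: derivative_eq_intros)
      also have "(- t * sin u * w - t * cos u * (- (2 * (t * sin u) * (t * cos u)) * (inverse w / 2))) / (w * w)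
         = - t * sin u * (w\<^sup>2 - t\<^sup>2 * (cos u)\<^sup>2) / w ^ 3"
        using w(1) by (simp add: field_simps power2_eq_square power3_eq_cube)
      also have "w\<^sup>2 - t\<^sup>2 * (cos u)\<^sup>2 = 1 - t\<^sup>2"
        using w(2) by (simp add: cos_squared_eq algebra_simps power_mult_distrib)
      finally show ?thesis .
    qed
    moreover have "- t * sin u * (1 - t\<^sup>2) / w ^ 3 < 0"
      using t su w(1) by (auto intro!: divide_neg_pos mult_pos_pos simp: abs_square_less_1)
    ultimately show "\<exists>z. (?g has_real_derivative z) (at u) \<and> z < 0" by blast
  next
    show "continuous_on {x..y} ?g"
      using pos by (intro continuous_intros) (auto simp: less_le)
  qed
  then show "t * cos y / sqrt (1 - (t * sin y)\<^sup>2) < t * cos x / sqrt (1 - (t * sin x)\<^sup>2)" .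
qed (use assms in auto)

text \<open>The last condition excludes the spurious solutions \<open>\<alpha> m = \<pi>\<close>, \<open>\<alpha> i = 0\<close> for \<open>i \<noteq> m\<close>, of the others,
  unless \<open>a m\<close> is at least the sum of the other \<open>a i\<close>; unlike positivity of the angles it is a closed
  condition.\<close>

definition closing_angles :: "'i set \<Rightarrow> ('i \<Rightarrow> real) \<Rightarrow> ('i \<Rightarrow> real) \<Rightarrow> bool" where
  "closing_angles I a \<alpha> \<longleftrightarrow>
     (\<forall>i\<in>I. 0 \<le> \<alpha> i \<and> \<alpha> i \<le> pi) \<and> sum \<alpha> I = pi \<and>
     (\<forall>i\<in>I. \<forall>j\<in>I. a j * sin (\<alpha> i) = a i * sin (\<alpha> j)) \<and>
     (\<forall>i\<in>I. - cos (\<alpha> i) * sum a (I - {i}) \<le> a i)"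
text \<open>\<kappa> is \<open>1 / sinh r\<close> for the radius \<open>r\<close> of the
  circumscribed circle, and \<open>a i\<close> stands for \<open>sinh (d i / 2)\<close>.\<close>

definition circular_angles :: "'i set \<Rightarrow> ('i \<Rightarrow> real) \<Rightarrow> real \<Rightarrow> ('i \<Rightarrow> real) \<Rightarrow> bool" where
  "circular_angles I a \<kappa> \<alpha> \<longleftrightarrow>
     0 < \<kappa> \<and> sum \<alpha> I = pi \<and> (\<forall>i\<in>I. 0 < \<alpha> i \<and> \<alpha> i < pi \<and> sin (\<alpha> i) = \<kappa> * a i)"
lemma circular_anglesD:
  assumes "circular_angles I a \<kappa> \<alpha>"
  shows "0 < \<kappa>" "sum \<alpha> I = pi" "\<And>i. i \<in> I \<Longrightarrow> 0 < \<alpha> i" "\<And>i. i \<in> I \<Longrightarrow> \<alpha> i < pi"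
    "\<And>i. i \<in> I \<Longrightarrow> sin (\<alpha> i) = \<kappa> * a i"
  using assms by (auto simp: circular_angles_def)

section \<open>Structure of the solutions of the angle equations\<close>

text \<open>This is \<open>x \<le> tan x\<close> multiplied by the cosine, a form which remains true
  beyond \<open>pi / 2\<close>.\<close>

lemma mult_cos_le_sin:
  assumes "0 \<le> x" "x \<le> pi"
  shows "x * cos x \<le> sin x"
proof -
  have "sin 0 - 0 * cos 0 \<le> sin x - x * cos x"
  proof (rule DERIV_nonneg_imp_nondecreasing[where f = "\<lambda>x. sin x - x * cos x", OF assms(1)])
    fix y assume "0 \<le> y" "y \<le> x"
    then have "0 \<le> y * sin y" using assms by (intro mult_nonneg_nonneg sin_ge_zero) auto
    moreover have "((\<lambda>x. sin x - x * cos x) has_real_derivative y * sin y) (at y)"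
      by (auto intro!: derivative_eq_intros)
    ultimately show "\<exists>z. ((\<lambda>x. sin x - x * cos x) has_real_derivative z) (at y) \<and> 0 \<le> z" by blast
  qed
  then show ?thesis by simp
qed

lemma sum_Diff_eq_pi:
  assumes "finite I" "i \<in> I" "sum \<alpha> I = pi"
  shows "sum \<alpha> (I - {i}) = pi - \<alpha> i"
  using assms by (simp add: sum_diff1)

text \<open>Only the last clause has content, and only for \<open>\<alpha> i \<ge> pi / 2\<close>.
  The other angles then have a sum \<open>S = pi - \<alpha> i\<close> with nonnegative cosine, and
  \<open>cos S\<close> times the sum of their sines is at most
  \<open>S * cos S \<le> sin S = sin (\<alpha> i)\<close>.\<close>

lemma circular_angles_imp_closing_angles:
  assumes I: "finite I" and "circular_angles I a \<kappa> \<alpha>"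
  shows "closing_angles I a \<alpha>"
proof -
  note D = circular_anglesD[OF assms(2)]
  note \<kappa> = D(1) and sum = D(2) and \<alpha> = D(3-5)
  have apos: "0 \<le> a i" if "i \<in> I" for i
    using sin_gt_zero[OF \<alpha>(1,2)[OF that]] \<alpha>(3)[OF that] \<kappa> by (simp add: zero_less_mult_iff)
  have "- cos (\<alpha> i) * sum a (I - {i}) \<le> a i" if i: "i \<in> I" for i
  proof (cases "cos (\<alpha> i) \<le> 0")
    case True
    define S where "S = sum \<alpha> (I - {i})"
    have S: "S = pi - \<alpha> i" unfolding S_def by (rule sum_Diff_eq_pi[OF I i sum])
    have "\<kappa> * sum a (I - {i}) = (\<Sum>j\<in>I - {i}. sin (\<alpha> j))"
      by (simp add: sum_distrib_left \<alpha>)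
    also have "\<dots> \<le> S" unfolding S_def
      using \<alpha>(1) by (intro sum_mono sin_x_le_x) (auto intro: less_imp_le)
    finally have "cos S * (\<kappa> * sum a (I - {i})) \<le> cos S * S"
      using True S by (intro mult_left_mono) auto
    also have "\<dots> \<le> sin S"
      using mult_cos_le_sin[of S] S \<alpha>(1,2)[OF i] by (simp add: mult.commute)
    also have "\<dots> = \<kappa> * a i" using S \<alpha>(3)[OF i] by simp
    finally have "\<kappa> * (- cos (\<alpha> i) * sum a (I - {i})) \<le> \<kappa> * a i"
      using S by (simp add: mult_ac)
    then show ?thesis using \<kappa> mult_le_cancel_left_pos by blast
  next
    case False
    then have "- cos (\<alpha> i) * sum a (I - {i}) \<le> 0"
      using mult_nonneg_nonneg[of "cos (\<alpha> i)" "sum a (I - {i})"] sum_nonneg[of "I - {i}" a] apos by auto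
    then show ?thesis using apos[OF i] by linarith
  qed
  moreover have "a j * sin (\<alpha> i) = a i * sin (\<alpha> j)" if "i \<in> I" "j \<in> I" for i j
    using that \<alpha>(3) by simp
  ultimately show ?thesis
    using \<alpha> sum by (auto simp: closing_angles_def less_imp_le)
qed

text \<open>The other angles add up to \<open>pi - \<alpha> i\<close>, which has the same sine as
  \<open>\<alpha> i\<close>; there are at least two of them, so the sine of their sum is strictly
  below the sum of their sines.\<close>

lemma circular_angles_polygon_inequality:
  assumes I: "finite I" "card I \<ge> 3" and ang: "circular_angles I a \<kappa> \<alpha>" and i: "i \<in> I"
  shows "a i < sum a (I - {i})"
proof -
  note D = circular_anglesD[OF ang]
  note \<kappa> = D(1) and sum = D(2) and \<alpha> = D(3-5)
  have S: "sum \<alpha> (I - {i}) = pi - \<alpha> i" by (rule sum_Diff_eq_pi[OF I(1) i sum])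
  have "\<kappa> * a i = sin (sum \<alpha> (I - {i}))" using \<alpha>(3)[OF i] S by simp
  also have "\<dots> < (\<Sum>j\<in>I - {i}. sin (\<alpha> j))"
    using I i \<alpha> S by (intro sin_sum_less) (auto intro: less_imp_le)
  also have "\<dots> = \<kappa> * sum a (I - {i})" by (simp add: sum_distrib_left \<alpha>)
  finally show ?thesis using \<kappa> by simp
qed

text \<open>One nonvanishing sine propagates to all indices through the ratio equations and
  determines \<kappa>. If all sines vanish, every angle is 0 or \<pi>, and the sum leaves room for
  exactly one \<pi>, at which the last clause becomes the stated inequality.\<close>

lemma closing_angles_cases:
  assumes I: "finite I" and a: "\<forall>i\<in>I. 0 < a i" and ang: "closing_angles I a \<alpha>"
  obtains (circular) \<kappa> where "circular_angles I a \<kappa> \<alpha>"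
  | (degenerate) m where "m \<in> I" and "\<alpha> m = pi" and "\<And>i. i \<in> I - {m} \<Longrightarrow> \<alpha> i = 0"
      and "sum a (I - {m}) \<le> a m"
proof (cases "\<exists>k\<in>I. sin (\<alpha> k) \<noteq> 0")
  case True
  have \<alpha>: "\<And>i. i \<in> I \<Longrightarrow> 0 \<le> \<alpha> i \<and> \<alpha> i \<le> pi" and sum: "sum \<alpha> I = pi"
    and ratio: "\<And>i j. i \<in> I \<Longrightarrow> j \<in> I \<Longrightarrow> a j * sin (\<alpha> i) = a i * sin (\<alpha> j)"
    using ang by (auto simp: closing_angles_def)
  obtain k where k: "k \<in> I" "sin (\<alpha> k) \<noteq> 0" using True by blast
  have sk: "0 < sin (\<alpha> k)" using sin_ge_zero \<alpha>[OF k(1)] k(2) by (metis less_eq_real_def)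
  have eq: "sin (\<alpha> i) = sin (\<alpha> k) / a k * a i" if "i \<in> I" for i
    using ratio[OF that k(1)] bspec[OF a k(1)] by (simp add: field_simps)
  have "0 < \<alpha> i \<and> \<alpha> i < pi" if "i \<in> I" for i
  proof -
    have "0 < sin (\<alpha> i)" unfolding eq[OF that] using sk a k(1) that by simp
    then have "\<alpha> i \<noteq> 0" "\<alpha> i \<noteq> pi" by auto
    then show ?thesis using \<alpha>[OF that] by auto
  qed
  then have "circular_angles I a (sin (\<alpha> k) / a k) \<alpha>"
    using sk bspec[OF a k(1)] eq sum by (simp add: circular_angles_def)
  then show ?thesis by (rule circular)
next
  case False
  have \<alpha>: "\<And>i. i \<in> I \<Longrightarrow> 0 \<le> \<alpha> i \<and> \<alpha> i \<le> pi" and sum: "sum \<alpha> I = pi"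
    and cl: "\<And>i. i \<in> I \<Longrightarrow> - cos (\<alpha> i) * sum a (I - {i}) \<le> a i"
    using ang by (auto simp: closing_angles_def)
  have "\<alpha> i = 0 \<or> \<alpha> i = pi" if "i \<in> I" for i
    using False that \<alpha>[OF that] sin_gt_zero[of "\<alpha> i"] by fastforce
  moreover have "\<exists>i\<in>I. \<alpha> i \<noteq> 0" using sum sum.neutral[of I \<alpha>] by fastforce
  ultimately obtain m where m: "m \<in> I" "\<alpha> m = pi" by blast
  have "sum \<alpha> (I - {m}) = 0" using sum_Diff_eq_pi[OF I m(1) sum] m by simp
  then have "\<alpha> i = 0" if "i \<in> I - {m}" for i
    using sum_nonneg_eq_0_iff[of "I - {m}" \<alpha>] I \<alpha> that by auto
  then show ?thesis using degenerate[OF m] cl[OF m(1)] m(2) by simp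
qed

text \<open>Only the longest side can subtend a half angle of \<open>pi / 2\<close> or more. Since a
  third angle is positive, such an \<open>\<alpha> i\<close> leaves
  \<open>\<alpha> j < pi - \<alpha> i\<close>, hence a smaller sine and a shorter side
  \<open>j\<close>.\<close>

lemma circular_angles_less_pi_half:
  assumes I: "finite I" "card I \<ge> 3" and ang: "circular_angles I a \<kappa> \<alpha>"
    and ij: "i \<in> I" "j \<in> I" "i \<noteq> j" "a i \<le> a j"
  shows "\<alpha> i < pi / 2"
proof (rule ccontr)
  assume "\<not> ?thesis"
  then have big: "pi / 2 \<le> \<alpha> i" by simp
  note D = circular_anglesD[OF ang]
  note \<kappa> = D(1) and sum = D(2) and \<alpha> = D(3-5)
  have "I - {i, j} \<noteq> {}" using I card_mono[of "{i, j}" I] ij(3) by auto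
  then have "0 < sum \<alpha> (I - {i, j})" using I \<alpha> by (intro sum_pos) auto
  moreover have "sum \<alpha> I = \<alpha> i + \<alpha> j + sum \<alpha> (I - {i, j})"
    using I ij by (subst sum.remove[of I i], simp, simp, subst sum.remove[of _ j]) (auto simp: Diff_insert2[symmetric])
  ultimately have less: "\<alpha> j < pi - \<alpha> i" using sum by linarith
  have "sin (\<alpha> j) < sin (pi - \<alpha> i)"
    using less big \<alpha>(1)[OF ij(2)] by (intro sin_monotone_2pi) auto
  then have "\<kappa> * a j < \<kappa> * a i" using \<alpha>(3) ij by simp
  then show False using \<kappa> ij by simp
qed

text \<open>Serves the squeeze near \<open>HI\<close>, where a small sine has to mean an angle close
  to 0 rather than to \<pi>. In the degenerate case the angle \<pi> belongs to a side that no other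
  side exceeds.\<close>

lemma closing_angles_le_pi_half:
  assumes I: "finite I" "card I \<ge> 3" and a: "\<forall>i\<in>I. 0 < a i" and ang: "closing_angles I a \<alpha>"
    and ij: "i \<in> I" "j \<in> I" "a i < a j"
  shows "\<alpha> i \<le> pi / 2"
using I(1) a ang
proof (cases rule: closing_angles_cases)
  case (circular \<kappa>)
  show ?thesis using circular_angles_less_pi_half[OF I circular ij(1,2)] ij by (auto intro: less_imp_le)
next
  case (degenerate m)
  have "i \<noteq> m"
  proof
    assume "i = m"
    then have "a j \<le> sum a (I - {m})" using ij I a by (intro member_le_sum) (auto intro: less_imp_le)
    then show False using \<open>i = m\<close> ij degenerate by auto
  qed
  then show ?thesis using degenerate ij by simp
qed

section \<open>Uniqueness and existence of the angles\<close>

text \<open>Every angle except that of the longest side is acute, so \<open>arcsin\<close> recovers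
  it from its sine, and the two solutions differ by the factor
  \<open>t = \<kappa>' / \<kappa>\<close> under the arcsine. For \<open>t < 1\<close> strict
  concavity makes the sum \<open>S'\<close> of these angles incompatible with the equation
  \<open>sin S' = t * sin S\<close> that the remaining angle imposes.\<close>

lemma circular_angles_unique_aux:
  assumes I: "finite I" "card I \<ge> 3"
    and ang: "circular_angles I a \<kappa> \<alpha>" "circular_angles I a \<kappa>' \<alpha>'" and le: "\<kappa>' \<le> \<kappa>" and i: "i \<in> I"
  shows "\<alpha>' i = \<alpha> i"
proof -
  note D = circular_anglesD[OF ang(1)]
  note \<kappa> = D(1) and sum = D(2) and \<alpha> = D(3-5)
  note D' = circular_anglesD[OF ang(2)]
  note \<kappa>' = D'(1) and sum' = D'(2) and \<alpha>' = D'(3-5)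
  have "I \<noteq> {}" using I by auto
  then obtain m where "m \<in> I" "a m = Max (a ` I)"
    using Max_in[of "a ` I"] I(1) by fastforce
  then have m: "m \<in> I" "\<And>i. i \<in> I \<Longrightarrow> a i \<le> a m"
    using I(1) by auto
  define t where "t = \<kappa>' / \<kappa>"
  have t: "0 < t" "t \<le> 1" using \<kappa> \<kappa>' le by (auto simp: t_def)
  have sin': "sin (\<alpha>' i) = t * sin (\<alpha> i)" if "i \<in> I" for i
    using \<alpha>(3)[OF that] \<alpha>'(3)[OF that] \<kappa> by (simp add: t_def)
  have half: "\<alpha> i < pi / 2" "\<alpha>' i < pi / 2" if "i \<in> I - {m}" for i
    using circular_angles_less_pi_half[OF I ang(1), of i m] circular_angles_less_pi_half[OF I ang(2), of i m]
      that m by auto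
  have arc: "\<alpha>' i = arcsin (t * sin (\<alpha> i))" if "i \<in> I - {m}" for i
    using arcsin_sin[of "\<alpha>' i"] half(2)[OF that] \<alpha>'(1)[of i] sin'[of i] that by simp
  define S where "S = sum \<alpha> (I - {m})"
  define S' where "S' = sum \<alpha>' (I - {m})"
  have S: "S = pi - \<alpha> m" unfolding S_def by (rule sum_Diff_eq_pi[OF I(1) m(1) sum])
  have S': "S' = pi - \<alpha>' m" unfolding S'_def by (rule sum_Diff_eq_pi[OF I(1) m(1) sum'])
  have le: "\<alpha>' i \<le> \<alpha> i" if "i \<in> I - {m}" for i
  proof -
    have "sin (\<alpha>' i) \<le> sin (\<alpha> i)"
      using sin'[of i] t that sin_gt_zero[OF \<alpha>(1,2), of i] by (auto intro: mult_left_le_one_le)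
    then show ?thesis using sin_mono_le_eq[of "\<alpha>' i" "\<alpha> i"] half[OF that] \<alpha>(1)[of i] \<alpha>'(1)[of i] that by auto
  qed
  have "t = 1"
  proof (rule ccontr)
    assume "t \<noteq> 1"
    then have t1: "t < 1" using t by simp
    have "arcsin (t * sin S) < (\<Sum>i\<in>I - {m}. arcsin (t * sin (\<alpha> i)))"
      unfolding S_def
      using I m \<alpha> S t t1 by (intro arcsin_mult_sin_sum_less) (auto simp: S_def[symmetric] intro: less_imp_le)
    also have "\<dots> = S'" unfolding S'_def using arc by (intro sum.cong) auto
    finally have less: "arcsin (t * sin S) < S'" .
    have sinS: "sin S' = t * sin S" using sin'[OF m(1)] S S' by simp
    show False
    proof (cases "S' \<le> pi / 2")
      case True
      then show False using less sinS arcsin_sin[of S'] S' \<alpha>'(2)[OF m(1)] by simp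
    next
      \<comment> \<open>Sine is decreasing on \<open>[S', S]\<close>, whereas the equation makes
        \<open>sin S'\<close> smaller than \<open>sin S\<close>.\<close>
      case False
      have "S' \<le> S" unfolding S_def S'_def by (intro sum_mono le)
      then have "sin (pi - S) \<le> sin (pi - S')"
        using False S \<alpha>(1)[OF m(1)] \<alpha>(2)[OF m(1)] by (intro sin_monotone_2pi_le) auto
      moreover have "t * sin S < sin S"
        using t1 sin_gt_zero[OF \<alpha>(1,2)[OF m(1)]] S by simp
      ultimately show False using sinS by simp
    qed
  qed
  then have eq: "\<alpha>' i = \<alpha> i" if "i \<in> I - {m}" for i
    using arc[OF that] arcsin_sin[of "\<alpha> i"] half(1)[OF that] \<alpha>(1)[of i] that by simp
  then have "S = S'" unfolding S_def S'_def by (intro sum.cong) auto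
  then show ?thesis using eq S S' i by (cases "i = m") auto
qed

text \<open>A circular solution obeys the strict polygon inequality, which no degenerate one
  permits; and two different entries cannot each be at least the sum of all the others when a third
  one is positive.\<close>

lemma closing_angles_unique:
  assumes I: "finite I" "card I \<ge> 3" and a: "\<forall>i\<in>I. 0 < a i"
    and ang: "closing_angles I a \<alpha>" "closing_angles I a \<alpha>'" and i: "i \<in> I"
  shows "\<alpha> i = \<alpha>' i"
proof -
  have degen: "m' = m" if "m \<in> I" "m' \<in> I" "sum a (I - {m}) \<le> a m" "sum a (I - {m'}) \<le> a m'" for m m'
  proof (rule ccontr)
    assume "m' \<noteq> m"
    have "I - {m, m'} \<noteq> {}" using I card_mono[of "{m, m'}" I] \<open>m' \<noteq> m\<close> by auto
    then have pos: "0 < sum a (I - {m, m'})" using I a by (intro sum_pos) auto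
    have "sum a (I - {m}) = a m' + sum a (I - {m, m'})" "sum a (I - {m'}) = a m + sum a (I - {m, m'})"
      using I that \<open>m' \<noteq> m\<close> by (auto simp: sum.remove[of "I - {m}" m'] sum.remove[of "I - {m'}" m]
          Diff_insert2[symmetric] insert_commute)
    then show False using that pos by linarith
  qed
  show ?thesis
  using I(1) a ang(1)
  proof (cases rule: closing_angles_cases)
    case c: (circular \<kappa>)
    show ?thesis
    using I(1) a ang(2)
    proof (cases rule: closing_angles_cases)
      case c': (circular \<kappa>')
      show ?thesis
      proof (cases "\<kappa>' \<le> \<kappa>")
        case True
        show ?thesis by (rule circular_angles_unique_aux[OF I c c' True i, symmetric])
      next
        case False
        then show ?thesis by (intro circular_angles_unique_aux[OF I c' c _ i]) simp
      qed
    next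
      case (degenerate m)
      then show ?thesis using circular_angles_polygon_inequality[OF I c, of m] by simp
    qed
  next
    case d: (degenerate m)
    show ?thesis
    using I(1) a ang(2)
    proof (cases rule: closing_angles_cases)
      case (circular \<kappa>)
      then show ?thesis using circular_angles_polygon_inequality[OF I circular, of m] d by simp
    next
      case d': (degenerate m')
      have "m' = m" by (rule degen[OF d(1) d'(1) d(4) d'(4)])
      then show ?thesis using d d' i by (cases "i = m") auto
    qed
  qed
qed

lemma degenerate_closing_angles:
  assumes I: "finite I" and m: "m \<in> I" and eq: "a m = sum a (I - {m})"
    and a: "\<forall>i\<in>I. 0 < a i"
  shows "closing_angles I a (\<lambda>i. if i = m then pi else 0)"
proof -
  have "- sum a (I - {i}) \<le> a i" if "i \<in> I" for i
    using sum_nonneg[of "I - {i}" a] a that by (force intro: less_imp_le order_trans[of _ 0])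
  then show ?thesis
    using assms by (auto simp: closing_angles_def)
qed

text \<open>Let \<kappa> increase from 0 to \<open>1 / a m\<close>, the largest value for which all
  prescribed sines are at most 1. If the arcsines add up to \<pi> on the way, they are the angles.
  Otherwise the angle of the longest side is continued past \<open>pi / 2\<close> as
  \<open>pi - arcsin (\<kappa> * a m)\<close> while \<kappa> decreases again.\<close>

lemma circular_angles_exist:
  assumes I: "finite I" "card I \<ge> 3" and a: "\<forall>i\<in>I. 0 < a i"
    and ineq: "\<forall>i\<in>I. a i < sum a (I - {i})"
  obtains \<kappa> \<alpha> where "circular_angles I a \<kappa> \<alpha>"
proof -
  have "I \<noteq> {}" using I by auto
  then obtain m where "m \<in> I" "a m = Max (a ` I)"
    using Max_in[of "a ` I"] I(1) by fastforce
  then have m: "m \<in> I" "\<And>i. i \<in> I \<Longrightarrow> a i \<le> a m"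
    using I(1) by auto
  define K where "K = 1 / a m"
  have am: "0 < a m" using a m by simp
  have K: "0 < K" "K * a m = 1" using am by (auto simp: K_def)
  have bound: "0 \<le> \<kappa> * a i" "\<kappa> * a i \<le> 1" if "i \<in> I" "0 \<le> \<kappa>" "\<kappa> \<le> K" for i \<kappa>
  proof -
    have "\<kappa> * a i \<le> K * a m" using that m a by (intro mult_mono) auto
    then show "\<kappa> * a i \<le> 1" using K by simp
    show "0 \<le> \<kappa> * a i" using that a by (intro mult_nonneg_nonneg) auto
  qed
  define \<phi> where "\<phi> \<kappa> = (\<Sum>i\<in>I - {m}. arcsin (\<kappa> * a i))" for \<kappa>
  have cont: "continuous_on {0..K} (\<lambda>\<kappa>. arcsin (\<kappa> * a i))" if "i \<in> I" for i
    using bound[OF that] by (intro continuous_intros) (force intro: order_trans[of "-1" 0])+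
  have cont\<phi>: "continuous_on {0..K} \<phi>"
    unfolding \<phi>_def using cont by (intro continuous_on_sum) auto
  have arc: "0 < arcsin (\<kappa> * a i)" "arcsin (\<kappa> * a i) \<le> pi / 2" "sin (arcsin (\<kappa> * a i)) = \<kappa> * a i"
    if "i \<in> I" "0 < \<kappa>" "\<kappa> \<le> K" for i \<kappa>
  proof -
    have "0 < \<kappa> * a i" using that a by simp
    then show "0 < arcsin (\<kappa> * a i)" using bound[of i \<kappa>] that arcsin_less_mono[of 0 "\<kappa> * a i"] by simp
    show "arcsin (\<kappa> * a i) \<le> pi / 2"
      using bound[of i \<kappa>] that by (intro arcsin_ubound) auto
    show "sin (arcsin (\<kappa> * a i)) = \<kappa> * a i"
      using bound[of i \<kappa>] that by (intro sin_arcsin) auto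
  qed
  have arcK: "arcsin (K * a m) = pi / 2" using K by simp
  show ?thesis
  proof (cases "\<phi> K \<ge> pi / 2")
    case True
    have "continuous_on {0..K} (\<lambda>\<kappa>. \<phi> \<kappa> + arcsin (\<kappa> * a m))"
      by (intro continuous_on_add cont\<phi> cont m(1))
    then obtain \<kappa> where \<kappa>: "0 \<le> \<kappa>" "\<kappa> \<le> K" "\<phi> \<kappa> + arcsin (\<kappa> * a m) = pi"
      using IVT'[of "\<lambda>\<kappa>. \<phi> \<kappa> + arcsin (\<kappa> * a m)" 0 pi K] True arcK K by (auto simp: \<phi>_def)
    have "\<kappa> \<noteq> 0" using \<kappa>(3) by (auto simp: \<phi>_def)
    then have "0 < \<kappa>" using \<kappa>(1) by simp
    moreover have "(\<Sum>i\<in>I. arcsin (\<kappa> * a i)) = pi"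
      using \<kappa>(3) I m by (simp add: \<phi>_def sum.remove)
    moreover have "arcsin (\<kappa> * a i) < pi" if "i \<in> I" for i
      using arc(2)[OF that \<open>0 < \<kappa>\<close> \<kappa>(2)] pi_gt_zero by linarith
    ultimately have "circular_angles I a \<kappa> (\<lambda>i. arcsin (\<kappa> * a i))"
      using arc \<kappa>(2) by (simp add: circular_angles_def)
    then show ?thesis by (rule that)
  next
    case False
    \<comment> \<open>A zero of \<psi> closes the polygon with a non-acute angle at
      \<open>m\<close>. There is a trivial zero at 0; the strict polygon inequality is positivity of
      the derivative there, and it provides a point \<open>h > 0\<close> from which the intermediate
      value theorem can start.\<close>
    define \<psi> where "\<psi> \<kappa> = \<phi> \<kappa> - arcsin (\<kappa> * a m)" for \<kappa>
    have "(\<psi> has_real_derivative (\<Sum>i\<in>I - {m}. a i) - a m) (at 0)"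
      unfolding \<psi>_def \<phi>_def by (auto intro!: derivative_eq_intros)
    moreover have "0 < (\<Sum>i\<in>I - {m}. a i) - a m" using ineq m by simp
    ultimately obtain d where d: "d > 0" "\<And>h. 0 < h \<Longrightarrow> h < d \<Longrightarrow> \<psi> 0 < \<psi> (0 + h)"
      by (metis DERIV_pos_inc_right)
    define h where "h = min K (d / 2)"
    have h: "0 < h" "h \<le> K" "h < d" using K d by (auto simp: h_def)
    have "0 < \<psi> h" using d(2)[OF h(1,3)] by (simp add: \<psi>_def \<phi>_def)
    moreover have "\<psi> K < 0" using False arcK by (simp add: \<psi>_def)
    moreover have "continuous_on {h..K} \<psi>"
      unfolding \<psi>_def using h
      by (intro continuous_on_diff continuous_on_subset[OF cont\<phi>] continuous_on_subset[OF cont[OF m(1)]]) auto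
    ultimately obtain \<kappa> where \<kappa>: "h \<le> \<kappa>" "\<kappa> \<le> K" "\<psi> \<kappa> = 0"
      using IVT2'[of \<psi> K 0 h] h by auto
    have \<kappa>0: "0 < \<kappa>" using \<kappa> h by simp
    define \<alpha> where "\<alpha> i = (if i = m then pi - arcsin (\<kappa> * a m) else arcsin (\<kappa> * a i))" for i
    have "sum \<alpha> I = \<alpha> m + sum \<alpha> (I - {m})" using I m by (simp add: sum.remove)
    also have "sum \<alpha> (I - {m}) = \<phi> \<kappa>" unfolding \<phi>_def by (intro sum.cong) (auto simp: \<alpha>_def)
    finally have "sum \<alpha> I = pi" using \<kappa>(3) by (simp add: \<alpha>_def \<psi>_def)
    moreover have "0 < \<alpha> i \<and> \<alpha> i < pi \<and> sin (\<alpha> i) = \<kappa> * a i" if "i \<in> I" for i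
      using arc[OF that \<kappa>0 \<kappa>(2)] arc[OF m(1) \<kappa>0 \<kappa>(2)] pi_gt_zero by (auto simp: \<alpha>_def)
    ultimately have "circular_angles I a \<kappa> \<alpha>"
      using \<kappa>0 by (simp add: circular_angles_def)
    then show ?thesis by (rule that)
  qed
qed

section \<open>Positivity of the area of a cyclic polygon\<close>

lemma arccos_inverse_sqrt:
  assumes "0 \<le> x"
  shows "arccos (1 / sqrt (1 + x\<^sup>2)) = arctan x"
proof -
  have "0 \<le> arctan x" using assms by simp
  moreover have "arctan x \<le> pi" using arctan_ubound[of x] pi_gt_zero by linarith
  ultimately show ?thesis using arccos_cos[of "arctan x"] by (simp add: cos_arctan)
qed

text \<open>For \<open>\<kappa> = 1 / sinh r\<close> the factor
  \<open>sqrt (1 + 1 / \<kappa>\<^sup>2)\<close> is \<open>cosh r\<close>, and the identity is the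
  relation \<open>cosh r = cot x * cot \<beta>\<close> in a right triangle with hypotenuse
  \<open>r\<close> and acute angles \<open>x\<close> and \<beta>.\<close>

lemma arccos_eq_arctan_tan:
  assumes "0 \<le> x" "x < pi / 2" "0 < \<kappa>"
  shows "arccos (cos x / sqrt (1 + (sin x / \<kappa>)\<^sup>2)) = arctan (sqrt (1 + 1 / \<kappa>\<^sup>2) * tan x)"
proof -
  have c: "0 < cos x" using assms by (intro cos_gt_zero_pi) auto
  have "1 + (sqrt (1 + 1 / \<kappa>\<^sup>2) * tan x)\<^sup>2 = (1 + (sin x / \<kappa>)\<^sup>2) / (cos x)\<^sup>2"
    using c assms by (simp add: tan_def power_mult_distrib power_divide field_simps sin_squared_eq)
  then have "sqrt (1 + (sqrt (1 + 1 / \<kappa>\<^sup>2) * tan x)\<^sup>2) = sqrt (1 + (sin x / \<kappa>)\<^sup>2) / cos x"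
    using c by (simp add: real_sqrt_divide)
  moreover have "0 \<le> sqrt (1 + 1 / \<kappa>\<^sup>2) * tan x"
    using assms c by (simp add: tan_def sin_ge_zero)
  ultimately show ?thesis using arccos_inverse_sqrt[of "sqrt (1 + 1 / \<kappa>\<^sup>2) * tan x"] by simp
qed

text \<open>Concavity comes from \<open>C > 1\<close>: the derivative
  \<open>C / (1 + (C\<^sup>2 - 1) * (sin x)\<^sup>2)\<close> then decreases. For
  \<open>C = 1\<close> the function is the identity, which is the Euclidean limit of the
  picture.\<close>

lemma isosceles_angle_sum_less:
  assumes I: "finite I" "card I \<ge> 2" and x: "\<And>i. i \<in> I \<Longrightarrow> 0 < x i" and S: "sum x I < pi / 2" and C: "1 < (C::real)"
  shows "arctan (C * tan (sum x I)) < (\<Sum>i\<in>I. arctan (C * tan (x i)))"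
proof (rule strictly_subadditive_sum[where b = "sum x I" and x = x and g = "\<lambda>x. arctan (C * tan x)"
      and g' = "\<lambda>x. C / (1 + (C\<^sup>2 - 1) * (sin x)\<^sup>2)"])
  have C2: "0 < C\<^sup>2 - 1" using C by (simp add: power2_eq_square less_1_mult)
  have cpos: "0 < cos y" if "0 \<le> y" "y \<le> sum x I" for y
    using that S by (intro cos_gt_zero_pi) auto
  show "continuous_on {0..sum x I} (\<lambda>x. arctan (C * tan x))"
    using cpos by (intro continuous_intros) (auto simp: less_le)
  fix y assume y: "0 < y" "y < sum x I"
  have c: "cos y > 0" using cpos y by auto
  have "1 + (C * tan y)\<^sup>2 = ((cos y)\<^sup>2 + C\<^sup>2 * (sin y)\<^sup>2) / (cos y)\<^sup>2"
    using c by (simp add: tan_def power_mult_distrib power_divide add_divide_distrib)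
  also have "(cos y)\<^sup>2 + C\<^sup>2 * (sin y)\<^sup>2 = 1 + (C\<^sup>2 - 1) * (sin y)\<^sup>2"
    by (simp add: cos_squared_eq algebra_simps)
  finally have "1 + (C * tan y)\<^sup>2 = (1 + (C\<^sup>2 - 1) * (sin y)\<^sup>2) / (cos y)\<^sup>2" .
  moreover have "0 < 1 + (C\<^sup>2 - 1) * (sin y)\<^sup>2" using C2 by (intro add_pos_nonneg) auto
  ultimately have "inverse (1 + (C * tan y)\<^sup>2) * (C * inverse ((cos y)\<^sup>2)) = C / (1 + (C\<^sup>2 - 1) * (sin y)\<^sup>2)"
    using c by (simp add: divide_inverse)
  moreover have "((\<lambda>x. arctan (C * tan x)) has_real_derivative
      inverse (1 + (C * tan y)\<^sup>2) * (C * inverse ((cos y)\<^sup>2))) (at y)"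
    using c by (auto intro!: derivative_eq_intros)
  ultimately show "((\<lambda>x. arctan (C * tan x)) has_real_derivative C / (1 + (C\<^sup>2 - 1) * (sin y)\<^sup>2)) (at y)"
    by simp
next
  fix y z assume yz: "0 < y" "y < z" "z < sum x I"
  have C2: "0 < C\<^sup>2 - 1" using C by (simp add: power2_eq_square less_1_mult)
  have "sin y < sin z" "0 < sin y" using yz S by (auto intro!: sin_monotone_2pi sin_gt_zero)
  then have "(sin y)\<^sup>2 < (sin z)\<^sup>2" by (intro power_strict_mono) auto
  then have "(C\<^sup>2 - 1) * (sin y)\<^sup>2 < (C\<^sup>2 - 1) * (sin z)\<^sup>2" using C2 by simp
  moreover have "0 \<le> (C\<^sup>2 - 1) * (sin y)\<^sup>2" using C2 by simp
  ultimately show "C / (1 + (C\<^sup>2 - 1) * (sin z)\<^sup>2) < C / (1 + (C\<^sup>2 - 1) * (sin y)\<^sup>2)"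
    using C by (intro divide_strict_left_mono mult_pos_pos) linarith+
qed (use assms in auto)

text \<open>The right-hand sum is \<open>\<Sum> (\<pi> / 2 - \<beta>)\<close> over the base angles \<open>\<beta>\<close> of the isosceles triangles
  spanned by the sides and the centre, \<open>\<beta>\<close> being negative for the side that separates the centre
  from the polygon, so that twice its excess over \<open>\<pi>\<close> is the area.\<close>

lemma circular_angles_area_pos:
  assumes I: "finite I" "card I \<ge> 3" and ang: "circular_angles I a \<kappa> \<alpha>"
  shows "pi < (\<Sum>i\<in>I. arccos (cos (\<alpha> i) / sqrt (1 + (a i)\<^sup>2)))"
proof -
  note D = circular_anglesD[OF ang]
  note \<kappa> = D(1) and sum = D(2) and \<alpha> = D(3-5)
  have a: "a i = sin (\<alpha> i) / \<kappa>" if "i \<in> I" for i using \<alpha>(3)[OF that] \<kappa> by simp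
  have apos: "a i > 0" if "i \<in> I" for i
    unfolding a[OF that] using \<alpha> that \<kappa> by (intro divide_pos_pos sin_gt_zero) auto
  define C where "C = sqrt (1 + 1 / \<kappa>\<^sup>2)"
  have C: "1 < C" using \<kappa> by (simp add: C_def)
  have g: "arccos (cos (\<alpha> i) / sqrt (1 + (a i)\<^sup>2)) = arctan (C * tan (\<alpha> i))" if "i \<in> I" "\<alpha> i < pi / 2" for i
    using arccos_eq_arctan_tan[of "\<alpha> i" \<kappa>] that \<alpha>(1)[OF that(1)] \<kappa> a[OF that(1)] by (simp add: C_def)
  have ge: "\<alpha> i < arctan (C * tan (\<alpha> i))" if "i \<in> I" "\<alpha> i < pi / 2" for i
  proof -
    have "tan (\<alpha> i) < C * tan (\<alpha> i)" using C tan_gt_zero[of "\<alpha> i"] \<alpha>(1) that by simp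
    then have "arctan (tan (\<alpha> i)) < arctan (C * tan (\<alpha> i))" by (rule arctan_monotone)
    then show ?thesis using arctan_tan[of "\<alpha> i"] that \<alpha>(1)[OF that(1)] by simp
  qed
  show ?thesis
  proof (cases "\<exists>m\<in>I. \<alpha> m > pi / 2")
    \<comment> \<open>No obtuse angle: since \<open>C > 1\<close>, each summand is at least its
      angle, with equality only at \<open>pi / 2\<close>, and three or more angles with sum \<pi>
      cannot all be right.\<close>
    case False
    have small: "\<exists>i\<in>I. \<alpha> i < pi / 2"
    proof (rule ccontr)
      assume "\<not> ?thesis"
      then have "real (card I) * (pi / 2) \<le> sum \<alpha> I" by (intro sum_bounded_below) auto
      moreover have "3 * (pi / 2) \<le> real (card I) * (pi / 2)" using I(2) by (intro mult_right_mono) auto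
      ultimately show False using sum pi_gt_zero by linarith
    qed
    have le: "\<alpha> i \<le> arccos (cos (\<alpha> i) / sqrt (1 + (a i)\<^sup>2))" if "i \<in> I" for i
    proof (cases "\<alpha> i = pi / 2")
      case True
      show ?thesis unfolding True by simp
    next
      case neq: False
      then have "\<alpha> i < pi / 2" using False that by force
      then show ?thesis using ge[OF that] g[OF that] by simp
    qed
    obtain i where "i \<in> I" "\<alpha> i < pi / 2" using small by blast
    then have "\<exists>i\<in>I. \<alpha> i < arccos (cos (\<alpha> i) / sqrt (1 + (a i)\<^sup>2))"
      using ge g by (intro bexI[of _ i]) simp_all
    then have "sum \<alpha> I < (\<Sum>i\<in>I. arccos (cos (\<alpha> i) / sqrt (1 + (a i)\<^sup>2)))"
      using I(1) le by (intro sum_strict_mono_ex1) simp_all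
    then show ?thesis using sum by simp
  next
    \<comment> \<open>The side \<open>m\<close> separates the centre from the polygon. Its summand
      is \<open>pi - arctan (C * tan S)\<close>, so the arctangents of the acute angles have to
      exceed \<open>arctan (C * tan S)\<close>.\<close>
    case True
    then obtain m where m: "m \<in> I" "pi / 2 < \<alpha> m" by blast
    define S where "S = sum \<alpha> (I - {m})"
    have S: "S = pi - \<alpha> m" unfolding S_def by (rule sum_Diff_eq_pi[OF I(1) m(1) sum])
    have small: "\<alpha> i < pi / 2" if "i \<in> I - {m}" for i
      using member_le_sum[OF that, of \<alpha>] I \<alpha> m S by (force simp: S_def intro: less_imp_le)
    have "cos (\<alpha> m) / sqrt (1 + (a m)\<^sup>2) = - (cos S / sqrt (1 + (sin S / \<kappa>)\<^sup>2))"
      using a[OF m(1)] S by simp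
    moreover have "\<bar>cos S / sqrt (1 + (sin S / \<kappa>)\<^sup>2)\<bar> \<le> 1"
    proof -
      have "\<bar>cos S\<bar> / sqrt (1 + (sin S / \<kappa>)\<^sup>2) \<le> 1 / 1" by (intro frac_le) auto
      then show ?thesis by (simp add: abs_divide)
    qed
    ultimately have "arccos (cos (\<alpha> m) / sqrt (1 + (a m)\<^sup>2)) = pi - arccos (cos S / sqrt (1 + (sin S / \<kappa>)\<^sup>2))"
      by (simp only: arccos_minus abs_le_iff minus_le_iff)
    also have "\<dots> = pi - arctan (C * tan S)"
      using arccos_eq_arctan_tan[of S \<kappa>] S m \<alpha>[OF m(1)] \<kappa> by (simp add: C_def)
    finally have "arccos (cos (\<alpha> m) / sqrt (1 + (a m)\<^sup>2)) = pi - arctan (C * tan S)" .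
    moreover have "arctan (C * tan S) < (\<Sum>i\<in>I - {m}. arctan (C * tan (\<alpha> i)))"
      unfolding S_def using I m \<alpha> S C by (intro isosceles_angle_sum_less) (auto simp: S_def)
    moreover have "\<dots> = (\<Sum>i\<in>I - {m}. arccos (cos (\<alpha> i) / sqrt (1 + (a i)\<^sup>2)))"
      using g small by (intro sum.cong) auto
    ultimately show ?thesis using I m by (simp add: sum.remove[of I m])
  qed
qed

section \<open>Change of variables in the complex plane\<close>

lemma measurable_Complex_pair: "(\<lambda>(x, y). Complex x y) \<in> (lborel \<Otimes>\<^sub>M lborel) \<rightarrow>\<^sub>M borel"
  unfolding lborel_prod Complex_eq case_prod_beta measurable_lborel2
  by (intro borel_measurable_continuous_onI continuous_intros)

text \<open>Agreement on boxes suffices. The description by pairs serves Fubini; the one by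
  \<open>real ^ 2\<close> serves the transformation formula for integrals.\<close>

lemma lborel_complex_eq_distr_pair:
  "(lborel :: complex measure) = distr (lborel \<Otimes>\<^sub>M lborel) borel (\<lambda>(x, y). Complex x y)"
proof (rule lborel_eqI)
  fix l u :: complex
  assume le: "\<And>b. b \<in> Basis \<Longrightarrow> l \<bullet> b \<le> u \<bullet> b"
  have lu: "Re l \<le> Re u" "Im l \<le> Im u" using le[of 1] le[of \<i>] by (auto simp: Basis_complex_def)
  have vim: "(\<lambda>(x, y). Complex x y) -` box l u \<inter> space (lborel \<Otimes>\<^sub>M lborel) = {Re l<..<Re u} \<times> {Im l<..<Im u}"
    by (auto simp: box_Complex_eq space_pair_measure in_box_complex_iff)
  show "emeasure (distr (lborel \<Otimes>\<^sub>M lborel) borel (\<lambda>(x, y). Complex x y)) (box l u) = (\<Prod>b\<in>Basis. (u - l) \<bullet> b)"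
    using lu by (subst emeasure_distr[OF measurable_Complex_pair], simp, subst vim,
      subst lborel.emeasure_pair_measure_Times) (auto simp: Basis_complex_def ennreal_mult)
qed simp

definition cart_complex :: "real ^ 2 \<Rightarrow> complex" where
  "cart_complex v = Complex (v $ 1) (v $ 2)"

definition complex_cart :: "complex \<Rightarrow> real ^ 2" where
  "complex_cart z = vector [Re z, Im z]"

lemma cart_complex_inverse [simp]: "complex_cart (cart_complex v) = v" "cart_complex (complex_cart z) = z"
  by (simp_all add: cart_complex_def complex_cart_def vec_eq_iff forall_2)

lemma bounded_linear_cart_complex: "bounded_linear cart_complex" "bounded_linear complex_cart"
  by (auto intro!: linear_conv_bounded_linear[THEN iffD1] linearI
      simp: cart_complex_def complex_cart_def complex_eq_iff vec_eq_iff forall_2)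

lemma lborel_complex_eq_distr_cart: "(lborel :: complex measure) = distr lborel borel cart_complex"
proof (rule lborel_eqI)
  fix l u :: complex
  assume le: "\<And>b. b \<in> Basis \<Longrightarrow> l \<bullet> b \<le> u \<bullet> b"
  have lu: "Re l \<le> Re u" "Im l \<le> Im u" using le[of 1] le[of \<i>] by (auto simp: Basis_complex_def)
  have meas: "cart_complex \<in> lborel \<rightarrow>\<^sub>M borel"
    using bounded_linear_cart_complex(1)
    by (simp add: borel_measurable_continuous_onI linear_continuous_on)
  have vim: "cart_complex -` box l u \<inter> space lborel = box (complex_cart l) (complex_cart u)"
    by (auto simp: mem_box_cart forall_2 in_box_complex_iff complex_cart_def cart_complex_def)
  have ax: "axis 1 (1::real) \<noteq> (axis 2 1 :: real ^ 2)" by (simp add: axis_eq_axis)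
  have B: "(Basis :: (real ^ 2) set) = {axis 1 1, axis 2 1}" by (auto simp: Basis_vec_def UNIV_2)
  show "emeasure (distr lborel borel cart_complex) (box l u) = (\<Prod>b\<in>Basis. (u - l) \<bullet> b)"
    using lu ax by (subst emeasure_distr[OF meas], simp, subst vim)
      (auto simp: emeasure_lborel_box_eq B Basis_complex_def inner_axis complex_cart_def)
qed simp

text \<open>The real-linear map \<open>\<lambda>h. p * h + q * cnj h\<close> has determinant
  \<open>(norm p)\<^sup>2 - (norm q)\<^sup>2\<close>, so derivatives can stay in Wirtinger form and
  no matrix occurs in the applications. Compactness and continuity supply the integrability required
  by the transformation formula.\<close>

lemma nn_integral_complex_change_of_variables:
  fixes g p q :: "complex \<Rightarrow> complex" and f :: "complex \<Rightarrow> real"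
  assumes S: "compact S" and inj: "inj_on g S"
    and der: "\<And>z. z \<in> S \<Longrightarrow> (g has_derivative (\<lambda>h. p z * h + q z * cnj h)) (at z within S)"
    and cont: "continuous_on S p" "continuous_on S q" "continuous_on (g ` S) f"
    and nonneg: "\<And>w. w \<in> g ` S \<Longrightarrow> 0 \<le> f w"
  shows "(\<integral>\<^sup>+w. ennreal (f w) * indicator (g ` S) w \<partial>lborel) =
    (\<integral>\<^sup>+z. ennreal (\<bar>(norm (p z))\<^sup>2 - (norm (q z))\<^sup>2\<bar> * f (g z)) * indicator S z \<partial>lborel)"
proof -
  define J where "J z = \<bar>(norm (p z))\<^sup>2 - (norm (q z))\<^sup>2\<bar>" for z
  define G where "G = complex_cart \<circ> g \<circ> cart_complex"
  define G' where "G' v = (\<lambda>h. complex_cart (p (cart_complex v) * cart_complex h + q (cart_complex v) * cnj (cart_complex h)))" for v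
  define T where "T = complex_cart ` S"
  have contg: "continuous_on S g"
    using der by (meson continuous_on_eq_continuous_within has_derivative_continuous)
  have gS: "compact (g ` S)" by (rule compact_continuous_image[OF contg S])
  have contc: "continuous_on X cart_complex" "continuous_on Y complex_cart" for X Y
    using bounded_linear_cart_complex by (auto intro: linear_continuous_on)
  have T: "compact T" unfolding T_def by (rule compact_continuous_image[OF contc(2) S])
  have GT: "G ` T = complex_cart ` g ` S" by (auto simp: G_def T_def image_image)
  have cGT: "compact (G ` T)" unfolding GT by (rule compact_continuous_image[OF contc(2) gS])
  have inT: "cart_complex v \<in> S" if "v \<in> T" for v using that by (auto simp: T_def)
  have derG: "(G has_derivative G' v) (at v within T)" if "v \<in> T" for v
  proof -
    have "(g has_derivative (\<lambda>h. p (cart_complex v) * h + q (cart_complex v) * cnj h))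
        (at (cart_complex v) within cart_complex ` T)"
      using der[OF inT[OF that]] by (simp add: T_def image_image)
    from bounded_linear.has_derivative[OF bounded_linear_cart_complex(2) has_derivative_in_compose[OF
          bounded_linear.has_derivative[OF bounded_linear_cart_complex(1) has_derivative_ident] this]]
    have "((\<lambda>v. complex_cart (g (cart_complex v))) has_derivative G' v) (at v within T)"
      by (simp add: G'_def)
    then show ?thesis by (simp add: G_def o_def)
  qed
  have injG: "inj_on G T"
  proof (rule inj_onI)
    fix v w assume vw: "v \<in> T" "w \<in> T" "G v = G w"
    then have "g (cart_complex v) = g (cart_complex w)"
      unfolding G_def o_def by (metis cart_complex_inverse(2))
    then show "v = w" using inj_onD[OF inj _ inT inT] vw by (metis cart_complex_inverse(1))
  qed
  have det: "\<bar>det (matrix (G' v))\<bar> = J (cart_complex v)" for v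
    unfolding J_def cmod_power2
    by (simp add: det_2 matrix_def G'_def complex_cart_def cart_complex_def axis_def
        power2_eq_square algebra_simps)
  \<comment> \<open>The transformation formula speaks of vector-valued functions, whence the detour
    through \<open>real ^ 1\<close>.\<close>
  let ?F = "\<lambda>v. vec (f (cart_complex v)) :: real ^ 1"
  have contF: "continuous_on (G ` T) (\<lambda>v. f (cart_complex v))"
    using cont(3) unfolding GT by (intro continuous_on_compose2[OF _ contc(1)]) auto
  have "(\<lambda>v. f (cart_complex v)) absolutely_integrable_on G ` T"
    using borel_integrable_compact[OF cGT contF] cGT
    by (auto simp: set_integrable_def integrable_completion borel_measurable_integrable)
  then have "?F absolutely_integrable_on G ` T \<and> integral (G ` T) ?F = integral (G ` T) ?F"
    by (simp add: absolutely_integrable_on_1_iff)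
  then have "(\<lambda>v. \<bar>det (matrix (G' v))\<bar> *\<^sub>R ?F (G v)) absolutely_integrable_on T \<and>
      integral T (\<lambda>v. \<bar>det (matrix (G' v))\<bar> *\<^sub>R ?F (G v)) = integral (G ` T) ?F"
    by (subst has_absolute_integral_change_of_variables)
      (use T derG injG in \<open>auto simp: compact_imp_closed lmeasurable_compact fmeasurableD\<close>)
  then have L: "(\<lambda>v. J (cart_complex v) * f (cart_complex (G v))) absolutely_integrable_on T"
     "integral T (\<lambda>v. J (cart_complex v) * f (cart_complex (G v))) = integral (G ` T) (\<lambda>v. f (cart_complex v))"
    by (simp_all add: det absolutely_integrable_on_1_iff integral_on_1_eq)
  have nnR2: "(\<integral>\<^sup>+v. ennreal (f (cart_complex v)) * indicator (G ` T) v \<partial>lborel) =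
    (\<integral>\<^sup>+v. ennreal (J (cart_complex v) * f (cart_complex (G v))) * indicator T v \<partial>lborel)"
  proof -
    have "(\<integral>\<^sup>+v. ennreal (f (cart_complex v)) * indicator (G ` T) v \<partial>lborel) =
      ennreal (integral (G ` T) (\<lambda>v. f (cart_complex v)))"
      using \<open>(\<lambda>v. f (cart_complex v)) absolutely_integrable_on G ` T\<close> nonneg
      by (intro nn_integral_has_integral_lebesgue' integrable_integral)
        (auto simp: GT absolutely_integrable_on_def)
    moreover have "(\<integral>\<^sup>+v. ennreal (J (cart_complex v) * f (cart_complex (G v))) * indicator T v \<partial>lborel) =
      ennreal (integral T (\<lambda>v. J (cart_complex v) * f (cart_complex (G v))))"
      using L(1) nonneg inT
      by (intro nn_integral_has_integral_lebesgue' integrable_integral)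
        (auto simp: G_def J_def absolutely_integrable_on_def)
    ultimately show ?thesis using L(2) by simp
  qed
  have meas_c: "cart_complex \<in> lborel \<rightarrow>\<^sub>M borel"
    by (simp add: borel_measurable_continuous_onI contc)
  have transfer: "(\<integral>\<^sup>+z. ennreal (h z) * indicator A z \<partial>lborel) =
      (\<integral>\<^sup>+v. ennreal (h (cart_complex v)) * indicator (complex_cart ` A) v \<partial>lborel)"
    if "compact A" "continuous_on A h" for h A
  proof -
    have "(\<lambda>x. indicator A x *\<^sub>R h x) \<in> borel_measurable borel"
      using that by (intro borel_measurable_continuous_on_indicator) (auto intro: borel_compact)
    then have "(\<lambda>x. ennreal (indicator A x *\<^sub>R h x)) \<in> borel_measurable borel" by measurable
    moreover have eq: "ennreal (indicator A x *\<^sub>R h x) = ennreal (h x) * indicator A x" for x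
      by (simp add: indicator_def)
    ultimately have meas: "(\<lambda>x. ennreal (h x) * indicator A x) \<in> borel_measurable borel" by simp
    have ind: "indicator (complex_cart ` A) v = (indicator A (cart_complex v) :: ennreal)" for v
      by (auto simp: indicator_def image_iff) (metis cart_complex_inverse(1))
    show ?thesis
      by (subst lborel_complex_eq_distr_cart, subst nn_integral_distr[OF meas_c]) (simp_all add: ind meas)
  qed
  have "continuous_on S (\<lambda>z. J z * f (g z))"
    unfolding J_def using cont contg by (intro continuous_intros continuous_on_compose2[OF cont(3)]) auto
  from transfer[OF S this] transfer[OF gS cont(3)] nnR2
  show ?thesis by (simp add: GT[symmetric] T_def[symmetric] J_def[symmetric] G_def)
qed

section \<open>Circular caps in the Klein disc\<close>

text \<open>The area density of curvature -1 in the Klein model: \<open>1 - (norm w)\<^sup>2\<close>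
  to the power -3/2.\<close>

definition klein_density :: "complex \<Rightarrow> real" where
  "klein_density w = 1 / sqrt (1 - (norm w)\<^sup>2) ^ 3"

definition klein_cap :: "real \<Rightarrow> real \<Rightarrow> real \<Rightarrow> complex set" where
  "klein_cap s m x = {w. norm w \<le> s \<and> x \<le> cis m \<bullet> w}"

text \<open>Sector minus signed isosceles triangle. For \<open>s = tanh r\<close> and
  \<open>x = s * cos \<alpha>\<close> the sector has area \<open>2 * \<alpha> * (cosh r - 1)\<close>
  and the triangle \<open>2 * (pi / 2 - \<beta>) - 2 * \<alpha>\<close>; the terms
  \<open>2 * \<alpha>\<close> cancel, and the second arccosine is
  \<open>pi / 2 - \<beta>\<close>.\<close>

definition cap_area :: "real \<Rightarrow> real \<Rightarrow> real" where
  "cap_area s x = 2 / sqrt (1 - s\<^sup>2) * arccos (x / s) - 2 * arccos (sqrt (1 - s\<^sup>2) / s * x / sqrt (1 - x\<^sup>2))"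

lemma nn_integral_klein_strip:
  assumes s: "0 < s" "s < 1" and x: "\<bar>x\<bar> \<le> s"
  shows "(\<integral>\<^sup>+y. ennreal (klein_density (Complex x y)) * indicator {- sqrt (s\<^sup>2 - x\<^sup>2)..sqrt (s\<^sup>2 - x\<^sup>2)} y \<partial>lborel)
    = ennreal (2 * sqrt (s\<^sup>2 - x\<^sup>2) / ((1 - x\<^sup>2) * sqrt (1 - s\<^sup>2)))"
proof -
  define b where "b = sqrt (s\<^sup>2 - x\<^sup>2)"
  have xs: "x\<^sup>2 \<le> s\<^sup>2" using x s by (metis abs_le_square_iff abs_of_pos)
  have s1: "s\<^sup>2 < 1" using s by (simp add: abs_square_less_1)
  have b: "0 \<le> b" "b\<^sup>2 = s\<^sup>2 - x\<^sup>2" using xs by (auto simp: b_def)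
  have x1: "0 < 1 - x\<^sup>2" using xs s1 by simp
  \<comment> \<open>\<open>y / (k * sqrt (k - y\<^sup>2))\<close> is the antiderivative of
    \<open>(k - y\<^sup>2)\<close> to the power -3/2, here with
    \<open>k = 1 - x\<^sup>2\<close>.\<close>
  define F where "F y = y / ((1 - x\<^sup>2) * sqrt (1 - x\<^sup>2 - y\<^sup>2))" for y
  have der: "(F has_real_derivative klein_density (Complex x y)) (at y)" if "-b \<le> y" "y \<le> b" for y
  proof -
    have "y\<^sup>2 \<le> b\<^sup>2" using that b(1) by (simp add: power2_le_iff_abs_le abs_le_iff)
    then have pos: "0 < 1 - x\<^sup>2 - y\<^sup>2" using b s1 by simp
    define r where "r = sqrt (1 - x\<^sup>2 - y\<^sup>2)"
    have r: "0 < r" "r\<^sup>2 = 1 - x\<^sup>2 - y\<^sup>2" using pos by (auto simp: r_def)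
    have "(F has_real_derivative ((1 - x\<^sup>2) * r - y * ((1 - x\<^sup>2) * (- (2 * y) * (inverse r / 2)))) / ((1 - x\<^sup>2) * r)\<^sup>2) (at y)"
      unfolding F_def[abs_def] using pos x1 r(1) unfolding r_def
      by (auto intro!: derivative_eq_intros simp: power2_eq_square)
    also have "((1 - x\<^sup>2) * r - y * ((1 - x\<^sup>2) * (- (2 * y) * (inverse r / 2)))) / ((1 - x\<^sup>2) * r)\<^sup>2 =
       (r\<^sup>2 + y\<^sup>2) / ((1 - x\<^sup>2) * r ^ 3)"
    proof -
      have "(k * r - y * (k * (- (2 * y) * (inverse r / 2)))) / (k * r)\<^sup>2 = (r\<^sup>2 + y\<^sup>2) / (k * r ^ 3)" if "0 < k" for k
        using that r(1) by (simp add: field_simps power2_eq_square power3_eq_cube)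
      from this[OF x1] show ?thesis .
    qed
    also have "r\<^sup>2 + y\<^sup>2 = 1 - x\<^sup>2" using r(2) by simp
    also have "(1 - x\<^sup>2) / ((1 - x\<^sup>2) * r ^ 3) = klein_density (Complex x y)"
      using x1 by (simp add: klein_density_def r_def cmod_power2 diff_diff_eq)
    finally show ?thesis .
  qed
  have "((\<lambda>y. klein_density (Complex x y)) has_integral (F b - F (- b))) {- b..b}"
    using b(1) der by (intro fundamental_theorem_of_calculus)
      (auto simp: has_real_derivative_iff_has_vector_derivative[symmetric] intro: has_field_derivative_at_within)
  moreover have "0 \<le> klein_density (Complex x y)" if "y \<in> {-b..b}" for y
  proof -
    have "y\<^sup>2 \<le> b\<^sup>2" using that b(1) by (simp add: power2_le_iff_abs_le abs_le_iff)
    then show ?thesis using b s1 by (simp add: klein_density_def cmod_power2)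
  qed
  ultimately have "(\<integral>\<^sup>+y. ennreal (klein_density (Complex x y)) * indicator {- b..b} y \<partial>lborel) = ennreal (F b - F (- b))"
    by (intro nn_integral_has_integral_lebesgue') auto
  moreover have "F b - F (- b) = 2 * b / ((1 - x\<^sup>2) * sqrt (1 - s\<^sup>2))"
    by (simp add: F_def b(2))
  ultimately show ?thesis by (simp add: b_def)
qed

text \<open>The closed form is verified rather than computed: its derivative is minus the integral
  over a vertical strip. The derivatives of the two arccosines combine through
  \<open>(1 - x\<^sup>2) - (1 - s\<^sup>2) = s\<^sup>2 - x\<^sup>2\<close>.\<close>

lemma cap_area_derivative:
  assumes s: "0 < s" "s < 1" and x: "\<bar>x\<bar> < s"
  shows "(cap_area s has_real_derivative - (2 * sqrt (s\<^sup>2 - x\<^sup>2) / ((1 - x\<^sup>2) * sqrt (1 - s\<^sup>2)))) (at x)"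
proof -
  define c where "c = sqrt (1 - s\<^sup>2)"
  define d where "d = sqrt (s\<^sup>2 - x\<^sup>2)"
  define e where "e = sqrt (1 - x\<^sup>2)"
  have s1: "s\<^sup>2 < 1" using s by (simp add: abs_square_less_1)
  have xs: "x\<^sup>2 < s\<^sup>2" using x s by (metis abs_of_pos power2_abs power2_strict_mono abs_less_iff)
  have pos: "0 < c" "0 < d" "0 < e" using s1 xs by (auto simp: c_def d_def e_def)
  have sq: "c\<^sup>2 = 1 - s\<^sup>2" "d\<^sup>2 = s\<^sup>2 - x\<^sup>2" "e\<^sup>2 = 1 - x\<^sup>2" using s1 xs by (auto simp: c_def d_def e_def)
  have xs1: "-1 < x / s" "x / s < 1" using x s by (auto simp: pos_less_divide_eq abs_less_iff)
  have r1: "sqrt (1 - (x / s)\<^sup>2) = d / s"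
  proof -
    have "1 - (x / s)\<^sup>2 = (d / s)\<^sup>2" using s sq by (simp add: power_divide field_simps)
    then show ?thesis using pos s by simp
  qed
  have q: "1 - (c / s * x / e)\<^sup>2 = (d / (s * e))\<^sup>2"
  proof -
    have "s\<^sup>2 * e\<^sup>2 - c\<^sup>2 * x\<^sup>2 = d\<^sup>2" unfolding sq by (simp add: algebra_simps)
    moreover have "1 - c\<^sup>2 * x\<^sup>2 / (s\<^sup>2 * e\<^sup>2) = (s\<^sup>2 * e\<^sup>2 - c\<^sup>2 * x\<^sup>2) / (s\<^sup>2 * e\<^sup>2)"
      using pos s by (simp add: diff_divide_distrib)
    ultimately show ?thesis by (simp add: power_divide power_mult_distrib)
  qed
  have r2: "sqrt (1 - (c / s * x / e)\<^sup>2) = d / (s * e)" unfolding q using pos s by simp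
  have "0 < (d / (s * e))\<^sup>2" using pos s by simp
  then have "(c / s * x / e)\<^sup>2 < 1" using q by linarith
  then have "\<bar>c / s * x / e\<bar> < 1" by (simp only: abs_square_less_1)
  then have b2: "-1 < c / s * x / e" "c / s * x / e < 1" by linarith+
  have d1: "((\<lambda>x. arccos (x / s)) has_real_derivative - 1 / d) (at x)"
  proof -
    have "((\<lambda>x. arccos (x / s)) has_real_derivative inverse (- sqrt (1 - (x / s)\<^sup>2)) * (1 / s)) (at x)"
      using xs1 by (intro DERIV_chain2[of arccos] DERIV_arccos DERIV_cdivide DERIV_ident)
    then show ?thesis unfolding r1 using pos s by (simp add: field_simps)
  qed
  have d2: "((\<lambda>x. arccos (c / s * x / sqrt (1 - x\<^sup>2))) has_real_derivative - c / (e\<^sup>2 * d)) (at x)"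
  proof -
    have "((\<lambda>x. P * x / sqrt (1 - x\<^sup>2)) has_real_derivative
        (P * e - P * x * (- (2 * x) * (inverse e / 2))) / (e * e)) (at x)" for P
      using xs s1 unfolding e_def by (auto intro!: derivative_eq_intros)
    from this[of "c / s"] have "((\<lambda>x. c / s * x / sqrt (1 - x\<^sup>2)) has_real_derivative
        (c / s * e - c / s * x * (- (2 * x) * (inverse e / 2))) / (e * e)) (at x)" .
    also have "(c / s * e - c / s * x * (- (2 * x) * (inverse e / 2))) / (e * e) = c / s * (e\<^sup>2 + x\<^sup>2) / e ^ 3"
      using pos s by (simp add: field_simps power2_eq_square power3_eq_cube)
    also have "\<dots> = c / (s * e ^ 3)" using sq by simp
    finally have "((\<lambda>x. arccos (c / s * x / sqrt (1 - x\<^sup>2))) has_real_derivative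
        inverse (- sqrt (1 - (c / s * x / e)\<^sup>2)) * (c / (s * e ^ 3))) (at x)"
      using b2 unfolding e_def by (intro DERIV_chain2[of arccos] DERIV_arccos)
    then show ?thesis unfolding r2 using pos s by (simp add: field_simps power2_eq_square power3_eq_cube)
  qed
  have "(cap_area s has_real_derivative 2 / c * (- 1 / d) - 2 * (- c / (e\<^sup>2 * d))) (at x)"
    unfolding cap_area_def[abs_def] c_def[symmetric] by (intro DERIV_diff DERIV_cmult d1 d2)
  moreover have "2 / c * (- 1 / d) - 2 * (- c / (e\<^sup>2 * d)) = - (2 * d / (e\<^sup>2 * c))"
  proof -
    have "e\<^sup>2 - c\<^sup>2 = d\<^sup>2" unfolding sq by simp
    then have "- (2 * e\<^sup>2) + 2 * c\<^sup>2 = - (2 * d\<^sup>2)" by simp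
    then show ?thesis using pos by (simp add: divide_simps power2_eq_square mult_ac)
  qed
  ultimately show ?thesis by (simp add: sq c_def d_def)
qed

lemma cap_area_continuous:
  assumes s: "0 < s" "s < 1"
  shows "continuous_on {-s..s} (cap_area s)"
proof -
  define c where "c = sqrt (1 - s\<^sup>2)"
  have s1: "s\<^sup>2 < 1" using s by (simp add: abs_square_less_1)
  have sq: "c\<^sup>2 = 1 - s\<^sup>2" "0 < c" using s1 by (auto simp: c_def)
  have xs: "x\<^sup>2 \<le> s\<^sup>2" if "x \<in> {-s..s}" for x
    using that s by (simp add: power2_le_iff_abs_le abs_le_iff)
  have "(c / s * x / sqrt (1 - x\<^sup>2))\<^sup>2 \<le> 1" if "x \<in> {-s..s}" for x
  proof -
    have "c\<^sup>2 * x\<^sup>2 \<le> s\<^sup>2 * (1 - x\<^sup>2)" unfolding sq using xs[OF that] by (simp add: algebra_simps)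
    then show ?thesis using s s1 xs[OF that] by (simp add: power_divide power_mult_distrib field_simps)
  qed
  then have abs: "\<bar>c / s * x / sqrt (1 - x\<^sup>2)\<bar> \<le> 1" if "x \<in> {-s..s}" for x
    using that by (simp only: abs_square_le_1)
  have bd: "-1 \<le> c / s * x / sqrt (1 - x\<^sup>2) \<and> c / s * x / sqrt (1 - x\<^sup>2) \<le> 1" if "x \<in> {-s..s}" for x
    using abs[OF that] by linarith
  have "sqrt (1 - x\<^sup>2) \<noteq> 0" if "x \<in> {-s..s}" for x
    using xs[OF that] s1 by simp
  then have "continuous_on {-s..s} (\<lambda>x. c / s * x / sqrt (1 - x\<^sup>2))"
    by (intro continuous_intros) auto
  then have "continuous_on {-s..s} (\<lambda>x. arccos (c / s * x / sqrt (1 - x\<^sup>2)))"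
    using bd by (intro continuous_on_arccos) auto
  moreover have "continuous_on {-s..s} (\<lambda>x. x / s)" using s by (intro continuous_intros) auto
  then have "continuous_on {-s..s} (\<lambda>x. arccos (x / s))"
    using s by (intro continuous_on_arccos) (auto simp: pos_le_divide_eq)
  ultimately show ?thesis
    unfolding cap_area_def[abs_def] c_def[symmetric]
    by (intro continuous_on_diff continuous_on_mult continuous_on_const)
qed

lemma nn_integral_klein_cap:
  assumes s: "0 < s" "s < 1" and x0: "- s \<le> x0" "x0 \<le> s"
  shows "(\<integral>\<^sup>+w. ennreal (klein_density w) * indicator (klein_cap s 0 x0) w \<partial>lborel) = ennreal (cap_area s x0)"
    "0 \<le> cap_area s x0"
proof -
  define h where "h w = ennreal (klein_density w) * indicator (klein_cap s 0 x0) w" for w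
  have cap: "klein_cap s 0 x0 = cball 0 s \<inter> {w. x0 \<le> Re w}" by (auto simp: klein_cap_def inner_complex_def)
  have [measurable]: "klein_cap s 0 x0 \<in> sets borel" unfolding cap
    by (intro sets.Int borel_closed closed_Collect_le continuous_intros) auto
  have [measurable]: "klein_density \<in> borel_measurable borel" unfolding klein_density_def[abs_def] by measurable
  have meas: "h \<in> borel_measurable borel" unfolding h_def[abs_def] by measurable
  have inner: "(\<integral>\<^sup>+y. h (Complex x y) \<partial>lborel) =
      ennreal (2 * sqrt (s\<^sup>2 - x\<^sup>2) / ((1 - x\<^sup>2) * sqrt (1 - s\<^sup>2))) * indicator {x0..s} x" for x
  proof (cases "x \<in> {x0..s}")
    case True
    have xs: "\<bar>x\<bar> \<le> s" using True x0 by auto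
    then have xs2: "x\<^sup>2 \<le> s\<^sup>2" using s by (metis abs_le_square_iff abs_of_pos)
    have "norm (Complex x y) \<le> s \<longleftrightarrow> y \<in> {- sqrt (s\<^sup>2 - x\<^sup>2)..sqrt (s\<^sup>2 - x\<^sup>2)}" for y
    proof -
      have "norm (Complex x y) \<le> s \<longleftrightarrow> x\<^sup>2 + y\<^sup>2 \<le> s\<^sup>2"
        using s power2_le_imp_le[of "norm (Complex x y)" s] power_mono[of "norm (Complex x y)" s 2]
        by (auto simp: cmod_power2)
      also have "\<dots> \<longleftrightarrow> \<bar>y\<bar> \<le> sqrt (s\<^sup>2 - x\<^sup>2)"
        using xs2 by (metis real_sqrt_abs real_sqrt_le_iff le_diff_eq add.commute)
      finally show ?thesis by (auto simp: abs_le_iff)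
    qed
    then have "h (Complex x y) = ennreal (klein_density (Complex x y)) * indicator {- sqrt (s\<^sup>2 - x\<^sup>2)..sqrt (s\<^sup>2 - x\<^sup>2)} y" for y
      using True by (simp add: h_def cap indicator_def)
    then show ?thesis using nn_integral_klein_strip[OF s xs] True by simp
  next
    case False
    have "h (Complex x y) = 0" for y
      using False abs_Re_le_cmod[of "Complex x y"] by (auto simp: h_def cap indicator_def)
    then show ?thesis using False by simp
  qed
  have strip_nonneg: "0 \<le> 2 * sqrt (s\<^sup>2 - x\<^sup>2) / ((1 - x\<^sup>2) * sqrt (1 - s\<^sup>2))" if x: "x \<in> {x0..s}" for x
  proof -
    have "x\<^sup>2 \<le> s\<^sup>2" using x x0 s by (auto simp: power2_le_iff_abs_le abs_le_iff)
    moreover have "s\<^sup>2 < 1" using s by (simp add: abs_square_less_1)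
    ultimately show ?thesis by simp
  qed
  have integral: "((\<lambda>x. 2 * sqrt (s\<^sup>2 - x\<^sup>2) / ((1 - x\<^sup>2) * sqrt (1 - s\<^sup>2))) has_integral
      - cap_area s s - - cap_area s x0) {x0..s}"
  proof (rule fundamental_theorem_of_calculus_interior)
    show "x0 \<le> s" by fact
    show "continuous_on {x0..s} (\<lambda>x. - cap_area s x)"
      using x0 by (intro continuous_on_minus continuous_on_subset[OF cap_area_continuous[OF s]]) auto
    fix x assume "x \<in> {x0<..<s}"
    then have "\<bar>x\<bar> < s" using x0 by auto
    from DERIV_minus[OF cap_area_derivative[OF s this]]
    show "((\<lambda>x. - cap_area s x) has_vector_derivative 2 * sqrt (s\<^sup>2 - x\<^sup>2) / ((1 - x\<^sup>2) * sqrt (1 - s\<^sup>2))) (at x)"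
      by (simp add: has_real_derivative_iff_has_vector_derivative)
  qed
  \<comment> \<open>At \<open>x = s\<close> the cap shrinks to a point; both arccosines vanish
    there, so the closed form has the right constant of integration.\<close>
  have ss: "cap_area s s = 0"
  proof -
    have "s\<^sup>2 < 1" using s by (simp add: abs_square_less_1)
    then show ?thesis using s by (simp add: cap_area_def)
  qed
  have "(\<integral>\<^sup>+w. h w \<partial>lborel) = (\<integral>\<^sup>+p. h (case p of (x, y) \<Rightarrow> Complex x y) \<partial>(lborel \<Otimes>\<^sub>M lborel))"
    by (subst lborel_complex_eq_distr_pair, subst nn_integral_distr[OF measurable_Complex_pair]) (auto simp: meas)
  also have "\<dots> = (\<integral>\<^sup>+x. \<integral>\<^sup>+y. h (Complex x y) \<partial>lborel \<partial>lborel)"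
    using measurable_compose[OF measurable_Complex_pair meas] by (subst lborel.nn_integral_fst[symmetric]) auto
  also have "\<dots> = (\<integral>\<^sup>+x. ennreal (2 * sqrt (s\<^sup>2 - x\<^sup>2) / ((1 - x\<^sup>2) * sqrt (1 - s\<^sup>2))) * indicator {x0..s} x \<partial>lborel)"
    unfolding inner ..
  also have "\<dots> = ennreal (- cap_area s s - - cap_area s x0)"
    by (rule nn_integral_has_integral_lebesgue'[OF strip_nonneg integral])
  also have "- cap_area s s - - cap_area s x0 = cap_area s x0" using ss by simp
  finally show "(\<integral>\<^sup>+w. ennreal (klein_density w) * indicator (klein_cap s 0 x0) w \<partial>lborel) = ennreal (cap_area s x0)"
    by (simp add: h_def)
  show "0 \<le> cap_area s x0" using has_integral_nonneg[OF integral strip_nonneg] ss by simp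
qed

section \<open>Polygons inscribed in a circle\<close>

lemma cis_inner_cis: "cis s \<bullet> cis t = cos (s - t)"
  by (simp add: inner_complex_def cos_diff)

lemma cis_inner_le_norm: "cis t \<bullet> w \<le> norm w"
  using norm_cauchy_schwarz[of "cis t" w] by simp

text \<open>A direction between two others as a combination of them, with nonnegative coefficients
  when \<open>0 \<le> x \<le> \<gamma> \<le> pi\<close>. Both the disjointness of caps and the
  description of the polygon by half-planes rest on it.\<close>

lemma sin_scaleR_cis: "sin \<gamma> *\<^sub>R cis (m + x) = sin (\<gamma> - x) *\<^sub>R cis m + sin x *\<^sub>R cis (m + \<gamma>)"
proof -
  have 1: "sin \<gamma> * cos (m + x) = sin (\<gamma> - x) * cos m + sin x * cos (m + \<gamma>)"
    using sin_cos_squared_add[of x] by (simp add: cos_add sin_diff) algebra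
  have 2: "sin \<gamma> * sin (m + x) = sin (\<gamma> - x) * sin m + sin x * sin (m + \<gamma>)"
    by (simp add: sin_add sin_diff algebra_simps)
  show ?thesis using 1 2 by (simp add: complex_eq_iff)
qed

lemma sin_mult_inner_cis:
  "sin \<gamma> * (cis (m + x) \<bullet> w) = sin (\<gamma> - x) * (cis m \<bullet> w) + sin x * (cis (m + \<gamma>) \<bullet> w)"
  using arg_cong[OF sin_scaleR_cis[of \<gamma> m x], of "\<lambda>z. z \<bullet> w"] by (simp add: inner_add_left)

lemma cos_le_cos_between:
  assumes "0 \<le> a" "a \<le> x" "x \<le> 2 * pi - a"
  shows "cos x \<le> cos a"
proof (cases "x \<le> pi")
  case True
  then show ?thesis using assms by (intro cos_monotone_0_pi_le) auto
next
  case False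
  have "cos (2 * pi - x) \<le> cos a" using False assms by (intro cos_monotone_0_pi_le) auto
  then show ?thesis by (simp add: cos_diff)
qed

lemma angle_shift:
  obtains k :: int where "a \<le> y + 2 * pi * k" "y + 2 * pi * k < a + 2 * pi"
proof
  define f where "f = \<lfloor>(y - a) / (2 * pi)\<rfloor>"
  have "of_int f \<le> (y - a) / (2 * pi)" "(y - a) / (2 * pi) < of_int f + 1"
    by (auto simp: f_def)
  then show "a \<le> y + 2 * pi * of_int (- f)" "y + 2 * pi * of_int (- f) < a + 2 * pi"
    by (auto simp: field_simps)
qed

lemma cis_shift: "cis (y + 2 * pi * of_int k) = cis y"
  by (simp add: cis_mult[symmetric] cis_multiple_2pi)

lemma mono_between:
  fixes t :: "nat \<Rightarrow> real"
  assumes "t 0 \<le> x" "x < t n"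
  shows "\<exists>k<n. t k \<le> x \<and> x < t (Suc k)"
  using assms
proof (induction n)
  case (Suc n)
  then show ?case by (cases "x < t n") (auto intro: less_SucI)
qed simp

text \<open>Strict along the chord only, so that the disc is exactly the disjoint union of the
  polygon and its caps.\<close>

definition open_cap :: "real \<Rightarrow> real \<Rightarrow> real \<Rightarrow> complex set" where
  "open_cap s m x = {w. norm w \<le> s \<and> x < cis m \<bullet> w}"

text \<open>Write the direction \<open>m + \<alpha>\<close>, the end of the first arc, as a
  combination of the two chord normals. The two chord inequalities then give \<open>sin \<gamma> *
  (cis (m + \<alpha>) \<bullet> w) > sin \<gamma> * s\<close>, which \<open>norm w \<le> s\<close>
  forbids.\<close>

lemma open_caps_disjoint_aux:
  assumes s: "0 < s" and \<alpha>: "0 < \<alpha>" "0 < \<beta>" and \<gamma>: "\<alpha> + \<beta> \<le> m' - m" "m' - m \<le> pi"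
  shows "open_cap s m (s * cos \<alpha>) \<inter> open_cap s m' (s * cos \<beta>) = {}"
proof -
  define \<gamma> where "\<gamma> = m' - m"
  have False if w: "norm w \<le> s" "s * cos \<alpha> < cis m \<bullet> w" "s * cos \<beta> < cis m' \<bullet> w" for w
  proof -
    have "sin \<alpha> > 0" using assms by (intro sin_gt_zero) auto
    have "0 \<le> sin (\<gamma> - \<alpha>)" using assms by (intro sin_ge_zero) (auto simp: \<gamma>_def)
    have "cos (\<gamma> - \<alpha>) \<le> cos \<beta>" using assms by (intro cos_monotone_0_pi_le) (auto simp: \<gamma>_def)
    have "s * sin \<gamma> = s * (sin (\<gamma> - \<alpha>) * cos \<alpha> + sin \<alpha> * cos (\<gamma> - \<alpha>))"
      using sin_add[of "\<gamma> - \<alpha>" \<alpha>] by (simp add: algebra_simps)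
    also have "\<dots> \<le> s * (sin (\<gamma> - \<alpha>) * cos \<alpha> + sin \<alpha> * cos \<beta>)"
      using s \<open>sin \<alpha> > 0\<close> \<open>cos (\<gamma> - \<alpha>) \<le> cos \<beta>\<close> by simp
    also have "\<dots> = sin (\<gamma> - \<alpha>) * (s * cos \<alpha>) + sin \<alpha> * (s * cos \<beta>)" by (simp add: algebra_simps)
    also have "\<dots> < sin (\<gamma> - \<alpha>) * (cis m \<bullet> w) + sin \<alpha> * (cis (m + \<gamma>) \<bullet> w)"
      using w \<open>sin \<alpha> > 0\<close> \<open>0 \<le> sin (\<gamma> - \<alpha>)\<close>
      by (intro add_le_less_mono mult_left_mono mult_strict_left_mono) (auto simp: \<gamma>_def)
    also have "\<dots> = sin \<gamma> * (cis (m + \<alpha>) \<bullet> w)" by (rule sin_mult_inner_cis[symmetric])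
    also have "\<dots> \<le> sin \<gamma> * s"
      using order_trans[OF cis_inner_le_norm w(1)] assms by (intro mult_left_mono sin_ge_zero) (auto simp: \<gamma>_def)
    finally show False by (simp add: mult.commute)
  qed
  then show ?thesis by (auto simp: open_cap_def)
qed

text \<open>Angles are real lifts, and \<open>t n\<close> repeats the first vertex one turn later,
  so that every side, including the closing one, runs from \<open>t k\<close> to
  \<open>t (Suc k)\<close>.\<close>

locale inscribed_polygon =
  fixes s :: real and n :: nat and t :: "nat \<Rightarrow> real"
  assumes s: "0 < s" and t_less: "\<And>k. k < n \<Longrightarrow> t k < t (Suc k)" and full: "t n = t 0 + 2 * pi"
    and small: "\<And>k. k < n \<Longrightarrow> t (Suc k) - t k < 2 * pi"
begin

definition mid :: "nat \<Rightarrow> real" where "mid k = (t k + t (Suc k)) / 2"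
definition half :: "nat \<Rightarrow> real" where "half k = (t (Suc k) - t k) / 2"
definition vertex :: "nat \<Rightarrow> complex" where "vertex j = of_real s * cis (t j)"

lemma half_bounds: "k < n \<Longrightarrow> 0 < half k" "k < n \<Longrightarrow> half k < pi"
  using t_less[of k] small[of k] by (auto simp: half_def)

lemma sum_half: "sum half {..<n} = pi"
proof -
  have "sum half {..<n} = (\<Sum>k<n. t (Suc k) - t k) / 2" by (simp add: half_def sum_divide_distrib)
  also have "(\<Sum>k<n. t (Suc k) - t k) = 2 * pi" by (simp add: sum_lessThan_telescope full)
  finally show ?thesis by simp
qed

lemma mono: "i \<le> j \<Longrightarrow> j \<le> n \<Longrightarrow> t i \<le> t j"
proof (induction j rule: dec_induct)
  case (step j)
  then show ?case using t_less[of j] by simp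
qed simp

lemma inner_vertex: "cis \<phi> \<bullet> vertex j = s * cos (\<phi> - t j)"
  by (simp add: vertex_def scaleR_conv_of_real[symmetric] cis_inner_cis)

lemma norm_vertex: "norm (vertex j) = s"
  using s by (simp add: vertex_def norm_mult)

lemma vertex_n: "vertex n = vertex 0"
  using cis_shift[of "t 0" 1] by (simp add: vertex_def full)

text \<open>Seen from the midpoint direction of side \<open>k\<close>, every vertex lies at angular
  distance between \<open>half k\<close> and \<open>2 * pi - half k\<close>, and on that range the
  cosine is largest at the ends.\<close>

lemma vertex_halfspace:
  assumes "k < n" "j < n"
  shows "cis (mid k) \<bullet> vertex j \<le> s * cos (half k)"
proof -
  have "cos (mid k - t j) \<le> cos (half k)"
  proof (cases "j \<le> k")
    case True
    then have "t 0 \<le> t j" "t j \<le> t k" "t (Suc k) \<le> t n" using assms by (auto intro!: mono)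
    then show ?thesis using full half_bounds[OF assms(1)]
      by (intro cos_le_cos_between) (auto simp: mid_def half_def field_simps)
  next
    case False
    then have "t (Suc k) \<le> t j" "t j \<le> t n" "t 0 \<le> t k" using assms by (auto intro!: mono)
    then have "cos (t j - mid k) \<le> cos (half k)" using full half_bounds[OF assms(1)]
      by (intro cos_le_cos_between) (auto simp: mid_def half_def field_simps)
    then show ?thesis using cos_minus[of "t j - mid k"] by simp
  qed
  then show ?thesis using s by (simp add: inner_vertex)
qed

lemma n_pos: "0 < n"
  using full pi_gt_zero by (cases n) auto

definition polygon :: "complex set" where "polygon = convex hull (vertex ` {..<n})"

lemma polygon_subset: "polygon \<subseteq> cball 0 s" "k < n \<Longrightarrow> polygon \<subseteq> {w. cis (mid k) \<bullet> w \<le> s * cos (half k)}"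
  unfolding polygon_def using vertex_halfspace
  by (intro hull_minimal; auto simp: norm_vertex convex_halfspace_le)+

lemma compact_polygon: "compact polygon"
  unfolding polygon_def by (intro compact_convex_hull finite_imp_compact) auto

text \<open>A linear functional \<open>\<langle>cis \<phi>, \<cdot>\<rangle>\<close> separating a point of the disc from the polygon would, for
  \<open>\<phi>\<close> between the directions of two consecutive vertices, be a nonnegative combination of the
  functionals bounding the corresponding side and the disc at one of these vertices.\<close>

lemma mem_polygon:
  assumes w: "norm w \<le> s" "\<And>k. k < n \<Longrightarrow> cis (mid k) \<bullet> w \<le> s * cos (half k)"
  shows "w \<in> polygon"
proof (rule ccontr)
  assume "w \<notin> polygon"
  moreover have "convex polygon" "closed polygon"
    using compact_polygon by (auto simp: polygon_def intro: compact_imp_closed)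
  ultimately have "\<exists>a b. a \<bullet> w < b \<and> (\<forall>x\<in>polygon. b < a \<bullet> x)"
    by (intro separating_hyperplane_closed_point)
  then obtain a b where ab: "a \<bullet> w < b" "\<And>x. x \<in> polygon \<Longrightarrow> b < a \<bullet> x"
    by blast
  have vert: "vertex j \<in> polygon" if "j < n" for j
    using that by (auto simp: polygon_def intro: hull_inc)
  have "a \<noteq> 0" using ab(1) ab(2)[OF vert[OF n_pos]] by auto
  \<comment> \<open>The separating direction is lifted into the turn starting at \<open>t 0\<close>,
    so that it falls between two consecutive vertex angles.\<close>
  obtain k :: int where k: "t 0 \<le> Arg (- a) + 2 * pi * k" "Arg (- a) + 2 * pi * k < t 0 + 2 * pi"
    by (rule angle_shift)
  define \<phi> where "\<phi> = Arg (- a) + 2 * pi * k"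
  have a: "- a = norm a *\<^sub>R cis \<phi>"
    using \<open>a \<noteq> 0\<close> rcis_cmod_Arg[of "- a"] by (simp add: \<phi>_def cis_shift rcis_def scaleR_conv_of_real)
  have sep: "cis \<phi> \<bullet> vertex j < cis \<phi> \<bullet> w" if "j \<le> n" for j
  proof -
    have "vertex j \<in> polygon" using vert[of j] vert[OF n_pos] vertex_n that by (cases "j = n") auto
    then have "(- a) \<bullet> vertex j < (- a) \<bullet> w" using ab(1) ab(2) by force
    then show ?thesis unfolding a using \<open>a \<noteq> 0\<close> by simp
  qed
  obtain j where j: "j < n" "t j \<le> \<phi>" "\<phi> < t (Suc j)"
    using mono_between[of t \<phi> n] k full unfolding \<phi>_def by auto
  define m where "m = mid j"
  define \<alpha> where "\<alpha> = half j"
  have \<alpha>: "0 < \<alpha>" "\<alpha> < pi" using half_bounds[OF j(1)] by (auto simp: \<alpha>_def)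
  have ends: "m + \<alpha> = t (Suc j)" "m - \<alpha> = t j" by (auto simp: m_def \<alpha>_def mid_def half_def field_simps)
  \<comment> \<open>Both halves of the arc at once: \<open>\<sigma>\<close> tells on which side of
    the midpoint \<phi> lies, and \<open>i\<close> is the vertex at that end.\<close>
  have key: False if x: "0 \<le> x" "x \<le> \<alpha>" and \<sigma>: "\<sigma> = 1 \<or> \<sigma> = -1" and \<phi>: "\<phi> = m + \<sigma> * x"
    and i: "i \<le> n" "t i = m + \<sigma> * \<alpha>" for x \<sigma> i
  proof -
    have "sin x \<ge> 0" "sin (\<alpha> - x) \<ge> 0" "sin \<alpha> > 0" using x \<alpha> by (auto intro!: sin_ge_zero sin_gt_zero)
    have comb: "sin \<alpha> * (cis \<phi> \<bullet> z) = sin (\<alpha> - x) * (cis m \<bullet> z) + sin x * (cis (m + \<sigma> * \<alpha>) \<bullet> z)" for z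
      using \<sigma> sin_mult_inner_cis[of \<alpha> m x z] sin_mult_inner_cis[of "- \<alpha>" m "- x" z] sin_minus[of "\<alpha> - x"]
      by (auto simp: \<phi>)
    have "sin \<alpha> * (cis \<phi> \<bullet> w) \<le> sin (\<alpha> - x) * (s * cos \<alpha>) + sin x * s"
      unfolding comb using w(2)[OF j(1)] order_trans[OF cis_inner_le_norm w(1)] \<open>sin x \<ge> 0\<close> \<open>sin (\<alpha> - x) \<ge> 0\<close>
      by (intro add_mono mult_left_mono) (auto simp: m_def \<alpha>_def)
    also have "\<dots> = sin \<alpha> * (cis \<phi> \<bullet> vertex i)"
      using comb[of "vertex i"] \<sigma> i(2) by (auto simp: inner_vertex)
    also have "\<dots> < sin \<alpha> * (cis \<phi> \<bullet> w)" using sep[OF i(1)] \<open>sin \<alpha> > 0\<close> by simp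
    finally show False by simp
  qed
  show False
  proof (cases "m \<le> \<phi>")
    case True
    then show False using key[of "\<phi> - m" 1 "Suc j"] j ends by auto
  next
    case False
    then show False using key[of "m - \<phi>" "-1" j] j ends by auto
  qed
qed

lemma disc_eq: "cball 0 s = polygon \<union> (\<Union>k<n. open_cap s (mid k) (s * cos (half k)))"
proof
  show "cball 0 s \<subseteq> polygon \<union> (\<Union>k<n. open_cap s (mid k) (s * cos (half k)))"
    using mem_polygon by (fastforce simp: open_cap_def)
  show "polygon \<union> (\<Union>k<n. open_cap s (mid k) (s * cos (half k))) \<subseteq> cball 0 s"
    using polygon_subset(1) by (auto simp: open_cap_def)
qed

lemma polygon_disjoint_caps: "polygon \<inter> (\<Union>k<n. open_cap s (mid k) (s * cos (half k))) = {}"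
  using polygon_subset(2) by (fastforce simp: open_cap_def)

lemma open_caps_disjoint: "disjoint_family_on (\<lambda>k. open_cap s (mid k) (s * cos (half k))) {..<n}"
proof -
  have "open_cap s (mid k) (s * cos (half k)) \<inter> open_cap s (mid l) (s * cos (half l)) = {}" if kl: "k < l" "l < n" for k l
  proof -
    have b: "0 < half k" "0 < half l" using half_bounds kl by auto
    have "t (Suc k) \<le> t l" "t (Suc l) \<le> t n" "t 0 \<le> t k" using kl by (auto intro!: mono)
    then have bd: "half k + half l \<le> mid l - mid k" "half l + half k \<le> (mid k + 2 * pi) - mid l"
      using full by (auto simp: mid_def half_def field_simps)
    show ?thesis
    \<comment> \<open>Of the two ways round the circle between the midpoints one is at most \<pi>;
      the second is reached by adding a full turn to \<open>mid k\<close>.\<close>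
    proof (cases "mid l - mid k \<le> pi")
      case True
      then show ?thesis using open_caps_disjoint_aux[OF s b bd(1)] by simp
    next
      case False
      then have "open_cap s (mid l) (s * cos (half l)) \<inter> open_cap s (mid k + 2 * pi) (s * cos (half k)) = {}"
        by (intro open_caps_disjoint_aux s b bd(2)) simp
      moreover have "open_cap s (mid k + 2 * pi) x = open_cap s (mid k) x" for x
        using cis_shift[of "mid k" 1] by (simp add: open_cap_def)
      ultimately show ?thesis by (simp add: Int_commute)
    qed
  qed
  then show ?thesis unfolding disjoint_family_on_def by (metis Int_commute lessThan_iff nat_neq_iff)
qed

end

section \<open>Klein area of caps and of inscribed polygons\<close>

definition klein_measure :: "complex measure" where
  "klein_measure = density lborel (\<lambda>w. ennreal (klein_density w))"

lemma borel_measurable_klein_density [measurable]: "klein_density \<in> borel_measurable borel"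
  unfolding klein_density_def[abs_def] by measurable

lemma sets_klein_measure [simp]: "sets klein_measure = sets borel"
  by (simp add: klein_measure_def)

lemma emeasure_klein_measure:
  "A \<in> sets borel \<Longrightarrow> emeasure klein_measure A = (\<integral>\<^sup>+w. ennreal (klein_density w) * indicator A w \<partial>lborel)"
  by (simp add: klein_measure_def emeasure_density)

lemma continuous_on_klein_density:
  assumes "A \<subseteq> ball 0 1"
  shows "continuous_on A klein_density"
proof -
  have "(norm w)\<^sup>2 < 1" if "w \<in> A" for w using assms that by (auto simp: abs_square_less_1)
  then show ?thesis unfolding klein_density_def[abs_def]
    by (intro continuous_intros) fastforce
qed

lemma klein_density_nonneg: "norm w < 1 \<Longrightarrow> 0 \<le> klein_density w"
  by (simp add: klein_density_def abs_square_less_1 power_le_one)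

lemma compact_klein_cap: "compact (klein_cap s m x)"
proof -
  have "klein_cap s m x = cball 0 s \<inter> {w. x \<le> cis m \<bullet> w}" by (auto simp: klein_cap_def)
  then show ?thesis by (simp add: compact_Int_closed closed_halfspace_ge)
qed

text \<open>Rotation by \<open>cis m\<close> is complex linear with Jacobian 1 and preserves the
  density, which reduces the claim to a vertical chord.\<close>

lemma emeasure_klein_cap:
  assumes s: "0 < s" "s < 1" and x: "- s \<le> x" "x \<le> s"
  shows "emeasure klein_measure (klein_cap s m x) = ennreal (cap_area s x)"
proof -
  have inner: "cis m \<bullet> (cis m * w) = cis 0 \<bullet> w" for w
    using sin_cos_squared_add[of m] by (simp add: inner_complex_def power2_eq_square) algebra
  have img: "klein_cap s m x = (\<lambda>w. cis m * w) ` klein_cap s 0 x"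
  proof
    show "(\<lambda>w. cis m * w) ` klein_cap s 0 x \<subseteq> klein_cap s m x"
      by (auto simp: klein_cap_def inner norm_mult)
    show "klein_cap s m x \<subseteq> (\<lambda>w. cis m * w) ` klein_cap s 0 x"
    proof
      fix w assume w: "w \<in> klein_cap s m x"
      have eq: "w = cis m * (cis (- m) * w)" by (simp add: mult.assoc[symmetric] cis_mult)
      then have "cis 0 \<bullet> (cis (- m) * w) = cis m \<bullet> w" using inner by metis
      then have "cis (- m) * w \<in> klein_cap s 0 x"
        using w unfolding klein_cap_def mem_Collect_eq norm_mult by simp
      then show "w \<in> (\<lambda>w. cis m * w) ` klein_cap s 0 x" using eq by blast
    qed
  qed
  have sub: "klein_cap s m x \<subseteq> ball 0 1" for m using s by (auto simp: klein_cap_def)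
  have "emeasure klein_measure (klein_cap s m x) =
      (\<integral>\<^sup>+w. ennreal (klein_density w) * indicator (klein_cap s m x) w \<partial>lborel)"
    by (simp add: emeasure_klein_measure borel_compact compact_klein_cap)
  also have "\<dots> = (\<integral>\<^sup>+w. ennreal (\<bar>(norm (cis m))\<^sup>2 - (norm (0::complex))\<^sup>2\<bar> * klein_density (cis m * w)) * indicator (klein_cap s 0 x) w \<partial>lborel)"
    unfolding img
    by (rule nn_integral_complex_change_of_variables[where p = "\<lambda>_. cis m" and q = "\<lambda>_. 0"])
      (use sub[of 0] sub[of m] in \<open>auto simp: compact_klein_cap inj_on_def img[symmetric] norm_mult
        intro!: continuous_intros continuous_on_klein_density klein_density_nonneg derivative_eq_intros\<close>)
  also have "\<dots> = ennreal (cap_area s x)"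
    using nn_integral_klein_cap[OF s x] by (simp add: klein_density_def norm_mult)
  finally show ?thesis .
qed

lemma emeasure_open_cap:
  assumes s: "0 < s" "s < 1" and x: "- s \<le> x" "x \<le> s"
  shows "open_cap s m x \<in> sets borel" "emeasure klein_measure (open_cap s m x) = ennreal (cap_area s x)"
proof -
  let ?L = "{w. cis m \<bullet> w = x}"
  have eq: "open_cap s m x = klein_cap s m x - ?L" by (auto simp: open_cap_def klein_cap_def)
  have L: "?L \<in> sets borel" by (intro borel_closed closed_hyperplane)
  have "negligible ?L" by (intro negligible_hyperplane) simp
  then have "?L \<in> null_sets lborel"
    using L by (metis negligible_iff_null_sets null_sets_completion_iff sets_lborel)
  moreover have "absolutely_continuous lborel klein_measure"
    unfolding klein_measure_def by (intro absolutely_continuousI_density) measurable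
  ultimately have null: "?L \<in> null_sets klein_measure" by (auto simp: absolutely_continuous_def)
  show "open_cap s m x \<in> sets borel" unfolding eq
    by (rule sets.Diff[OF borel_compact[OF compact_klein_cap] L])
  show "emeasure klein_measure (open_cap s m x) = ennreal (cap_area s x)"
    unfolding eq emeasure_klein_cap[OF assms, of m, symmetric]
    using null by (intro emeasure_Diff_null_set) (simp_all add: borel_compact compact_klein_cap)
qed

text \<open>For \<open>s = tanh r\<close> the quotient \<open>s / sqrt (1 - s\<^sup>2)\<close> is
  \<open>sinh r\<close>, so the large square root is \<open>cosh (d / 2)\<close> for the side
  \<open>d\<close> with half angle \<alpha>.\<close>

lemma cap_area_cos:
  assumes s: "0 < s" "s < 1" and \<alpha>: "0 \<le> \<alpha>" "\<alpha> \<le> pi"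
  shows "cap_area s (s * cos \<alpha>) = 2 / sqrt (1 - s\<^sup>2) * \<alpha>
    - 2 * arccos (cos \<alpha> / sqrt (1 + (s / sqrt (1 - s\<^sup>2) * sin \<alpha>)\<^sup>2))"
proof -
  define c where "c = sqrt (1 - s\<^sup>2)"
  have s1: "s\<^sup>2 < 1" using s by (simp add: abs_square_less_1)
  have c: "0 < c" "c\<^sup>2 = 1 - s\<^sup>2" using s1 by (auto simp: c_def)
  have "1 - (s * cos \<alpha>)\<^sup>2 = c\<^sup>2 + s\<^sup>2 * (sin \<alpha>)\<^sup>2"
    unfolding c by (simp add: power_mult_distrib cos_squared_eq algebra_simps)
  also have "\<dots> = c\<^sup>2 * (1 + (s / c * sin \<alpha>)\<^sup>2)"
    using c(1) by (simp add: power_mult_distrib power_divide field_simps)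
  finally have "sqrt (1 - (s * cos \<alpha>)\<^sup>2) = c * sqrt (1 + (s / c * sin \<alpha>)\<^sup>2)"
    using c(1) by (simp add: real_sqrt_mult)
  then show ?thesis
    using s c(1) \<alpha> by (simp add: cap_area_def c_def[symmetric] arccos_cos)
qed

context inscribed_polygon
begin

text \<open>The disc is itself the cap with half angle \<pi>. The parts of the cap areas linear in
  the angle cancel against it because the half angles add up to \<pi>, and
  \<open>arccos (-1)\<close> leaves the final \<open>- pi\<close>.\<close>

lemma measure_polygon:
  assumes s1: "s < 1"
  shows "measure klein_measure polygon =
    2 * ((\<Sum>k<n. arccos (cos (half k) / sqrt (1 + (s / sqrt (1 - s\<^sup>2) * sin (half k))\<^sup>2))) - pi)"
proof -
  let ?O = "\<lambda>k. open_cap s (mid k) (s * cos (half k))"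
  have cosb: "- s \<le> s * cos \<alpha>" "s * cos \<alpha> \<le> s" for \<alpha>
    using s mult_left_mono[of "-1" "cos \<alpha>" s] mult_left_mono[of "cos \<alpha>" 1 s] by auto
  have O: "?O k \<in> sets borel" "emeasure klein_measure (?O k) = ennreal (cap_area s (s * cos (half k)))" for k
    using emeasure_open_cap[OF s s1 cosb] by auto
  have disc: "cball 0 s = klein_cap s 0 (- s)"
  proof -
    have "- s \<le> cis 0 \<bullet> w" if "norm w \<le> s" for w
      using abs_Re_le_cmod[of w] that by (simp add: inner_complex_def)
    then show ?thesis by (auto simp: klein_cap_def)
  qed
  have ed: "emeasure klein_measure (cball 0 s) = ennreal (cap_area s (- s))"
    unfolding disc using s by (intro emeasure_klein_cap s1) auto
  have P: "polygon \<in> sets borel" by (intro borel_compact compact_polygon)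
  have finP: "emeasure klein_measure polygon \<noteq> \<infinity>"
    using emeasure_mono[OF polygon_subset(1), of klein_measure] ed by (auto simp: top_unique)
  have nonneg: "0 \<le> cap_area s (s * cos \<alpha>)" for \<alpha> by (intro nn_integral_klein_cap s s1 cosb)
  have mO: "measure klein_measure (?O k) = cap_area s (s * cos (half k))" if "k < n" for k
    using nonneg O(2)[of k] by (simp add: measure_def)
  have emeasure_O: "emeasure klein_measure (\<Union>k<n. ?O k) \<noteq> top"
  proof -
    have "(\<Union>k<n. ?O k) \<subseteq> cball 0 s" using disc_eq by blast
    then have "emeasure klein_measure (\<Union>k<n. ?O k) \<le> ennreal (cap_area s (- s))"
      unfolding ed[symmetric] by (intro emeasure_mono) auto
    then show ?thesis by (auto simp: top_unique)
  qed
  have "measure klein_measure (cball 0 s) = measure klein_measure polygon + measure klein_measure (\<Union>k<n. ?O k)"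
    unfolding disc_eq using finP P O ed polygon_disjoint_caps
    by (intro measure_Union) (auto simp: emeasure_O)
  also have "measure klein_measure (\<Union>k<n. ?O k) = (\<Sum>k<n. measure klein_measure (?O k))"
    using O by (intro measure_finite_Union open_caps_disjoint) auto
  also have "\<dots> = (\<Sum>k<n. cap_area s (s * cos (half k)))" using mO by (intro sum.cong) auto
  also have "\<dots> = (\<Sum>k<n. 2 / sqrt (1 - s\<^sup>2) * half k
    - 2 * arccos (cos (half k) / sqrt (1 + (s / sqrt (1 - s\<^sup>2) * sin (half k))\<^sup>2)))"
    using half_bounds by (intro sum.cong cap_area_cos s s1) (auto intro: less_imp_le)
  also have "\<dots> = 2 / sqrt (1 - s\<^sup>2) * pi
    - 2 * (\<Sum>k<n. arccos (cos (half k) / sqrt (1 + (s / sqrt (1 - s\<^sup>2) * sin (half k))\<^sup>2)))"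
    by (simp only: sum_subtractf sum_distrib_left[symmetric] sum_half)
  finally have "measure klein_measure (cball 0 s) = measure klein_measure polygon + (2 / sqrt (1 - s\<^sup>2) * pi
    - 2 * (\<Sum>k<n. arccos (cos (half k) / sqrt (1 + (s / sqrt (1 - s\<^sup>2) * sin (half k))\<^sup>2))))" .
  moreover have "measure klein_measure (cball 0 s) = 2 / sqrt (1 - s\<^sup>2) * pi - 2 * pi"
    using cap_area_cos[OF s s1, of pi] nonneg[of pi] ed by (simp add: measure_def)
  ultimately show ?thesis by simp
qed

end

section \<open>The Klein model\<close>

definition klein :: "complex \<Rightarrow> complex" where
  "klein z = (2 / (1 + (norm z)\<^sup>2)) *\<^sub>R z"

text \<open>\<open>hyp_time\<close> and \<open>hyp_space\<close> are the coordinates of the point on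
  the upper sheet of the hyperboloid in Minkowski space; \<open>klein\<close> is its central
  projection.\<close>

definition hyp_time :: "complex \<Rightarrow> real" where
  "hyp_time z = (1 + (norm z)\<^sup>2) / (1 - (norm z)\<^sup>2)"

definition hyp_space :: "complex \<Rightarrow> complex" where
  "hyp_space z = (2 / (1 - (norm z)\<^sup>2)) *\<^sub>R z"

lemma one_minus_norm_sq_pos: "norm (z::complex) < 1 \<Longrightarrow> 0 < 1 - (norm z)\<^sup>2"
  by (simp add: abs_square_less_1)

lemma klein_eq: "norm z < 1 \<Longrightarrow> klein z = hyp_space z /\<^sub>R hyp_time z"
proof -
  assume "norm z < 1"
  then have "1 - (norm z)\<^sup>2 \<noteq> 0" using one_minus_norm_sq_pos[of z] by simp
  moreover have "inverse (q / p) * (2 / p) = 2 / q" if "p \<noteq> 0" for p q :: real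
    using that by (simp add: divide_simps)
  ultimately have "inverse ((1 + (norm z)\<^sup>2) / (1 - (norm z)\<^sup>2)) * (2 / (1 - (norm z)\<^sup>2)) = 2 / (1 + (norm z)\<^sup>2)"
    by blast
  then show ?thesis unfolding klein_def hyp_space_def hyp_time_def scaleR_scaleR by (simp only:)
qed

lemma hyp_time_pos: "norm z < 1 \<Longrightarrow> 0 < hyp_time z"
  using one_minus_norm_sq_pos[of z] by (simp add: hyp_time_def add_pos_nonneg)

lemma hyperboloid: "norm z < 1 \<Longrightarrow> (hyp_time z)\<^sup>2 - (norm (hyp_space z))\<^sup>2 = 1"
proof -
  assume "norm z < 1"
  then have p: "0 < 1 - (norm z)\<^sup>2" by (rule one_minus_norm_sq_pos)
  have "(1 + x)\<^sup>2 - 4 * x = (1 - x)\<^sup>2" for x :: real by (simp add: power2_eq_square algebra_simps)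
  from this[of "(norm z)\<^sup>2"] show ?thesis
    using p by (simp add: hyp_time_def hyp_space_def power_mult_distrib power_divide diff_divide_distrib[symmetric])
qed

lemma one_minus_norm_Moebius_sq:
  assumes "norm w < 1" "norm z < 1"
  shows "1 - (norm (Moebius_function 0 w z))\<^sup>2 = (1 - (norm w)\<^sup>2) * (1 - (norm z)\<^sup>2) / (norm (1 - cnj w * z))\<^sup>2"
    "1 - cnj w * z \<noteq> 0"
proof -
  have "norm (cnj w * z) < 1" using norm_mult_less[of "cnj w" 1 z 1] assms by simp
  then show ne: "1 - cnj w * z \<noteq> 0" by auto
  have "(norm (1 - cnj w * z))\<^sup>2 - (norm (z - w))\<^sup>2 = (1 - (norm w)\<^sup>2) * (1 - (norm z)\<^sup>2)"
    unfolding cmod_power2 by (simp add: power2_eq_square algebra_simps)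
  then show "1 - (norm (Moebius_function 0 w z))\<^sup>2 = (1 - (norm w)\<^sup>2) * (1 - (norm z)\<^sup>2) / (norm (1 - cnj w * z))\<^sup>2"
    using ne by (simp add: Moebius_function_simple norm_divide power_divide field_simps)
qed

lemma hdist_nonneg: "norm z < 1 \<Longrightarrow> norm w < 1 \<Longrightarrow> 0 \<le> hdist z w"
  using Moebius_function_norm_lt_1[of w z 0] by (simp add: hdist_def artanh_def)

lemma cosh_double_artanh:
  assumes "0 \<le> x" "x < 1"
  shows "cosh (2 * artanh (x::real)) = (1 + x\<^sup>2) / (1 - x\<^sup>2)"
proof -
  have pos: "0 < (1 + x) / (1 - x)" using assms by simp
  have "2 * artanh x = ln ((1 + x) / (1 - x))" by (simp add: artanh_def)
  then have "cosh (2 * artanh x) = ((1 + x) / (1 - x) + (1 - x) / (1 + x)) / 2"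
    using pos by (simp add: cosh_ln_real)
  also have "\<dots> = (1 + x\<^sup>2) / (1 - x\<^sup>2)"
  proof -
    have "1 - x\<^sup>2 = (1 - x) * (1 + x)" by (simp add: power2_eq_square algebra_simps)
    then show ?thesis using assms by (simp add: divide_simps) (simp add: power2_eq_square algebra_simps)
  qed
  finally show ?thesis .
qed

text \<open>The Lorentz product suits segments, being bilinear; the Euclidean form suits invariance
  under Moebius maps and distances on a circle.\<close>

lemma cosh_hdist:
  assumes "norm z < 1" "norm w < 1"
  shows "cosh (hdist z w) = hyp_time z * hyp_time w - hyp_space z \<bullet> hyp_space w"
    "cosh (hdist z w) = 1 + 2 * (norm (z - w))\<^sup>2 / ((1 - (norm z)\<^sup>2) * (1 - (norm w)\<^sup>2))"
proof -
  define N where "N = (norm (z - w))\<^sup>2"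
  define Q where "Q = (norm (1 - cnj w * z))\<^sup>2"
  define A where "A = 1 - (norm z)\<^sup>2"
  define B where "B = 1 - (norm w)\<^sup>2"
  have pos: "0 < A" "0 < B" using one_minus_norm_sq_pos assms by (auto simp: A_def B_def)
  have Qp: "0 < Q" using one_minus_norm_Moebius_sq(2)[OF assms(2,1)] by (simp add: Q_def)
  have QN: "Q - N = A * B"
    unfolding Q_def N_def A_def B_def cmod_power2 by (simp add: power2_eq_square algebra_simps)
  have M: "(norm (Moebius_function 0 w z))\<^sup>2 = N / Q"
    by (simp add: Moebius_function_simple norm_divide power_divide N_def Q_def)
  have "cosh (hdist z w) = (1 + N / Q) / (1 - N / Q)"
    unfolding hdist_def using Moebius_function_norm_lt_1[OF assms(2,1), of 0]
    by (subst cosh_double_artanh) (auto simp: M)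
  also have "\<dots> = (Q + N) / (Q - N)" using Qp by (simp add: divide_simps)
  also have "\<dots> = 1 + 2 * N / (A * B)" using pos unfolding QN by (simp add: divide_simps) (use QN in linarith)
  finally have eq: "cosh (hdist z w) = 1 + 2 * N / (A * B)" .
  then show "cosh (hdist z w) = 1 + 2 * (norm (z - w))\<^sup>2 / ((1 - (norm z)\<^sup>2) * (1 - (norm w)\<^sup>2))"
    by (simp add: N_def A_def B_def)
  have "N = (norm z)\<^sup>2 + (norm w)\<^sup>2 - 2 * (z \<bullet> w)"
    unfolding N_def by (simp add: power2_norm_eq_inner inner_diff inner_commute)
  then have num: "A * B + 2 * N = (1 + (norm z)\<^sup>2) * (1 + (norm w)\<^sup>2) - 4 * (z \<bullet> w)"
    by (simp add: A_def B_def algebra_simps)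
  have "1 + 2 * N / (A * B) = (A * B + 2 * N) / (A * B)"
    using pos by (simp add: add_divide_distrib)
  also have "\<dots> = (1 + (norm z)\<^sup>2) * (1 + (norm w)\<^sup>2) / (A * B) - 4 * (z \<bullet> w) / (A * B)"
    unfolding num by (rule diff_divide_distrib)
  also have "(1 + (norm z)\<^sup>2) * (1 + (norm w)\<^sup>2) / (A * B) = hyp_time z * hyp_time w"
    by (simp add: hyp_time_def A_def B_def)
  also have "4 * (z \<bullet> w) / (A * B) = hyp_space z \<bullet> hyp_space w"
    by (simp add: hyp_space_def A_def B_def mult.commute)
  finally show "cosh (hdist z w) = hyp_time z * hyp_time w - hyp_space z \<bullet> hyp_space w"
    unfolding eq .
qed

lemma cosh_inject: "0 \<le> x \<Longrightarrow> 0 \<le> y \<Longrightarrow> cosh x = cosh y \<Longrightarrow> x = (y::real)"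
  using cosh_real_strict_mono[of x y] cosh_real_strict_mono[of y x] by (cases x y rule: linorder_cases) auto

lemma hdist_eq_0: "norm z < 1 \<Longrightarrow> norm w < 1 \<Longrightarrow> hdist z w = 0 \<Longrightarrow> z = w"
  using cosh_hdist(2)[of z w] one_minus_norm_sq_pos[of z] one_minus_norm_sq_pos[of w] by auto

text \<open>Under the map the squared Euclidean distance acquires the factor
  \<open>C\<^sup>2 / (P\<^sup>2 * Q\<^sup>2)\<close>, and the two terms of the denominator acquire
  \<open>C / P\<^sup>2\<close> and \<open>C / Q\<^sup>2\<close>.\<close>

lemma hdist_Moebius:
  assumes "norm c < 1" "norm z < 1" "norm w < 1"
  shows "hdist (Moebius_function 0 c z) (Moebius_function 0 c w) = hdist z w"
proof (rule cosh_inject[OF hdist_nonneg hdist_nonneg])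
  define P where "P = norm (1 - cnj c * z)"
  define Q where "Q = norm (1 - cnj c * w)"
  define C where "C = 1 - (norm c)\<^sup>2"
  have C: "0 < C" using one_minus_norm_sq_pos assms by (auto simp: C_def)
  have ne: "1 - cnj c * z \<noteq> 0" "1 - cnj c * w \<noteq> 0"
    using one_minus_norm_Moebius_sq(2) assms by auto
  then have PQ: "0 < P" "0 < Q" by (auto simp: P_def Q_def)
  have "Moebius_function 0 c z - Moebius_function 0 c w = of_real C * (z - w) / ((1 - cnj c * z) * (1 - cnj c * w))"
  proof -
    have "of_real C = 1 - c * cnj c" unfolding C_def by (simp only: of_real_diff of_real_1 complex_norm_square)
    then show ?thesis using ne by (simp add: Moebius_function_simple divide_simps) (simp add: algebra_simps)
  qed
  then have "(norm (Moebius_function 0 c z - Moebius_function 0 c w))\<^sup>2 = C\<^sup>2 * (norm (z - w))\<^sup>2 / (P\<^sup>2 * Q\<^sup>2)"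
    using C by (simp add: norm_divide norm_mult power_divide power_mult_distrib P_def Q_def)
  moreover define n where "n = (norm (z - w))\<^sup>2"
  moreover define A where "A = 1 - (norm z)\<^sup>2"
  moreover define B where "B = 1 - (norm w)\<^sup>2"
  ultimately have "cosh (hdist (Moebius_function 0 c z) (Moebius_function 0 c w)) =
      1 + 2 * (C\<^sup>2 * n / (P\<^sup>2 * Q\<^sup>2)) / ((C * A / P\<^sup>2) * (C * B / Q\<^sup>2))"
    using assms by (simp only: cosh_hdist(2) Moebius_function_norm_lt_1 one_minus_norm_Moebius_sq(1) P_def Q_def C_def)
  also have "\<dots> = 1 + 2 * n / (A * B)"
    using C PQ by (simp add: power2_eq_square)
  also have "\<dots> = cosh (hdist z w)"
    using assms by (simp add: cosh_hdist(2) n_def A_def B_def)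
  finally show "cosh (hdist (Moebius_function 0 c z) (Moebius_function 0 c w)) = cosh (hdist z w)" .
qed (simp_all add: Moebius_function_norm_lt_1 assms)

lemma sinh_eq_of_sq: "0 \<le> a \<Longrightarrow> 0 \<le> b \<Longrightarrow> (cosh a)\<^sup>2 - 1 = b\<^sup>2 \<Longrightarrow> sinh a = (b::real)"
  using cosh_square_eq[of a] by (intro power2_eq_imp_eq[of "sinh a" b]) auto

text \<open>On the hyperboloid, equality in the triangle inequality makes \<open>sinh C *\<^sub>R Z - sinh B *\<^sub>R X - sinh A *\<^sub>R Y\<close>
  Lorentz-orthogonal to \<open>X\<close>, \<open>Y\<close> and \<open>Z\<close>, hence zero.\<close>

lemma mem_hsegment_iff:
  assumes x: "norm x < 1" and y: "norm y < 1" and z: "norm z < 1"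
  shows "z \<in> hsegment x y \<longleftrightarrow> klein z \<in> closed_segment (klein x) (klein y)"
proof -
  define A where "A = hdist x z"
  define B where "B = hdist z y"
  define C where "C = hdist x y"
  have nonneg: "0 \<le> A" "0 \<le> B" "0 \<le> C" using hdist_nonneg assms by (auto simp: A_def B_def C_def)
  let ?T = hyp_time and ?V = hyp_space
  have coshs: "cosh A = ?T x * ?T z - ?V x \<bullet> ?V z" "cosh B = ?T z * ?T y - ?V z \<bullet> ?V y"
    "cosh C = ?T x * ?T y - ?V x \<bullet> ?V y"
    using cosh_hdist(1) assms by (auto simp: A_def B_def C_def)
  have self: "?T u * ?T u - ?V u \<bullet> ?V u = 1" if "norm u < 1" for u
    using hyperboloid[OF that] by (simp add: power2_eq_square power2_norm_eq_inner[symmetric])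
  have Tpos: "0 < ?T x" "0 < ?T y" "0 < ?T z" using hyp_time_pos assms by auto
  have "A + B = C \<longleftrightarrow> klein z \<in> closed_segment (klein x) (klein y)"
  proof
    assume ABC: "A + B = C"
    show "klein z \<in> closed_segment (klein x) (klein y)"
    proof (cases "C = 0")
      case True
      then have "A = 0" using ABC nonneg by simp
      then have "x = z" using hdist_eq_0[OF x z] by (simp add: A_def)
      then show ?thesis by simp
    next
      case False
      then have sC: "0 < sinh C" using nonneg by (simp add: less_le)
      define W0 where "W0 = sinh C * ?T z - sinh B * ?T x - sinh A * ?T y"
      define W where "W = sinh C *\<^sub>R ?V z - sinh B *\<^sub>R ?V x - sinh A *\<^sub>R ?V y"
      have lor: "W0 * t - W \<bullet> v = sinh C * (?T z * t - ?V z \<bullet> v) - sinh B * (?T x * t - ?V x \<bullet> v)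
          - sinh A * (?T y * t - ?V y \<bullet> v)" for t v
        by (simp add: W0_def W_def inner_diff_left algebra_simps)
      have coshs': "?T z * ?T x - ?V z \<bullet> ?V x = cosh A" "?T y * ?T z - ?V y \<bullet> ?V z = cosh B"
        "?T y * ?T x - ?V y \<bullet> ?V x = cosh C"
        unfolding coshs by (simp_all add: inner_commute mult.commute)
      have zx: "W0 * ?T x - W \<bullet> ?V x = 0"
      proof -
        have "W0 * ?T x - W \<bullet> ?V x = sinh C * cosh A - sinh B - sinh A * cosh C"
          unfolding lor coshs' self[OF x] by simp
        also have "B = C - A" using ABC by simp
        finally show ?thesis by (simp add: sinh_diff)
      qed
      have zy: "W0 * ?T y - W \<bullet> ?V y = 0"
      proof -
        have "W0 * ?T y - W \<bullet> ?V y = sinh C * cosh B - sinh B * cosh C - sinh A"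
          unfolding lor coshs[symmetric] self[OF y] by simp
        also have "A = C - B" using ABC by simp
        finally show ?thesis by (simp add: sinh_diff)
      qed
      have zz: "W0 * ?T z - W \<bullet> ?V z = 0"
      proof -
        have "W0 * ?T z - W \<bullet> ?V z = sinh C - sinh B * cosh A - sinh A * cosh B"
          unfolding lor coshs[symmetric] coshs' self[OF z] by simp
        also have "C = A + B" using ABC by simp
        finally show ?thesis by (simp add: sinh_add)
      qed
      \<comment> \<open>Orthogonal to the three vectors it is composed of, \<open>(W0, W)\<close> is
        orthogonal to itself. A lightlike vector orthogonal to the timelike \<open>z\<close>
        vanishes, by Cauchy-Schwarz and \<open>norm (?V z) < ?T z\<close>.\<close>
      have "W0 * W0 - W \<bullet> W = sinh C * (W0 * ?T z - W \<bullet> ?V z) - sinh B * (W0 * ?T x - W \<bullet> ?V x) - sinh A * (W0 * ?T y - W \<bullet> ?V y)"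
        unfolding lor[of W0 W] by (simp add: inner_commute mult.commute)
      then have WW: "W0\<^sup>2 = (norm W)\<^sup>2" using zx zy zz by (simp add: power2_eq_square power2_norm_eq_inner[symmetric])
      then have absW: "\<bar>W0\<bar> = norm W" by (metis abs_norm_cancel power2_eq_iff_nonneg abs_ge_zero norm_ge_zero power2_abs)
      have "\<bar>W0\<bar> * ?T z = \<bar>W \<bullet> ?V z\<bar>" using zz Tpos by (metis abs_mult abs_of_pos eq_iff_diff_eq_0)
      also have "\<dots> \<le> \<bar>W0\<bar> * norm (?V z)" unfolding absW by (rule Cauchy_Schwarz_ineq2)
      finally have "\<bar>W0\<bar> * (?T z - norm (?V z)) \<le> 0" by (simp add: algebra_simps)
      moreover have "norm (?V z) < ?T z"
      proof (rule power2_less_imp_less)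
        show "(norm (?V z))\<^sup>2 < (?T z)\<^sup>2" using hyperboloid[OF z] by linarith
        show "0 \<le> ?T z" using Tpos by simp
      qed
      ultimately have "\<bar>W0\<bar> \<le> 0" by (simp add: mult_le_0_iff)
      then have "W0 = 0" by simp
      then have "W = 0" using absW by simp
      \<comment> \<open>Dividing the vector relation by its time component turns it into a convex
        combination in the Klein model; \<open>u\<close> is the weight of \<open>y\<close>.\<close>
      define u where "u = sinh A * ?T y / (sinh C * ?T z)"
      have Tz: "sinh C * ?T z = sinh B * ?T x + sinh A * ?T y" using \<open>W0 = 0\<close> by (simp add: W0_def)
      have Vz: "sinh C *\<^sub>R ?V z = sinh B *\<^sub>R ?V x + sinh A *\<^sub>R ?V y" using \<open>W = 0\<close> by (simp add: W_def diff_diff_eq)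
      have ne: "sinh C * ?T z \<noteq> 0" using sC Tpos by simp
      have "1 - u = (sinh C * ?T z - sinh A * ?T y) / (sinh C * ?T z)"
        unfolding u_def diff_divide_distrib divide_self[OF ne] ..
      also have "sinh C * ?T z - sinh A * ?T y = sinh B * ?T x" using Tz by linarith
      finally have u: "0 \<le> u" "1 - u = sinh B * ?T x / (sinh C * ?T z)"
        using sC Tpos nonneg by (simp_all add: u_def)
      have "0 \<le> sinh B * ?T x / (sinh C * ?T z)" using sC Tpos nonneg by simp
      then have u1: "u \<le> 1" using u(2) by linarith
      have "klein z = (1 / (sinh C * ?T z)) *\<^sub>R (sinh C *\<^sub>R ?V z)"
        using sC Tpos by (simp add: klein_eq[OF z] divide_inverse)
      also have "\<dots> = (1 / (sinh C * ?T z)) *\<^sub>R (sinh B *\<^sub>R (?T x *\<^sub>R klein x) + sinh A *\<^sub>R (?T y *\<^sub>R klein y))"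
        unfolding Vz using Tpos by (simp add: klein_eq[OF x] klein_eq[OF y])
      also have "\<dots> = (1 - u) *\<^sub>R klein x + u *\<^sub>R klein y"
        unfolding u(2) by (simp add: u_def scaleR_add_right)
      finally show ?thesis using u(1) u1 by (auto simp: in_segment)
    qed
  next
    assume "klein z \<in> closed_segment (klein x) (klein y)"
    then obtain u where u: "0 \<le> u" "u \<le> 1" "klein z = (1 - u) *\<^sub>R klein x + u *\<^sub>R klein y"
      by (auto simp: in_segment)
    \<comment> \<open>Rescaling by the time components lifts the Euclidean weights to coefficients
      of the vectors on the hyperboloid.\<close>
    define l where "l = (1 - u) * ?T z / ?T x"
    define m where "m = u * ?T z / ?T y"
    have lm: "0 \<le> l" "0 \<le> m" using u Tpos by (auto simp: l_def m_def)
    have lT: "l * ?T x = (1 - u) * ?T z" "m * ?T y = u * ?T z" using Tpos by (auto simp: l_def m_def)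
    have Tz: "?T z = l * ?T x + m * ?T y" unfolding lT by (simp add: algebra_simps)
    have V: "?V w = ?T w *\<^sub>R klein w" if "norm w < 1" for w
      using hyp_time_pos[OF that] by (simp add: klein_eq[OF that])
    have Vz: "?V z = l *\<^sub>R ?V x + m *\<^sub>R ?V y"
      unfolding V[OF x] V[OF y] V[OF z] u(3) scaleR_scaleR lT by (simp add: scaleR_add_right mult.commute)
    have cA: "cosh A = l + m * cosh C"
    proof -
      have "cosh A = l * (?T x * ?T x - ?V x \<bullet> ?V x) + m * (?T x * ?T y - ?V x \<bullet> ?V y)"
        unfolding coshs(1) Tz Vz by (simp add: inner_add_right algebra_simps)
      then show ?thesis unfolding self[OF x] coshs(3) by simp
    qed
    have cB: "cosh B = l * cosh C + m"
    proof -
      have "cosh B = l * (?T x * ?T y - ?V x \<bullet> ?V y) + m * (?T y * ?T y - ?V y \<bullet> ?V y)"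
        unfolding coshs(2) Tz Vz by (simp add: inner_add_left algebra_simps)
      then show ?thesis unfolding self[OF y] coshs(3) by simp
    qed
    have one: "l * cosh A + m * cosh B = 1"
    proof -
      have "l * cosh A + m * cosh B = ?T z * (l * ?T x + m * ?T y) - ?V z \<bullet> (l *\<^sub>R ?V x + m *\<^sub>R ?V y)"
        unfolding coshs by (simp add: inner_add_right inner_commute algebra_simps)
      then show ?thesis using self[OF z] unfolding Tz[symmetric] Vz[symmetric] by simp
    qed
    have s2: "(sinh C)\<^sup>2 = (cosh C)\<^sup>2 - 1" by (simp add: cosh_square_eq)
    \<comment> \<open>\<open>one\<close> says that \<open>z\<close> has Lorentz norm 1. Subtracted
      from the squared cosines it leaves perfect squares, which exhibit \<open>sinh A\<close> and
      \<open>sinh B\<close> as multiples of \<open>sinh C\<close>.\<close>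
    have "(cosh A)\<^sup>2 - (l * cosh A + m * cosh B) = m\<^sup>2 * ((cosh C)\<^sup>2 - 1)"
      unfolding cA cB by (simp add: power2_eq_square algebra_simps)
    then have sA: "sinh A = m * sinh C"
      using nonneg lm by (intro sinh_eq_of_sq) (simp_all add: one s2 power_mult_distrib)
    have "(cosh B)\<^sup>2 - (l * cosh A + m * cosh B) = l\<^sup>2 * ((cosh C)\<^sup>2 - 1)"
      unfolding cA cB by (simp add: power2_eq_square algebra_simps)
    then have sB: "sinh B = l * sinh C"
      using nonneg lm by (intro sinh_eq_of_sq) (simp_all add: one s2 power_mult_distrib)
    have "cosh (A + B) = cosh A * cosh B + l * m * (sinh C)\<^sup>2"
      unfolding cosh_add sA sB by (simp add: power2_eq_square)
    also have "\<dots> = cosh C * (l * cosh A + m * cosh B)"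
      unfolding s2 unfolding cA cB by (simp add: power2_eq_square algebra_simps)
    also have "\<dots> = cosh C" unfolding one by simp
    finally show "A + B = C" using nonneg cosh_inject[of "A + B" C] by simp
  qed
  then show ?thesis using z by (simp add: hsegment_def A_def B_def C_def)
qed

section \<open>Klein charts and hyperbolic convex hulls\<close>

definition unklein :: "complex \<Rightarrow> complex" where
  "unklein w = (1 / (1 + sqrt (1 - (norm w)\<^sup>2))) *\<^sub>R w"

lemma one_plus_norm_sq_pos: "0 < 1 + (norm (z::complex))\<^sup>2"
  by (simp add: add_pos_nonneg)

lemma one_minus_norm_klein_sq: "1 - (norm (klein z))\<^sup>2 = ((1 - (norm z)\<^sup>2) / (1 + (norm z)\<^sup>2))\<^sup>2"
proof -
  have "1 - (2 / p)\<^sup>2 * N = ((1 - N) / p)\<^sup>2" if "p = 1 + N" "p \<noteq> 0" for p N :: real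
  proof -
    have "p\<^sup>2 - 4 * N = (1 - N)\<^sup>2" unfolding that(1) by (simp add: power2_eq_square algebra_simps)
    then show ?thesis using that(2) by (simp add: power_divide divide_simps)
  qed
  moreover have "1 + (norm z)\<^sup>2 \<noteq> 0" using one_plus_norm_sq_pos[of z] by simp
  ultimately have "1 - (2 / (1 + (norm z)\<^sup>2))\<^sup>2 * (norm z)\<^sup>2 = ((1 - (norm z)\<^sup>2) / (1 + (norm z)\<^sup>2))\<^sup>2"
    by blast
  then show ?thesis unfolding klein_def norm_scaleR power_mult_distrib power2_abs .
qed

lemma norm_klein_less_1:
  assumes "norm z < 1"
  shows "norm (klein z) < 1"
proof -
  have "0 < ((1 - (norm z)\<^sup>2) / (1 + (norm z)\<^sup>2))\<^sup>2"
    using one_minus_norm_sq_pos[OF assms] one_plus_norm_sq_pos[of z] by simp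
  then have "(norm (klein z))\<^sup>2 < 1" using one_minus_norm_klein_sq[of z] by linarith
  then show ?thesis by (simp add: abs_square_less_1)
qed

lemma norm_unklein_less_1:
  assumes "norm w < 1"
  shows "norm (unklein w) < 1"
proof -
  define r where "r = sqrt (1 - (norm w)\<^sup>2)"
  have "0 < r" using one_minus_norm_sq_pos[OF assms] by (simp add: r_def)
  then have "norm (unklein w) = norm w / (1 + r)" by (simp add: unklein_def r_def[symmetric])
  also have "\<dots> \<le> norm w / 1" using \<open>0 < r\<close> by (intro divide_left_mono) auto
  finally have "norm (unklein w) \<le> norm w" by simp
  then show ?thesis using assms by simp
qed

lemma unklein_klein:
  assumes "norm z < 1"
  shows "unklein (klein z) = z"
proof -
  have "1 / (1 + (1 - N) / (1 + N)) * (2 / (1 + N)) = 1" if "0 < 1 + N" for N :: real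
    using that by (simp add: divide_simps)
  note scal = this[OF one_plus_norm_sq_pos[of z]]
  have "sqrt (1 - (norm (klein z))\<^sup>2) = (1 - (norm z)\<^sup>2) / (1 + (norm z)\<^sup>2)"
    unfolding one_minus_norm_klein_sq real_sqrt_abs
    using one_minus_norm_sq_pos[OF assms] one_plus_norm_sq_pos[of z] by (intro abs_of_nonneg) simp
  then have "unklein (klein z) = (1 / (1 + (1 - (norm z)\<^sup>2) / (1 + (norm z)\<^sup>2)) * (2 / (1 + (norm z)\<^sup>2))) *\<^sub>R z"
    by (simp only: unklein_def) (simp only: klein_def scaleR_scaleR)
  then show ?thesis unfolding scal by simp
qed

lemma klein_unklein:
  assumes "norm w < 1"
  shows "klein (unklein w) = w"
proof -
  define r where "r = sqrt (1 - (norm w)\<^sup>2)"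
  have r: "0 < r" "r\<^sup>2 = 1 - (norm w)\<^sup>2" using one_minus_norm_sq_pos[OF assms] by (auto simp: r_def)
  have "(norm (unklein w))\<^sup>2 = (norm w)\<^sup>2 / (1 + r)\<^sup>2"
    using r(1) by (simp add: unklein_def r_def[symmetric] power_mult_distrib power_divide)
  also have "(norm w)\<^sup>2 = (1 - r) * (1 + r)" using r(2) by (simp add: power2_eq_square algebra_simps)
  also have "\<dots> / (1 + r)\<^sup>2 = (1 - r) / (1 + r)" using r(1) by (simp add: power2_eq_square)
  finally have eq: "(norm (unklein w))\<^sup>2 = (1 - r) / (1 + r)" .
  have "1 + (1 - r) / (1 + r) = 2 / (1 + r)" using r(1) by (simp add: divide_simps)
  then have "2 / (1 + (norm (unklein w))\<^sup>2) = 1 + r" unfolding eq by simp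
  then show ?thesis using r(1) by (simp add: klein_def unklein_def r_def[symmetric])
qed

text \<open>The centre is free so that it can be the circumcentre: the circle of radius
  \<open>r\<close> about \<open>c\<close> becomes the Euclidean circle of radius
  \<open>tanh r\<close> about 0.\<close>

definition klein_at :: "complex \<Rightarrow> complex \<Rightarrow> complex" where
  "klein_at c z = klein (Moebius_function 0 c z)"

definition unklein_at :: "complex \<Rightarrow> complex \<Rightarrow> complex" where
  "unklein_at c w = Moebius_function 0 (- c) (unklein w)"

lemma klein_at_inverse:
  assumes "norm c < 1"
  shows "norm z < 1 \<Longrightarrow> unklein_at c (klein_at c z) = z" "norm w < 1 \<Longrightarrow> klein_at c (unklein_at c w) = w"
    "norm z < 1 \<Longrightarrow> norm (klein_at c z) < 1" "norm w < 1 \<Longrightarrow> norm (unklein_at c w) < 1"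
  using assms
  by (simp_all add: klein_at_def unklein_at_def unklein_klein klein_unklein norm_klein_less_1 norm_unklein_less_1
      Moebius_function_norm_lt_1 Moebius_function_compose)

lemma mem_hsegment_iff_klein_at:
  assumes c: "norm c < 1" and x: "norm x < 1" and y: "norm y < 1" and z: "norm z < 1"
  shows "z \<in> hsegment x y \<longleftrightarrow> klein_at c z \<in> closed_segment (klein_at c x) (klein_at c y)"
proof -
  let ?M = "Moebius_function 0 c"
  have "z \<in> hsegment x y \<longleftrightarrow> ?M z \<in> hsegment (?M x) (?M y)"
    using assms by (simp add: hsegment_def hdist_Moebius Moebius_function_norm_lt_1)
  then show ?thesis
    using mem_hsegment_iff[of "?M x" "?M y" "?M z"] assms by (simp add: Moebius_function_norm_lt_1 klein_at_def)
qed

text \<open>The chart exchanges geodesic and Euclidean segments, hence the two notions of convexity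
  and their hulls. The Euclidean hull stays in the unit ball, where the inverse chart is
  available.\<close>

lemma hconvex_hull_eq:
  assumes c: "norm c < 1" and X: "X \<subseteq> ball 0 1"
  shows "hconvex hull X = unklein_at c ` (convex hull (klein_at c ` X))"
    "convex hull (klein_at c ` X) \<subseteq> ball 0 1"
proof -
  let ?C = "convex hull (klein_at c ` X)"
  have Xn: "norm x < 1" if "x \<in> X" for x using X that by auto
  show sub: "?C \<subseteq> ball 0 1"
    using Xn klein_at_inverse(3)[OF c] by (intro hull_minimal) auto
  then have Cn: "norm w < 1" if "w \<in> ?C" for w using that by auto
  have H: "z \<in> unklein_at c ` ?C \<longleftrightarrow> norm z < 1 \<and> klein_at c z \<in> ?C" for z
  proof
    show "z \<in> unklein_at c ` ?C \<Longrightarrow> norm z < 1 \<and> klein_at c z \<in> ?C"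
      using klein_at_inverse(2,4)[OF c Cn] by auto
    show "norm z < 1 \<and> klein_at c z \<in> ?C \<Longrightarrow> z \<in> unklein_at c ` ?C"
      using klein_at_inverse(1)[OF c, of z] by (metis imageI)
  qed
  show "hconvex hull X = unklein_at c ` ?C"
  proof (rule hull_unique)
    have "klein_at c x \<in> ?C" if "x \<in> X" for x using that by (intro hull_inc imageI)
    then show "X \<subseteq> unklein_at c ` ?C" using Xn H by blast
    show "hconvex (unklein_at c ` ?C)"
      unfolding hconvex_def
    proof (intro conjI ballI subsetI)
      fix z assume "z \<in> unklein_at c ` ?C"
      then show "z \<in> ball 0 1" using H by auto
    next
      fix x y z assume xy: "x \<in> unklein_at c ` ?C" "y \<in> unklein_at c ` ?C" and z: "z \<in> hsegment x y"
      have zn: "norm z < 1" using z by (auto simp: hsegment_def)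
      have "klein_at c z \<in> closed_segment (klein_at c x) (klein_at c y)"
        using mem_hsegment_iff_klein_at[OF c _ _ zn, of x y] xy z H by auto
      also have "\<dots> \<subseteq> ?C" using xy H by (intro closed_segment_subset) auto
      finally show "z \<in> unklein_at c ` ?C" using H zn by auto
    qed
  next
    fix T assume XT: "X \<subseteq> T" and T: "hconvex T"
    have Tn: "norm x < 1" if "x \<in> T" for x using T that by (auto simp: hconvex_def)
    have "convex (klein_at c ` T)"
      unfolding convex_contains_segment
    proof clarify
      fix x y w assume xy: "x \<in> T" "y \<in> T" and w: "w \<in> closed_segment (klein_at c x) (klein_at c y)"
      have "closed_segment (klein_at c x) (klein_at c y) \<subseteq> ball 0 1"
        using Tn[OF xy(1)] Tn[OF xy(2)] klein_at_inverse(3)[OF c] by (intro closed_segment_subset) auto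
      then have wn: "norm w < 1" using w by auto
      have "unklein_at c w \<in> hsegment x y"
        using mem_hsegment_iff_klein_at[OF c Tn[OF xy(1)] Tn[OF xy(2)], of "unklein_at c w"] w wn
          klein_at_inverse[OF c] by simp
      then have "unklein_at c w \<in> T" using T xy by (auto simp: hconvex_def)
      then show "w \<in> klein_at c ` T" using klein_at_inverse(2)[OF c wn] by (metis imageI)
    qed
    then have "?C \<subseteq> klein_at c ` T" using XT by (intro hull_minimal) auto
    then show "unklein_at c ` ?C \<subseteq> T"
      using klein_at_inverse(1)[OF c] Tn by force
  qed
qed

lemma continuous_on_unklein_at:
  assumes c: "norm c < 1" and S: "S \<subseteq> ball 0 1"
  shows "continuous_on S (unklein_at c)"
proof -
  have n: "norm w < 1" if "w \<in> S" for w using S that by auto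
  have p: "1 + sqrt (1 - (norm w)\<^sup>2) \<noteq> 0" if "w \<in> S" for w
    using one_minus_norm_sq_pos[OF n[OF that]] by (smt (verit) real_sqrt_gt_zero)
  have cu: "continuous_on S unklein"
    unfolding unklein_def[abs_def] using p by (intro continuous_intros) auto
  have "continuous_on (unklein ` S) (Moebius_function 0 (- c))"
    using c n by (intro continuous_on_subset[OF holomorphic_on_imp_continuous_on[OF Moebius_function_holomorphic]])
      (auto simp: norm_unklein_less_1)
  from continuous_on_compose2[OF this cu] show ?thesis by (simp add: unklein_at_def[abs_def])
qed

section \<open>Transport of area to the Klein model\<close>

text \<open>The conjugate-linear part enters through
  \<open>2 * (u \<bullet> h) = u * cnj h + cnj u * h\<close>, the only place where the derivative is
  not a multiple of \<open>h\<close>.\<close>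

lemma klein_has_derivative:
  "(klein has_derivative (\<lambda>h. of_real (2 / (1 + (norm u)\<^sup>2)\<^sup>2) * h + (- 2 * u\<^sup>2 / of_real ((1 + (norm u)\<^sup>2)\<^sup>2)) * cnj h)) (at u)"
proof -
  define s where "s = 1 + (norm u)\<^sup>2"
  have s: "0 < s" using one_plus_norm_sq_pos by (simp add: s_def)
  have eq: "klein z = (2 / (1 + z \<bullet> z)) *\<^sub>R z" for z by (simp add: klein_def power2_norm_eq_inner)
  have s': "1 + u \<bullet> u = s" by (simp add: s_def power2_norm_eq_inner)
  have "(klein has_derivative (\<lambda>h. (2 / s) *\<^sub>R h + (- (2 * (2 * (u \<bullet> h))) / s\<^sup>2) *\<^sub>R u)) (at u)"
    unfolding eq[abs_def] using s
    by (auto intro!: derivative_eq_intros ext simp: s' inner_commute power2_eq_square divide_inverse algebra_simps)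
  moreover have "(2 / s) *\<^sub>R h + (- (2 * (2 * (u \<bullet> h))) / s\<^sup>2) *\<^sub>R u =
      of_real (2 / s\<^sup>2) * h + (- 2 * u\<^sup>2 / of_real (s\<^sup>2)) * cnj h" for h
  proof -
    have "of_real (2 * (u \<bullet> h)) = u * cnj h + cnj u * h"
      by (simp add: complex_eq_iff inner_complex_def)
    moreover have "of_real s = 1 + u * cnj u" by (simp add: s_def complex_norm_square[symmetric])
    moreover have "of_real (s\<^sup>2) * ((2 / s) *\<^sub>R h + (- (2 * (2 * (u \<bullet> h))) / s\<^sup>2) *\<^sub>R u) =
      2 * of_real s * h - 2 * of_real (2 * (u \<bullet> h)) * u"
      using s by (simp add: scaleR_conv_of_real algebra_simps power2_eq_square)
    ultimately have "of_real (s\<^sup>2) * ((2 / s) *\<^sub>R h + (- (2 * (2 * (u \<bullet> h))) / s\<^sup>2) *\<^sub>R u) = 2 * h - 2 * u\<^sup>2 * cnj h"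
      by (simp only:) (simp add: power2_eq_square algebra_simps)
    moreover have "of_real (s\<^sup>2) * (of_real (2 / s\<^sup>2) * h + (- 2 * u\<^sup>2 / of_real (s\<^sup>2)) * cnj h) = 2 * h - 2 * u\<^sup>2 * cnj h"
      using s by (simp add: algebra_simps)
    ultimately have "of_real (s\<^sup>2) * ((2 / s) *\<^sub>R h + (- (2 * (2 * (u \<bullet> h))) / s\<^sup>2) *\<^sub>R u) =
      of_real (s\<^sup>2) * (of_real (2 / s\<^sup>2) * h + (- 2 * u\<^sup>2 / of_real (s\<^sup>2)) * cnj h)" by simp
    moreover have "(of_real (s\<^sup>2) :: complex) \<noteq> 0" using s by simp
    ultimately show ?thesis by (metis mult_left_cancel)
  qed
  ultimately show ?thesis by (simp add: s_def)
qed

lemma Moebius_has_field_derivative: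
  assumes "1 - cnj c * z \<noteq> 0"
  shows "(Moebius_function 0 c has_field_derivative of_real (1 - (norm c)\<^sup>2) / (1 - cnj c * z)\<^sup>2) (at z)"
proof -
  have "((\<lambda>z. (z - c) / (1 - cnj c * z)) has_field_derivative ((1 - cnj c * z) + (z - c) * cnj c) / (1 - cnj c * z)\<^sup>2) (at z)"
    using assms by (auto intro!: derivative_eq_intros simp: power2_eq_square)
  moreover have "(1 - cnj c * z) + (z - c) * cnj c = of_real (1 - (norm c)\<^sup>2)"
    unfolding of_real_diff of_real_1 complex_norm_square by (simp add: algebra_simps)
  ultimately show ?thesis by (simp add: Moebius_function_simple[abs_def])
qed

lemma emeasure_hyp_area:
  assumes "S \<in> sets borel" "S \<subseteq> ball 0 1"
  shows "emeasure hyp_area S = (\<integral>\<^sup>+z. ennreal (4 / (1 - (norm z)\<^sup>2)\<^sup>2) * indicator S z \<partial>lborel)"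
proof -
  have "emeasure hyp_area S = (\<integral>\<^sup>+z. ennreal (indicator (ball 0 1) z * (4 / (1 - (norm z)\<^sup>2)\<^sup>2)) * indicator S z \<partial>lborel)"
  proof -
    have [measurable]: "ball (0 :: complex) 1 \<in> sets borel" by simp
    have "(\<lambda>z :: complex. indicator (ball 0 1) z * (4 / (1 - (norm z)\<^sup>2)\<^sup>2) :: real) \<in> borel_measurable borel"
      by measurable
    then show ?thesis unfolding hyp_area_def using assms(1) by (intro emeasure_density) simp_all
  qed
  also have "\<dots> = (\<integral>\<^sup>+z. ennreal (4 / (1 - (norm z)\<^sup>2)\<^sup>2) * indicator S z \<partial>lborel)"
    using assms(2) by (intro nn_integral_cong) (auto simp: indicator_def)
  finally show ?thesis .
qed

text \<open>With \<open>N\<close> the squared norm of the Moebius image, the Jacobian of the chart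
  is \<open>4 * (1 - N) / (1 + N) ^ 3 * (C / Q)\<^sup>2\<close> and the Klein density is
  \<open>((1 + N) / (1 - N)) ^ 3\<close>. Their product is the Poincare density because
  \<open>1 - N = C * Z / Q\<close>.\<close>

lemma emeasure_hyp_area_eq_klein:
  assumes c: "norm c < 1" and S: "compact S" "S \<subseteq> ball 0 1"
  shows "emeasure hyp_area S = emeasure klein_measure (klein_at c ` S)"
proof -
  let ?M = "Moebius_function 0 c"
  define D where "D z = of_real (1 - (norm c)\<^sup>2) / (1 - cnj c * z)\<^sup>2" for z
  define p where "p z = of_real (2 / (1 + (norm (?M z))\<^sup>2)\<^sup>2) * D z" for z
  define q where "q z = (- 2 * (?M z)\<^sup>2 / of_real ((1 + (norm (?M z))\<^sup>2)\<^sup>2)) * cnj (D z)" for z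
  have n: "norm z < 1" if "z \<in> S" for z using S that by auto
  have ne: "1 - cnj c * z \<noteq> 0" if "z \<in> S" for z using one_minus_norm_Moebius_sq(2)[OF c n[OF that]] .
  have contM: "continuous_on S ?M"
    using S c by (intro continuous_on_subset[OF holomorphic_on_imp_continuous_on[OF Moebius_function_holomorphic]]) auto
  have contD: "continuous_on S D" unfolding D_def[abs_def] using ne by (intro continuous_intros) auto
  have ne2: "1 + (norm (?M z))\<^sup>2 \<noteq> 0" for z using one_plus_norm_sq_pos[of "?M z"] by simp
  have derN: "(klein_at c has_derivative (\<lambda>h. p z * h + q z * cnj h)) (at z within S)" if "z \<in> S" for z
  proof -
    have "(?M has_derivative (\<lambda>h. D z * h)) (at z within S)"
      using has_derivative_at_withinI[OF Moebius_has_field_derivative[OF ne[OF that], unfolded has_field_derivative_def]]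
      unfolding D_def .
    from has_derivative_compose[OF this klein_has_derivative[of "?M z"]]
    show ?thesis by (simp add: klein_at_def[abs_def] p_def q_def mult_ac)
  qed
  have inj: "inj_on (klein_at c) S" using klein_at_inverse(1)[OF c] n by (metis inj_on_def)
  have sub: "klein_at c ` S \<subseteq> ball 0 1" using klein_at_inverse(3)[OF c] n by auto
  have contN: "continuous_on S (klein_at c)"
    using derN by (meson continuous_on_eq_continuous_within has_derivative_continuous)
  have jac: "\<bar>(norm (p z))\<^sup>2 - (norm (q z))\<^sup>2\<bar> * klein_density (klein_at c z) = 4 / (1 - (norm z)\<^sup>2)\<^sup>2"
    if z: "z \<in> S" for z
  proof -
    define N where "N = (norm (?M z))\<^sup>2"
    define C where "C = 1 - (norm c)\<^sup>2"
    define Q where "Q = (norm (1 - cnj c * z))\<^sup>2"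
    define Z where "Z = 1 - (norm z)\<^sup>2"
    have pos: "0 < C" "0 < Q" "0 < Z" using one_minus_norm_sq_pos c n[OF z] ne[OF z] by (auto simp: C_def Q_def Z_def)
    have N1: "1 - N = C * Z / Q"
      using one_minus_norm_Moebius_sq(1)[OF c n[OF z]] by (simp add: N_def C_def Z_def Q_def)
    have N0: "0 \<le> N" "0 < 1 - N" using pos by (auto simp: N1) (simp add: N_def)
    have nD: "norm (D z) = C / Q"
      using pos(1) unfolding D_def C_def[symmetric] norm_divide norm_of_real norm_power Q_def by simp
    have np: "norm (p z) = 2 / (1 + N)\<^sup>2 * (C / Q)"
      unfolding p_def norm_mult norm_of_real nD N_def[symmetric] using N0 by simp
    have nq: "norm (q z) = 2 * N / (1 + N)\<^sup>2 * (C / Q)"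
      unfolding q_def norm_mult norm_divide complex_mod_cnj nD norm_of_real norm_power N_def[symmetric]
      using N0 by (simp add: norm_mult N_def norm_power)
    have dens: "klein_density (klein_at c z) = ((1 + N) / (1 - N)) ^ 3"
      unfolding klein_density_def klein_at_def one_minus_norm_klein_sq N_def[symmetric] real_sqrt_abs
      using N0 by (simp add: power_divide)
    have "(norm (p z))\<^sup>2 - (norm (q z))\<^sup>2 = 4 * (1 - N) / (1 + N) ^ 3 * (C / Q)\<^sup>2"
    proof -
      have "(norm (p z))\<^sup>2 - (norm (q z))\<^sup>2 = 4 * (1 - N\<^sup>2) / ((1 + N)\<^sup>2)\<^sup>2 * (C / Q)\<^sup>2"
        unfolding np nq by (simp add: power_mult_distrib power_divide diff_divide_distrib algebra_simps)
      also have "4 * (1 - N\<^sup>2) / ((1 + N)\<^sup>2)\<^sup>2 = 4 * (1 - N) / (1 + N) ^ 3"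
      proof -
        have "4 * (1 - N\<^sup>2) = (4 * (1 - N)) * (1 + N)" by (simp add: power2_eq_square algebra_simps)
        moreover have "((1 + N)\<^sup>2)\<^sup>2 = (1 + N) ^ 3 * (1 + N)" by (simp add: power2_eq_square power3_eq_cube)
        ultimately show ?thesis using N0 by simp
      qed
      finally show ?thesis .
    qed
    moreover have "0 \<le> 4 * (1 - N) / (1 + N) ^ 3 * (C / Q)\<^sup>2" using N0 by simp
    ultimately have "\<bar>(norm (p z))\<^sup>2 - (norm (q z))\<^sup>2\<bar> = 4 * (1 - N) / (1 + N) ^ 3 * (C / Q)\<^sup>2"
      by (simp only: abs_of_nonneg)
    then have "\<bar>(norm (p z))\<^sup>2 - (norm (q z))\<^sup>2\<bar> * klein_density (klein_at c z)
        = 4 * (1 - N) / (1 + N) ^ 3 * (C / Q)\<^sup>2 * ((1 + N) / (1 - N)) ^ 3"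
      unfolding dens by (simp only:)
    also have "\<dots> = 4 * (C / Q)\<^sup>2 / (1 - N)\<^sup>2"
    proof -
      have cancel: "4 * b / a ^ 3 * x * (a / b) ^ 3 = 4 * x / b\<^sup>2" if "a \<noteq> 0" "b \<noteq> 0" for a b x :: real
        using that by (simp add: power_divide power2_eq_square power3_eq_cube)
      show ?thesis by (rule cancel) (use N0 in auto)
    qed
    also have "\<dots> = 4 / Z\<^sup>2" unfolding N1 using pos by (simp add: power_divide power_mult_distrib)
    finally show ?thesis by (simp add: Z_def)
  qed
  have "emeasure klein_measure (klein_at c ` S) =
      (\<integral>\<^sup>+w. ennreal (klein_density w) * indicator (klein_at c ` S) w \<partial>lborel)"
    by (intro emeasure_klein_measure borel_compact compact_continuous_image contN S)
  also have "\<dots> = (\<integral>\<^sup>+z. ennreal (\<bar>(norm (p z))\<^sup>2 - (norm (q z))\<^sup>2\<bar> * klein_density (klein_at c z)) * indicator S z \<partial>lborel)"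
  proof (rule nn_integral_complex_change_of_variables[OF S(1) inj derN])
    have "complex_of_real ((1 + (norm (?M z))\<^sup>2)\<^sup>2) \<noteq> 0" for z
      unfolding of_real_eq_0_iff power_eq_0_iff using ne2 by blast
    moreover have "(1 + (norm (?M z))\<^sup>2)\<^sup>2 \<noteq> 0" for z
      unfolding power_eq_0_iff using ne2 by blast
    ultimately show "continuous_on S p" "continuous_on S q" unfolding p_def[abs_def] q_def[abs_def]
      by (intro continuous_on_mult continuous_on_divide continuous_on_of_real continuous_on_power continuous_on_add
        continuous_on_norm continuous_on_cnj continuous_on_const contM contD ballI; blast)+
    show "continuous_on (klein_at c ` S) klein_density" by (rule continuous_on_klein_density[OF sub])
    show "0 \<le> klein_density w" if "w \<in> klein_at c ` S" for w using sub that by (intro klein_density_nonneg) auto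
  qed
  also have "\<dots> = (\<integral>\<^sup>+z. ennreal (4 / (1 - (norm z)\<^sup>2)\<^sup>2) * indicator S z \<partial>lborel)"
    using jac by (intro nn_integral_cong) (auto simp: indicator_def)
  also have "\<dots> = emeasure hyp_area S" using S by (intro emeasure_hyp_area[symmetric] borel_compact)
  finally show ?thesis ..
qed

lemma emeasure_hconvex_hull:
  assumes c: "norm c < 1" and X: "finite X" "X \<subseteq> ball 0 1"
  shows "emeasure hyp_area (hconvex hull X) = emeasure klein_measure (convex hull (klein_at c ` X))"
proof -
  let ?C = "convex hull (klein_at c ` X)"
  have H: "hconvex hull X = unklein_at c ` ?C" and sub: "?C \<subseteq> ball 0 1"
    using hconvex_hull_eq[OF c X(2)] by auto
  have "compact ?C" using X(1) by (intro compact_convex_hull finite_imp_compact) auto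
  then have "compact (hconvex hull X)"
    unfolding H by (intro compact_continuous_image continuous_on_unklein_at c sub)
  moreover have "hconvex hull X \<subseteq> ball 0 1"
    unfolding H using sub klein_at_inverse(4)[OF c] by force
  ultimately have "emeasure hyp_area (hconvex hull X) = emeasure klein_measure (klein_at c ` (hconvex hull X))"
    by (rule emeasure_hyp_area_eq_klein[OF c])
  also have "klein_at c ` (hconvex hull X) = ?C"
  proof -
    have "(\<lambda>w. klein_at c (unklein_at c w)) ` ?C = (\<lambda>w. w) ` ?C"
      using sub klein_at_inverse(2)[OF c] by (intro image_cong) auto
    then show ?thesis unfolding H image_image by simp
  qed
  finally show ?thesis .
qed

section \<open>Cyclic polygons\<close>

lemma tanh_half_bounds: "0 < r \<Longrightarrow> 0 < tanh (r / 2 :: real)" "tanh (r / 2) < (1::real)"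
  by (simp_all add: tanh_real_lt_1)

lemma norm_hpolar_arg: "0 < r \<Longrightarrow> norm (of_real (tanh (r / 2)) * cis t) = tanh (r / 2)"
  using tanh_half_bounds(1)[of r] by (simp add: norm_mult)

lemma norm_hpolar_less_1:
  assumes "norm c < 1" "0 < r"
  shows "norm (hpolar c r t) < 1"
  using assms tanh_half_bounds(2)[of r] norm_hpolar_arg[OF assms(2), of t] unfolding hpolar_def
  by (intro Moebius_function_norm_lt_1) auto

lemma klein_at_hpolar:
  assumes c: "norm c < 1" and r: "0 < r"
  shows "klein_at c (hpolar c r t) = of_real (tanh r) * cis t"
proof -
  have "tanh r = 2 * tanh (r / 2) / (1 + (tanh (r / 2))\<^sup>2)"
    using tanh_add[of "r / 2" "r / 2"] by (simp add: power2_eq_square)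
  then show ?thesis
    using norm_hpolar_arg[OF r, of t] tanh_half_bounds(2)[of r] c
    by (simp add: klein_at_def hpolar_def Moebius_function_compose klein_def scaleR_conv_of_real)
qed

lemma hpolar_eq_iff:
  assumes c: "norm c < 1" and r: "0 < r"
  shows "hpolar c r a = hpolar c r b \<longleftrightarrow> (\<exists>k::int. a = b + 2 * pi * k)"
proof
  assume "hpolar c r a = hpolar c r b"
  then have "of_real (tanh r) * cis a = of_real (tanh r) * cis b" using klein_at_hpolar[OF assms] by metis
  then have "cis a = cis b" using r by simp
  then show "\<exists>k::int. a = b + 2 * pi * k"
    using sin_cos_eq_iff[of a b] by (simp add: complex_eq_iff)
next
  assume "\<exists>k::int. a = b + 2 * pi * k"
  then show "hpolar c r a = hpolar c r b" by (auto simp: hpolar_def cis_shift)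
qed

lemma hpolar_shift: "hpolar c r (t + 2 * pi * of_int k) = hpolar c r t"
  by (simp add: hpolar_def cis_shift)

lemma one_minus_tanh_sq: "1 - (tanh r)\<^sup>2 = 1 / (cosh (r::real))\<^sup>2"
proof -
  have "(cosh r)\<^sup>2 - (sinh r)\<^sup>2 = 1" by (simp add: cosh_square_eq)
  moreover have "1 - (tanh r)\<^sup>2 = ((cosh r)\<^sup>2 - (sinh r)\<^sup>2) / (cosh r)\<^sup>2"
    by (simp add: tanh_def power_divide diff_divide_distrib)
  ultimately show ?thesis by simp
qed

lemma artanh_inject:
  assumes "0 \<le> x" "x < 1" "0 \<le> y" "y < (1::real)" "artanh x = artanh y"
  shows "x = y"
proof -
  have "0 < (1 + x) / (1 - x)" "0 < (1 + y) / (1 - y)" using assms by auto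
  moreover have "ln ((1 + x) / (1 - x)) = ln ((1 + y) / (1 - y))" using assms(5) by (simp add: artanh_def)
  ultimately have "(1 + x) / (1 - x) = (1 + y) / (1 - y)" by (simp only: ln_inj_iff)
  then show ?thesis using assms by (simp add: frac_eq_eq algebra_simps)
qed

text \<open>The law of sines in one half of the isosceles triangle over the chord, obtained here
  from the Euclidean chord length after moving the centre to 0.\<close>

lemma sinh_half_hdist_hpolar:
  assumes c: "norm c < 1" and r: "0 < r"
  shows "sinh (hdist (hpolar c r a) (hpolar c r b) / 2) = sinh r * \<bar>sin ((a - b) / 2)\<bar>"
proof -
  define \<rho> where "\<rho> = tanh (r / 2)"
  define x where "x = of_real \<rho> * cis a"
  define y where "y = of_real \<rho> * cis b"
  define D where "D = hdist (hpolar c r a) (hpolar c r b)"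
  have \<rho>: "0 < \<rho>" "\<rho> < 1" using r by (auto simp: \<rho>_def tanh_real_lt_1)
  have n: "norm x = \<rho>" "norm y = \<rho>" using \<rho> by (auto simp: x_def y_def norm_mult)
  have D: "D = hdist x y"
    unfolding D_def hpolar_def \<rho>_def[symmetric] x_def[symmetric] y_def[symmetric]
    using c \<rho> n by (intro hdist_Moebius) auto
  have "(norm (x - y))\<^sup>2 = \<rho>\<^sup>2 * (norm (cis a - cis b))\<^sup>2"
    unfolding x_def y_def using \<rho> by (simp add: right_diff_distrib[symmetric] norm_mult power_mult_distrib)
  also have "(norm (cis a - cis b))\<^sup>2 = 2 - 2 * cos (a - b)"
    using cos_minus[of "a - b"] by (simp add: power2_norm_eq_inner inner_diff cis_inner_cis)
  also have "2 - 2 * cos (a - b) = 4 * (sin ((a - b) / 2))\<^sup>2"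
  proof -
    have "2 * ((a - b) / 2) = a - b" by simp
    then have "cos (a - b) = 1 - 2 * (sin ((a - b) / 2))\<^sup>2"
      using cos_double_sin[of "(a - b) / 2"] by (simp only:)
    then show ?thesis by simp
  qed
  finally have xy: "(norm (x - y))\<^sup>2 = \<rho>\<^sup>2 * (4 * (sin ((a - b) / 2))\<^sup>2)" .
  have sr: "sinh r = 2 * \<rho> / (1 - \<rho>\<^sup>2)"
  proof -
    have "1 - \<rho>\<^sup>2 = 1 / (cosh (r / 2))\<^sup>2" unfolding \<rho>_def by (rule one_minus_tanh_sq)
    then show ?thesis using sinh_double[of "r / 2"] by (simp add: \<rho>_def tanh_def power2_eq_square)
  qed
  have p: "0 < 1 - \<rho>\<^sup>2" using \<rho> by (simp add: abs_square_less_1)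
  have "2 * (sinh (D / 2))\<^sup>2 = cosh D - 1"
    using cosh_double_cosh[of "D / 2"] by (simp add: sinh_square_eq)
  also have "\<dots> = 2 * (norm (x - y))\<^sup>2 / ((1 - \<rho>\<^sup>2) * (1 - \<rho>\<^sup>2))"
    unfolding D using \<rho> n by (simp add: cosh_hdist(2))
  also have "\<dots> = 2 * (sinh r * \<bar>sin ((a - b) / 2)\<bar>)\<^sup>2"
    unfolding xy sr using p by (simp add: power_mult_distrib power_divide power2_eq_square)
  finally have "(sinh (D / 2))\<^sup>2 = (sinh r * \<bar>sin ((a - b) / 2)\<bar>)\<^sup>2" by simp
  moreover have "0 \<le> D" unfolding D_def by (intro hdist_nonneg norm_hpolar_less_1 c r)
  ultimately show ?thesis using r unfolding D_def
    by (intro power2_eq_imp_eq[of "sinh (hdist (hpolar c r a) (hpolar c r b) / 2)"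
          "sinh r * \<bar>sin ((a - b) / 2)\<bar>"]) auto
qed

lemma mem_hcircle_iff:
  assumes c: "norm c < 1" and r: "0 < r"
  shows "z \<in> hcircle c r \<longleftrightarrow> (\<exists>t. z = hpolar c r t)"
proof
  assume "z \<in> hcircle c r"
  then have z: "norm z < 1" "hdist c z = r" by (auto simp: hcircle_def)
  define w where "w = Moebius_function 0 c z"
  have wn: "norm w < 1" unfolding w_def by (intro Moebius_function_norm_lt_1 c z)
  have "hdist 0 w = r"
    using hdist_Moebius[OF c c z(1)] z(2) by (simp add: w_def Moebius_function_eq_zero)
  then have "artanh (norm w) = artanh (tanh (r / 2))"
    by (simp add: hdist_def Moebius_function_of_zero artanh_tanh_real)
  then have "norm w = tanh (r / 2)"
    using artanh_inject[of "norm w" "tanh (r / 2)"] wn tanh_half_bounds[of r] r by simp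
  then have "w = of_real (tanh (r / 2)) * cis (Arg w)" by (metis rcis_cmod_Arg rcis_def)
  moreover have "z = Moebius_function 0 (- c) w"
    unfolding w_def using c z by (simp add: Moebius_function_compose)
  ultimately show "\<exists>t. z = hpolar c r t" unfolding hpolar_def by metis
next
  assume "\<exists>t. z = hpolar c r t"
  then obtain t where t: "z = hpolar c r t" by blast
  have zn: "norm z < 1" unfolding t by (rule norm_hpolar_less_1[OF assms])
  define w where "w = of_real (tanh (r / 2)) * cis t"
  have wn: "norm w = tanh (r / 2)" unfolding w_def by (rule norm_hpolar_arg[OF r])
  have "hdist c z = hdist (Moebius_function 0 (- c) 0) (Moebius_function 0 (- c) w)"
    by (simp add: Moebius_function_of_zero t hpolar_def w_def)
  also have "\<dots> = hdist 0 w" using c wn tanh_half_bounds(2)[of r] by (intro hdist_Moebius) auto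
  also have "\<dots> = r" by (simp add: hdist_def Moebius_function_of_zero wn artanh_tanh_real)
  finally show "z \<in> hcircle c r" using zn by (simp add: hcircle_def)
qed

text \<open>All lifts are normalised to one turn starting at the angle of \<open>x 0\<close>. The
  condition on arcs then forbids them to coincide or to step back; it concerns only the arcs ending
  at \<open>x 1\<close> to \<open>x (n - 1)\<close>, and the closing side takes the rest of the
  turn.\<close>

lemma cyclic_ngon_angles:
  assumes n: "n \<ge> 2" and ngon: "cyclic_ngon n d x"
  obtains c r t where "norm c < 1" "0 < r" "inscribed_polygon (tanh r) n t"
    "\<And>i. i < n \<Longrightarrow> x i = hpolar c r (t i)"
proof -
  obtain c r where c: "norm c < 1" and r: "0 < r" and circ: "\<And>i. i < n \<Longrightarrow> x i \<in> hcircle c r"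
    and arcs: "\<And>i j. i \<in> {1..<n} \<Longrightarrow> j < n \<Longrightarrow> j \<noteq> i \<Longrightarrow> x j \<notin> ccw_arc c r (x (i - 1)) (x i)"
    using ngon by (auto simp: cyclic_ngon_def)
  obtain \<tau> where \<tau>: "\<And>i. i < n \<Longrightarrow> x i = hpolar c r (\<tau> i)"
    using circ mem_hcircle_iff[OF c r] bchoice[of "{..<n}" "\<lambda>i s. x i = hpolar c r s"] by auto
  have "\<exists>s. x i = hpolar c r s \<and> \<tau> 0 \<le> s \<and> s < \<tau> 0 + 2 * pi" if "i < n" for i
  proof -
    obtain k :: int where "\<tau> 0 \<le> \<tau> i + 2 * pi * k" "\<tau> i + 2 * pi * k < \<tau> 0 + 2 * pi" by (rule angle_shift)
    then show ?thesis using \<tau>[OF that] hpolar_shift by metis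
  qed
  then obtain u where u: "\<And>i. i < n \<Longrightarrow> x i = hpolar c r (u i) \<and> \<tau> 0 \<le> u i \<and> u i < \<tau> 0 + 2 * pi"
    using bchoice[of "{..<n}" "\<lambda>i s. x i = hpolar c r s \<and> \<tau> 0 \<le> s \<and> s < \<tau> 0 + 2 * pi"] by auto
  define t where "t i = (if i = 0 then \<tau> 0 else if i = n then \<tau> 0 + 2 * pi else u i)" for i
  have t: "x i = hpolar c r (t i)" "t 0 \<le> t i" "t i < t 0 + 2 * pi" if "i < n" for i
    using u[OF that] \<tau>[OF that] that by (auto simp: t_def)
  \<comment> \<open>A vertex lies on the arc that ends at it, even when it equals its predecessor,
    since that arc is then the whole circle. Another vertex at the same place would lie on it as
    well.\<close>
  have distinct: "x j \<noteq> x i" if i: "i \<in> {1..<n}" and j: "j < n" "j \<noteq> i" for i j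
  proof -
    obtain k :: int where k: "t (i - 1) \<le> t i + 2 * pi * k" "t i + 2 * pi * k < t (i - 1) + 2 * pi" by (rule angle_shift)
    have "\<exists>v. x i = hpolar c r v \<and> t (i - 1) < v \<and> v \<le> t (i - 1) + 2 * pi"
    proof (cases "t (i - 1) = t i + 2 * pi * k")
      case True
      have "x i = hpolar c r (t (i - 1) + 2 * pi)"
        using hpolar_shift[of c r "t i" k] hpolar_shift[of c r "t (i - 1)" 1] t(1)[of i] i True by auto
      then show ?thesis by (intro exI[of _ "t (i - 1) + 2 * pi"]) auto
    next
      case False
      then show ?thesis using k t(1)[of i] i hpolar_shift[of c r "t i" k]
        by (intro exI[of _ "t i + 2 * pi * k"]) auto
    qed
    moreover have "x (i - 1) = hpolar c r (t (i - 1))" using t(1)[of "i - 1"] i by auto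
    ultimately have "x i \<in> ccw_arc c r (x (i - 1)) (x i)" unfolding ccw_arc_def by blast
    then show ?thesis using arcs[OF i j] by metis
  qed
  have gt0: "t 0 < t i" if "i \<in> {1..<n}" for i
    using distinct[OF that, of 0] t[of i] t[of 0] that by (cases "t i = t 0") auto
  have tn: "t n = t 0 + 2 * pi" using n unfolding t_def by simp
  have less: "t k < t (Suc k)" if "k < n" for k
  proof (cases "Suc k = n")
    case True
    then show ?thesis using t(3)[OF that] tn by simp
  next
    case False
    then have i: "Suc k \<in> {1..<n}" using that by auto
    show ?thesis
    proof (cases "k = 0")
      case True
      then show ?thesis using gt0[OF i] by simp
    next
      case k0: False
      show ?thesis
      proof (rule ccontr)
        assume "\<not> ?thesis"
        moreover have "t k \<noteq> t (Suc k)" using distinct[OF i, of k] t(1)[of k] t(1)[of "Suc k"] i that by auto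
        ultimately have lt: "t (Suc k) < t k" by simp
        \<comment> \<open>A step back would make the counterclockwise arc from vertex
          \<open>k\<close> to vertex \<open>Suc k\<close> run past the start of the turn, where
          \<open>x 0\<close> sits.\<close>
        have "x 0 \<in> ccw_arc c r (x (Suc k - 1)) (x (Suc k))"
          unfolding ccw_arc_def mem_Collect_eq
        proof (intro exI conjI)
          show "x 0 = hpolar c r (t 0 + 2 * pi)" using t(1)[of 0] n hpolar_shift[of c r "t 0" 1] by simp
          show "x (Suc k - 1) = hpolar c r (t k)" using t(1)[of k] that by simp
          show "x (Suc k) = hpolar c r (t (Suc k) + 2 * pi)"
            using t(1)[of "Suc k"] i hpolar_shift[of c r "t (Suc k)" 1] by simp
        qed (use lt t(3)[OF that] gt0[OF i] in auto)
        then show False using arcs[OF i, of 0] n by simp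
      qed
    qed
  qed
  have "t (Suc k) - t k < 2 * pi" if "k < n" for k
  proof (cases "k = 0")
    case True
    then show ?thesis using t(3)[of 1] n by simp
  next
    case False
    have "t (Suc k) \<le> t 0 + 2 * pi"
      using t(3)[of "Suc k"] tn that by (cases "Suc k = n") auto
    then show ?thesis using gt0[of k] False that by simp
  qed
  then have "inscribed_polygon (tanh r) n t"
    using r less tn by unfold_locales auto
  from that[OF c r this t(1)] show ?thesis .
qed

text \<open>Side \<open>i\<close> of \<^const>\<open>cyclic_ngon\<close> ends at vertex \<open>i\<close>, side \<open>k\<close> of \<^locale>\<open>inscribed_polygon\<close> starts at
  vertex \<open>k\<close>.\<close>

definition side_index :: "nat \<Rightarrow> nat \<Rightarrow> nat" where
  "side_index n i = (if i = 0 then n - 1 else i - 1)"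

lemma sum_side_index:
  fixes g :: "nat \<Rightarrow> real"
  shows "(\<Sum>i<n. g (side_index n i)) = (\<Sum>k<n. g k)"
  by (rule sum.reindex_bij_witness[where i = "\<lambda>k. if k = n - 1 then 0 else Suc k" and j = "side_index n"])
    (auto simp: side_index_def)

lemma cyclic_ngon_area:
  assumes n: "n \<ge> 2" and ngon: "cyclic_ngon n d x"
  obtains \<kappa> \<alpha> where "circular_angles {..<n} (\<lambda>i. half_sinh (d i)) \<kappa> \<alpha>"
    "measure hyp_area (hconvex hull (x ` {..<n})) =
      2 * ((\<Sum>i<n. arccos (cos (\<alpha> i) / sqrt (1 + (half_sinh (d i))\<^sup>2))) - pi)"
proof -
  obtain c r t where c: "norm c < 1" and r: "0 < r" and P: "inscribed_polygon (tanh r) n t"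
    and x: "\<And>i. i < n \<Longrightarrow> x i = hpolar c r (t i)"
    using cyclic_ngon_angles[OF assms] by metis
  interpret inscribed_polygon "tanh r" n t by (rule P)
  have sr: "0 < sinh r" using r by simp
  have xn: "x 0 = hpolar c r (t n)" using x[OF n_pos] hpolar_shift[of c r "t 0" 1] by (simp add: full)
  have side: "half_sinh (ereal (hdist (hpolar c r (t k)) (hpolar c r (t (Suc k))))) = sinh r * sin (half k)"
    if "k < n" for k
  proof -
    have "\<bar>sin ((t k - t (Suc k)) / 2)\<bar> = \<bar>sin (half k)\<bar>"
      using sin_minus[of "half k"] by (simp add: half_def minus_divide_left)
    also have "\<dots> = sin (half k)" using half_bounds[OF that] by (simp add: sin_ge_zero)
    finally show ?thesis by (simp add: half_sinh_def sinh_half_hdist_hpolar[OF c r])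
  qed
  define \<alpha> where "\<alpha> i = half (side_index n i)" for i
  have a: "half_sinh (d i) = sinh r * sin (\<alpha> i)" if "i < n" for i
  proof (cases "i = 0")
    case True
    have "ereal (hdist (x (n - 1)) (x 0)) = d 0" using ngon by (simp add: cyclic_ngon_def)
    then show ?thesis
      using side[of "n - 1"] x[of "n - 1"] xn n_pos True by (simp add: \<alpha>_def side_index_def)
  next
    case False
    then have "ereal (hdist (x (i - 1)) (x i)) = d i" using ngon that by (simp add: cyclic_ngon_def)
    then show ?thesis
      using side[of "i - 1"] x[of "i - 1"] x[OF that] that False by (simp add: \<alpha>_def side_index_def)
  qed
  have idx: "side_index n i < n" if "i < n" for i using that by (auto simp: side_index_def)
  have ang: "circular_angles {..<n} (\<lambda>i. half_sinh (d i)) (1 / sinh r) \<alpha>"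
    using sr a half_bounds idx sum_half
    by (simp add: circular_angles_def) (simp add: \<alpha>_def sum_side_index[of half])
  have area: "measure hyp_area (hconvex hull (x ` {..<n})) =
      2 * ((\<Sum>i<n. arccos (cos (\<alpha> i) / sqrt (1 + (half_sinh (d i))\<^sup>2))) - pi)"
  proof -
    have "klein_at c ` x ` {..<n} = vertex ` {..<n}"
      unfolding image_image using x by (intro image_cong) (simp_all add: klein_at_hpolar[OF c r] vertex_def)
    moreover have "x ` {..<n} \<subseteq> ball 0 1" using x norm_hpolar_less_1[OF c r] by auto
    ultimately have "emeasure hyp_area (hconvex hull (x ` {..<n})) = emeasure klein_measure polygon"
      using emeasure_hconvex_hull[OF c, of "x ` {..<n}"] by (simp add: polygon_def)
    then have "measure hyp_area (hconvex hull (x ` {..<n})) = measure klein_measure polygon"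
      by (simp add: measure_def)
    also have "\<dots> = 2 * ((\<Sum>k<n. arccos (cos (half k) / sqrt (1 + (tanh r / sqrt (1 - (tanh r)\<^sup>2) * sin (half k))\<^sup>2))) - pi)"
      by (rule measure_polygon) (rule tanh_real_lt_1)
    also have "tanh r / sqrt (1 - (tanh r)\<^sup>2) = sinh r"
      unfolding one_minus_tanh_sq by (simp add: real_sqrt_divide tanh_def)
    also have "(\<Sum>k<n. arccos (cos (half k) / sqrt (1 + (sinh r * sin (half k))\<^sup>2))) =
        (\<Sum>i<n. arccos (cos (\<alpha> i) / sqrt (1 + (sinh r * sin (\<alpha> i))\<^sup>2)))"
      unfolding \<alpha>_def by (rule sum_side_index[symmetric])
    also have "\<dots> = (\<Sum>i<n. arccos (cos (\<alpha> i) / sqrt (1 + (half_sinh (d i))\<^sup>2)))"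
      using a by (intro sum.cong) auto
    finally show ?thesis .
  qed
  show ?thesis by (rule that[OF ang area])
qed

text \<open>Circle about 0 with \<open>sinh r = 1 / \<kappa>\<close>, vertices at the partial sums
  of the central angles. That the angles add up to \<pi> makes the closing side come out
  right.\<close>

lemma cyclic_ngon_exists:
  assumes n: "n \<ge> 2" and fin: "\<And>i. i < n \<Longrightarrow> \<bar>d i\<bar> \<noteq> \<infinity>"
    and ang: "circular_angles {..<n} (\<lambda>i. half_sinh (d i)) \<kappa> \<alpha>"
  obtains x where "cyclic_ngon n d x"
proof -
  have \<kappa>: "0 < \<kappa>" and sum: "sum \<alpha> {..<n} = pi" and \<alpha>: "\<And>i. i < n \<Longrightarrow> 0 < \<alpha> i"
    "\<And>i. i < n \<Longrightarrow> \<alpha> i < pi" "\<And>i. i < n \<Longrightarrow> sin (\<alpha> i) = \<kappa> * half_sinh (d i)"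
    using ang by (auto simp: circular_angles_def)
  define r where "r = arsinh (1 / \<kappa>)"
  have r: "0 < r" "sinh r = 1 / \<kappa>" using \<kappa> by (auto simp: r_def)
  have c: "norm (0::complex) < 1" by simp
  \<comment> \<open>The sum starts at 1 because side \<open>j\<close> ends at vertex
    \<open>j\<close>; the angle \<open>\<alpha> 0\<close> is left for the side from
    \<open>x (n - 1)\<close> to \<open>x 0\<close>.\<close>
  define t where "t j = 2 * sum \<alpha> {1..j}" for j
  define x where "x j = hpolar 0 r (t j)" for j
  have step: "t (Suc j) = t j + 2 * \<alpha> (Suc j)" for j by (simp add: t_def)
  have mono: "t i < t j" if "i < j" "j < n" for i j
    using that
  proof (induction j)
    case (Suc j)
    then show ?case using step[of j] \<alpha>(1)[of "Suc j"] by (cases "i = j") auto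
  qed simp
  have t0: "t 0 = 0" by (simp add: t_def)
  have split: "pi = \<alpha> 0 + sum \<alpha> {1..<n}"
    using n sum by (simp add: sum.atLeast_Suc_lessThan lessThan_atLeast0)
  have last: "t (n - 1) = 2 * pi - 2 * \<alpha> 0"
  proof -
    have "{1..n - 1} = {1..<n}" using n by auto
    then show ?thesis using split by (simp add: t_def)
  qed
  have lt: "t j < 2 * pi" if "j < n" for j
  proof (cases "j = n - 1")
    case False
    then have "t j < t (n - 1)" using that by (intro mono) auto
    then show ?thesis using last \<alpha>(1)[of 0] n by linarith
  next
    case True
    then show ?thesis using last \<alpha>(1)[of 0] n by simp
  qed
  have ge: "0 \<le> t j" if "j < n" for j
    using mono[of 0 j] t0 that by (cases "j = 0") auto
  have sinpos: "0 \<le> sin (\<alpha> k)" if "k < n" for k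
    using \<alpha>(1,2)[OF that] by (intro sin_ge_zero) auto
  have hd: "ereal (hdist (x i) (x j)) = d k" if "k < n" "\<bar>sin ((t i - t j) / 2)\<bar> = sin (\<alpha> k)" for i j k
  proof -
    have "sinh (hdist (x i) (x j) / 2) = half_sinh (d k)"
      unfolding x_def sinh_half_hdist_hpolar[OF c r(1)] that(2) r(2) using \<alpha>(3)[OF that(1)] \<kappa> by simp
    then have "hdist (x i) (x j) = real_of_ereal (d k)" by (simp add: half_sinh_def)
    then show ?thesis using fin[OF that(1)] by (simp add: ereal_real)
  qed
  have "ereal (hdist (x (i - 1)) (x i)) = d i" if "i \<in> {1..<n}" for i
  proof (rule hd)
    have "t (i - 1) - t i = - (2 * \<alpha> i)" using step[of "i - 1"] that by simp
    then show "\<bar>sin ((t (i - 1) - t i) / 2)\<bar> = sin (\<alpha> i)"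
      using sinpos[of i] that by simp
  qed (use that in auto)
  moreover have "ereal (hdist (x (n - 1)) (x 0)) = d 0"
  proof (rule hd)
    have eq: "(t (n - 1) - t 0) / 2 = pi - \<alpha> 0" using last t0 by simp
    show "\<bar>sin ((t (n - 1) - t 0) / 2)\<bar> = sin (\<alpha> 0)"
      unfolding eq using sinpos[of 0] n by simp
  qed (use n in auto)
  moreover have "x j \<notin> ccw_arc 0 r (x (i - 1)) (x i)" if i: "i \<in> {1..<n}" and j: "j < n" "j \<noteq> i" for i j
  proof
    assume "x j \<in> ccw_arc 0 r (x (i - 1)) (x i)"
    then obtain s v u where *: "x j = hpolar 0 r v" "x (i - 1) = hpolar 0 r s" "x i = hpolar 0 r u"
      "s < v" "v \<le> u" "u \<le> s + 2 * pi" unfolding ccw_arc_def by blast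
    obtain k :: int where k: "s = t (i - 1) + 2 * pi * k" using *(2) hpolar_eq_iff[OF c r(1)] unfolding x_def by metis
    obtain l :: int where l: "u = t i + 2 * pi * l" using *(3) hpolar_eq_iff[OF c r(1)] unfolding x_def by metis
    obtain m :: int where m: "v = t j + 2 * pi * m" using *(1) hpolar_eq_iff[OF c r(1)] unfolding x_def by metis
    have bd: "0 \<le> t (i - 1)" "t (i - 1) < t i" "t i < 2 * pi" "0 \<le> t j" "t j < 2 * pi"
      using ge[of "i - 1"] mono[of "i - 1" i] lt[of i] ge[of j] lt[of j] i j by auto
    have aux: "p = q" if "- (2 * pi) < 2 * pi * (real_of_int p - q)" "2 * pi * (real_of_int p - q) < 2 * pi" for p q :: int
    proof -
      have "2 * pi * (-1) < 2 * pi * (real_of_int p - q)" "2 * pi * (real_of_int p - q) < 2 * pi * 1" using that by auto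
      moreover have "0 < 2 * pi" by simp
      ultimately have "-1 < real_of_int p - q" "real_of_int p - q < 1"
        using mult_less_cancel_left_pos by blast+
      then show ?thesis by linarith
    qed
    \<comment> \<open>The three parameters lie within one turn of each other, and so do the angles
      \<open>t\<close>, so all of them are shifted by the same multiple of
      \<open>2 * pi\<close>.\<close>
    have "l = k" using *(4-6) bd unfolding k l by (intro aux) (auto simp: algebra_simps)
    have "m = k" using *(4-6) bd unfolding k l m \<open>l = k\<close> by (intro aux) (auto simp: algebra_simps)
    have "t (i - 1) < t j" "t j \<le> t i" using *(4,5) unfolding k l m \<open>l = k\<close> \<open>m = k\<close> by auto
    moreover have "t j \<le> t (i - 1)" if "j < i"
    proof (cases "j < i - 1")
      case True
      have "i - 1 < n" using i by auto
      from mono[OF True this] show ?thesis by simp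
    next
      case False
      then have "j = i - 1" using that by linarith
      then show ?thesis by simp
    qed
    moreover have "i < j \<Longrightarrow> t i < t j" using mono[of i j] j by auto
    ultimately show False using j(2) by (cases "j < i") auto
  qed
  moreover have "x i \<in> hcircle 0 r" for i using mem_hcircle_iff[OF c r(1)] x_def by auto
  ultimately have "cyclic_ngon n d x"
    unfolding cyclic_ngon_def using r(1) by (intro conjI bexI[of _ 0] exI[of _ r]) auto
  then show ?thesis by (rule that)
qed

section \<open>The extended area function\<close>

text \<open>On \<open>HC\<close> the largest \<open>sinh (d / 2)\<close> is the sum of the others,
  so the area is twice such a defect. Along the segment from \<open>a\<close> to \<open>b\<close>
  each increment is weighted by \<open>1 / (1 + x\<^sup>2) - 1 / (1 + X\<^sup>2)\<close>, which is
  positive because every entry \<open>x\<close> is below the total \<open>X\<close>.\<close>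

lemma arctan_defect_strict_mono:
  fixes a b :: "'i \<Rightarrow> real"
  assumes I: "finite I" "card I \<ge> 2" and a: "\<forall>i\<in>I. 0 < a i" and le: "\<forall>i\<in>I. a i \<le> b i"
    and less: "\<exists>i\<in>I. a i < b i"
  shows "(\<Sum>i\<in>I. arctan (a i)) - arctan (sum a I) < (\<Sum>i\<in>I. arctan (b i)) - arctan (sum b I)"
proof -
  define x where "x t i = a i + t * (b i - a i)" for t i
  define \<Phi> where "\<Phi> t = (\<Sum>i\<in>I. arctan (x t i)) - arctan (\<Sum>i\<in>I. x t i)" for t
  have "\<Phi> 0 < \<Phi> 1"
  proof (rule DERIV_pos_imp_increasing[where f = \<Phi>])
    fix t :: real assume t: "0 \<le> t" "t \<le> 1"
    define X where "X = (\<Sum>i\<in>I. x t i)"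
    have xpos: "0 < x t i" if "i \<in> I" for i
      using a le t that by (simp add: x_def add_pos_nonneg)
    have xX: "x t i < X" if "i \<in> I" for i
    proof -
      have "I - {i} \<noteq> {}" using I(2) card_mono[of "{i}" I] by auto
      then have "0 < (\<Sum>j\<in>I - {i}. x t j)" using I(1) xpos by (intro sum_pos) auto
      then show ?thesis using I(1) that by (simp add: X_def sum.remove)
    qed
    let ?D = "(\<Sum>i\<in>I. (b i - a i) * inverse (1 + (x t i)\<^sup>2)) - (\<Sum>i\<in>I. b i - a i) * inverse (1 + X\<^sup>2)"
    have "(\<Phi> has_real_derivative ?D) (at t)"
      unfolding \<Phi>_def[abs_def] X_def x_def
      by (auto intro!: derivative_eq_intros simp: mult.commute)
    moreover have "0 < ?D"
    proof -
      have cmp: "inverse (1 + X\<^sup>2) < inverse (1 + (x t i)\<^sup>2)" if "i \<in> I" for i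
        using xpos[OF that] xX[OF that] power_strict_mono[of "x t i" X 2]
        by (intro less_imp_inverse_less add_pos_nonneg) auto
      have "(\<Sum>i\<in>I. (b i - a i) * inverse (1 + X\<^sup>2)) < (\<Sum>i\<in>I. (b i - a i) * inverse (1 + (x t i)\<^sup>2))"
      proof (rule sum_strict_mono_ex1[OF I(1)])
        show "\<forall>i\<in>I. (b i - a i) * inverse (1 + X\<^sup>2) \<le> (b i - a i) * inverse (1 + (x t i)\<^sup>2)"
          using cmp le by (intro ballI mult_left_mono) (auto intro: less_imp_le)
        obtain i where "i \<in> I" "a i < b i" using less by blast
        then show "\<exists>i\<in>I. (b i - a i) * inverse (1 + X\<^sup>2) < (b i - a i) * inverse (1 + (x t i)\<^sup>2)"
          using cmp by (intro bexI[of _ i] mult_strict_left_mono) auto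
      qed
      then show ?thesis by (simp add: sum_distrib_right)
    qed
    ultimately show "\<exists>y. (\<Phi> has_real_derivative y) (at t) \<and> 0 < y" by blast
  qed simp
  then show ?thesis by (simp add: \<Phi>_def x_def)
qed

section \<open>Functions of a single side, including infinite ones\<close>

text \<open>The case distinction is essential: \<open>real_of_ereal \<infinity>\<close> is 0, so the
  plain formula would give 1 at infinity.\<close>

definition half_sech :: "ereal \<Rightarrow> real" where
  "half_sech e = (if e = \<infinity> then 0 else 1 / cosh (real_of_ereal e / 2))"

text \<open>The Gudermannian of half the side, that is, the complement of its angle of parallelism
  \<open>horo_angle\<close>. It is the summand of the area at angle 0.\<close>

definition tangent_angle :: "ereal \<Rightarrow> real" where
  "tangent_angle e = arccos (half_sech e)"

lemma half_sech_eq: "e \<noteq> \<infinity> \<Longrightarrow> half_sech e = 1 / sqrt (1 + (half_sinh e)\<^sup>2)"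
proof -
  assume "e \<noteq> \<infinity>"
  moreover have "sqrt (1 + (sinh (real_of_ereal e / 2))\<^sup>2) = cosh (real_of_ereal e / 2)"
  proof -
    have "1 + (sinh (real_of_ereal e / 2))\<^sup>2 = (cosh (real_of_ereal e / 2))\<^sup>2"
      by (simp add: cosh_square_eq)
    then show ?thesis by (simp only: real_sqrt_abs abs_of_pos cosh_real_pos)
  qed
  ultimately show ?thesis by (simp add: half_sech_def half_sinh_def)
qed

lemma half_sech_bounds: "0 \<le> half_sech e" "half_sech e \<le> 1"
  using cosh_real_ge_1[of "real_of_ereal e / 2"] by (auto simp: half_sech_def divide_le_eq)

lemma half_sinh_pos: "0 < e \<Longrightarrow> e < \<infinity> \<Longrightarrow> 0 < half_sinh e"
  by (cases e) (auto simp: half_sinh_def)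

lemma half_sinh_less: "0 < e \<Longrightarrow> e < e' \<Longrightarrow> e' < \<infinity> \<Longrightarrow> half_sinh e < half_sinh e'"
  by (cases e; cases e') (auto simp: half_sinh_def)

lemma half_sinh_le: "0 < e \<Longrightarrow> e \<le> e' \<Longrightarrow> e' < \<infinity> \<Longrightarrow> half_sinh e \<le> half_sinh e'"
  using half_sinh_less[of e e'] by (auto simp: le_less)

lemma tangent_angle_eq: "0 < e \<Longrightarrow> e < \<infinity> \<Longrightarrow> tangent_angle e = arctan (half_sinh e)"
  using arccos_inverse_sqrt[of "half_sinh e"] half_sinh_pos[of e] by (simp add: tangent_angle_def half_sech_eq)

lemma tangent_angle_infinity: "tangent_angle \<infinity> = pi / 2"
  by (simp add: tangent_angle_def half_sech_def)

lemma tangent_angle_horo: "e \<noteq> \<infinity> \<Longrightarrow> tangent_angle e = pi / 2 - horo_angle e"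
proof -
  assume "e \<noteq> \<infinity>"
  then have "1 / cosh (real_of_ereal e / 2) = half_sech e" by (simp add: half_sech_def)
  then show ?thesis
    unfolding tangent_angle_def horo_angle_def using half_sech_bounds[of e] arcsin_arccos_eq[of "half_sech e"] by simp
qed

lemma tangent_angle_less:
  assumes "0 < e" "e < e'"
  shows "tangent_angle e < tangent_angle e'"
proof (cases "e' = \<infinity>")
  case True
  then show ?thesis using assms arctan_ubound by (simp add: tangent_angle_infinity tangent_angle_eq)
next
  case False
  then have "e' < \<infinity>" by auto
  moreover then have "e < \<infinity>" using assms by auto
  ultimately show ?thesis
    using assms half_sinh_less[of e e'] by (auto simp: tangent_angle_eq intro: arctan_monotone)
qed

lemma tangent_angle_le: "0 < e \<Longrightarrow> e \<le> e' \<Longrightarrow> tangent_angle e \<le> tangent_angle e'"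
  using tangent_angle_less[of e e'] by (auto simp: le_less)

lemma tangent_angle_pos: "0 < e \<Longrightarrow> 0 < tangent_angle e"
  by (cases "e = \<infinity>") (auto simp: tangent_angle_infinity tangent_angle_eq half_sinh_pos less_top)

lemma tendsto_half_sinh:
  assumes "(f \<longlongrightarrow> e) F" "\<bar>e\<bar> \<noteq> \<infinity>"
  shows "((\<lambda>x. half_sinh (f x)) \<longlongrightarrow> half_sinh e) F"
proof -
  obtain r where r: "e = ereal r" using assms(2) by (cases e) auto
  have "((\<lambda>x. real_of_ereal (f x)) \<longlongrightarrow> r) F" using assms(1) unfolding r by (rule lim_real_of_ereal)
  then show ?thesis unfolding half_sinh_def r by (auto intro!: tendsto_intros)
qed

text \<open>Bounds the sine of the angle of a short side in the presence of a long one, and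
  dominates \<open>half_sech\<close>; both limits at infinity are read off from it.\<close>

definition half_csch :: "ereal \<Rightarrow> real" where
  "half_csch e = (if e = \<infinity> then 0 else 1 / half_sinh e)"

lemma half_csch_nonneg: "0 < e \<Longrightarrow> 0 \<le> half_csch e"
  using half_sinh_pos[of e] by (auto simp: half_csch_def intro: less_imp_le)

lemma half_sech_le_half_csch:
  assumes "0 < e"
  shows "half_sech e \<le> half_csch e"
proof (cases "e = \<infinity>")
  case False
  then have "0 < half_sinh e" using assms by (intro half_sinh_pos) auto
  then show ?thesis using False sinh_le_cosh_real[of "real_of_ereal e / 2"]
    by (simp add: half_sech_def half_csch_def half_sinh_def frac_le)
qed (simp add: half_sech_def half_csch_def)

lemma tendsto_half_csch_infinity:
  assumes "(f \<longlongrightarrow> \<infinity>) F" "eventually (\<lambda>x. 0 < f x) F"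
  shows "((\<lambda>x. half_csch (f x)) \<longlongrightarrow> 0) F"
proof (rule order_tendstoI)
  fix y :: real assume "y < 0"
  show "eventually (\<lambda>x. y < half_csch (f x)) F"
    using assms(2) by eventually_elim (use half_csch_nonneg \<open>y < 0\<close> in fastforce)
next
  fix y :: real assume y: "0 < y"
  define R where "R = 2 * arsinh (1 / y)"
  have R: "0 < R" using y by (simp add: R_def)
  have "eventually (\<lambda>x. ereal R < f x) F" using assms(1) by (simp add: tendsto_PInfty)
  then show "eventually (\<lambda>x. half_csch (f x) < y) F"
  proof eventually_elim
    case (elim x)
    show ?case
    proof (cases "f x = \<infinity>")
      case False
      then have "half_sinh (ereal R) < half_sinh (f x)" using elim R by (intro half_sinh_less) auto
      then have "1 / y < half_sinh (f x)" by (simp add: half_sinh_def R_def)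
      moreover have "0 < half_sinh (f x)" using False elim R less_trans[of 0 "ereal R" "f x"] by (intro half_sinh_pos) auto
      ultimately show ?thesis using False y by (simp add: half_csch_def field_simps)
    qed (use y in \<open>simp add: half_csch_def\<close>)
  qed
qed

lemma tendsto_half_sech:
  assumes "(f \<longlongrightarrow> e) F" "eventually (\<lambda>x. 0 < f x) F" "0 < e"
  shows "((\<lambda>x. half_sech (f x)) \<longlongrightarrow> half_sech e) F"
proof (cases "e = \<infinity>")
  case True
  have "((\<lambda>x. half_sech (f x)) \<longlongrightarrow> 0) F"
  proof (rule tendsto_sandwich[OF _ _ tendsto_const])
    show "((\<lambda>x. half_csch (f x)) \<longlongrightarrow> 0) F" using assms True by (intro tendsto_half_csch_infinity) auto
    show "eventually (\<lambda>x. half_sech (f x) \<le> half_csch (f x)) F"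
      using assms(2) by eventually_elim (rule half_sech_le_half_csch)
  qed (simp add: half_sech_bounds)
  then show ?thesis using True by (simp add: half_sech_def)
next
  case False
  then have "\<bar>e\<bar> \<noteq> \<infinity>" using assms(3) by auto
  then have "((\<lambda>x. 1 / sqrt (1 + (half_sinh (f x))\<^sup>2)) \<longlongrightarrow> 1 / sqrt (1 + (half_sinh e)\<^sup>2)) F"
    using tendsto_half_sinh[OF assms(1)] by (intro tendsto_intros) (auto simp: add_pos_nonneg less_imp_neq[THEN not_sym])
  moreover have "eventually (\<lambda>x. f x < \<infinity>) F"
    using order_tendstoD(2)[OF assms(1), of \<infinity>] False by auto
  then have "eventually (\<lambda>x. 1 / sqrt (1 + (half_sinh (f x))\<^sup>2) = half_sech (f x)) F"
    by eventually_elim (auto simp: half_sech_eq)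
  ultimately show ?thesis using False half_sech_eq[of e] by (simp add: tendsto_cong)
qed

section \<open>The extended area and its values on the three strata\<close>

abbreviation (input) boundary_union :: "nat \<Rightarrow> (nat \<Rightarrow> ereal) set" where
  "boundary_union n \<equiv> AC n \<union> HC n \<union> HI n"

text \<open>On \<open>HI\<close> the equations would be misleading, as
  \<open>half_sinh \<infinity>\<close> is 0. The value 0 is the true limit at the finite sides and
  immaterial at the infinite ones, where \<open>half_sech\<close> vanishes.\<close>

definition ngon_angles :: "nat \<Rightarrow> (nat \<Rightarrow> ereal) \<Rightarrow> nat \<Rightarrow> real" where
  "ngon_angles n d = (if d \<in> HI n then (\<lambda>_. 0) else SOME \<alpha>. closing_angles {..<n} (\<lambda>i. half_sinh (d i)) \<alpha>)"

definition ngon_area :: "nat \<Rightarrow> (nat \<Rightarrow> ereal) \<Rightarrow> real" where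
  "ngon_area n d = 2 * ((\<Sum>i<n. arccos (cos (ngon_angles n d i) * half_sech (d i))) - pi)"

lemma AC_HC_bounds:
  assumes "d \<in> AC n \<union> HC n" "i < n"
  shows "0 < d i" "d i < \<infinity>" "0 < half_sinh (d i)"
proof -
  show "0 < d i" "d i < \<infinity>" using assms by (auto simp: AC_def HC_def PiE_iff)
  then show "0 < half_sinh (d i)" by (rule half_sinh_pos)
qed

lemma boundary_union_pos: "d \<in> boundary_union n \<Longrightarrow> i < n \<Longrightarrow> 0 < d i"
  by (auto simp: AC_def HC_def HI_def PiE_iff)

lemma finite_imp_AC_HC:
  assumes "d \<in> boundary_union n" "\<And>i. i < n \<Longrightarrow> d i < \<infinity>"
  shows "d \<in> AC n \<union> HC n"
  using assms by (fastforce simp: HI_def)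

lemma AC_HC_not_HI: "d \<in> AC n \<union> HC n \<Longrightarrow> d \<notin> HI n"
  using AC_HC_bounds(2)[of d n] by (fastforce simp: HI_def)

lemma HI_infinities:
  assumes "n \<ge> 3" "d \<in> HI n"
  obtains p q where "p < n" "q < n" "p \<noteq> q" "d p = \<infinity>" "d q = \<infinity>"
    "q = (p + 1) mod n" "\<forall>i<n. i \<noteq> p \<longrightarrow> i \<noteq> q \<longrightarrow> d i < \<infinity>"
proof -
  obtain p where p: "p < n" "d p = \<infinity>" "d ((p + 1) mod n) = \<infinity>"
    "\<forall>i\<in>{..<n} - {p, (p + 1) mod n}. d i < \<infinity>"
    using assms(2) by (auto simp: HI_def)
  have "(p + 1) mod n \<noteq> p"
    using assms(1) p(1) by (cases "p + 1 = n") auto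
  then show ?thesis using p assms(1) by (intro that[of p "(p + 1) mod n"]) auto
qed

lemma circular_angles_of_AC:
  assumes "n \<ge> 3" "d \<in> AC n"
  obtains \<kappa> \<alpha> where "circular_angles {..<n} (\<lambda>i. half_sinh (d i)) \<kappa> \<alpha>"
  using circular_angles_exist[of "{..<n}" "\<lambda>i. half_sinh (d i)"] AC_HC_bounds(3)[of d n] assms
  by (auto simp: AC_def)

text \<open>The maximum is attained once: its \<open>half_sinh\<close> exceeds that of any other
  side by the at least one remaining positive term.\<close>

lemma HC_maximum:
  assumes n: "n \<ge> 3" and d: "d \<in> HC n"
  obtains m where "m < n" "d m = Max (d ` {..<n})"
    "half_sinh (d m) = (\<Sum>i\<in>{..<n} - {m}. half_sinh (d i))"
    "\<forall>i<n. i \<noteq> m \<longrightarrow> d i < d m"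
proof -
  obtain m where m: "m < n" "d m = Max (d ` {..<n})"
    "half_sinh (d m) = (\<Sum>i\<in>{..<n} - {m}. half_sinh (d i))"
    using d unfolding HC_def by blast
  have pos: "0 < half_sinh (d i)" if "i < n" for i using AC_HC_bounds(3)[of d n i] d that by auto
  have "d i < d m" if i: "i < n" "i \<noteq> m" for i
  proof -
    have ne: "{..<n} - {m} - {i} \<noteq> {}" using n card_mono[of "{m, i}" "{..<n}"] i by (auto simp: card_insert_if)
    have "0 < (\<Sum>j\<in>{..<n} - {m} - {i}. half_sinh (d j))"
      using ne pos by (intro sum_pos) auto
    then have "half_sinh (d i) < half_sinh (d i) + (\<Sum>j\<in>{..<n} - {m} - {i}. half_sinh (d j))"
      by simp
    also have "\<dots> = half_sinh (d m)" unfolding m(3) using i m(1) by (subst (2) sum.remove[of _ i]) auto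
    finally have "half_sinh (d i) < half_sinh (d m)" .
    moreover have "d i \<le> d m" unfolding m(2) using i by (intro Max_ge) auto
    ultimately show ?thesis by (cases "d i = d m") auto
  qed
  then show ?thesis using m that by blast
qed

lemma closing_angles_of_HC:
  assumes n: "n \<ge> 3" and d: "d \<in> HC n" and m: "m < n" "d m = Max (d ` {..<n})"
  shows "closing_angles {..<n} (\<lambda>i. half_sinh (d i)) (\<lambda>i. if i = m then pi else 0)"
    "half_sinh (d m) = (\<Sum>i\<in>{..<n} - {m}. half_sinh (d i))"
proof -
  obtain m' where m': "m' < n" "d m' = Max (d ` {..<n})"
    "half_sinh (d m') = (\<Sum>i\<in>{..<n} - {m'}. half_sinh (d i))" "\<forall>i<n. i \<noteq> m' \<longrightarrow> d i < d m'"
    by (rule HC_maximum[OF n d])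
  have "m' = m" using m'(4)[rule_format, OF m(1)] m(2) m'(2) by (cases "m' = m") auto
  then show eq: "half_sinh (d m) = (\<Sum>i\<in>{..<n} - {m}. half_sinh (d i))" using m'(3) by simp
  show "closing_angles {..<n} (\<lambda>i. half_sinh (d i)) (\<lambda>i. if i = m then pi else 0)"
    using AC_HC_bounds(3)[of d n] d m eq by (intro degenerate_closing_angles) auto
qed

lemma ngon_angles_closing:
  assumes n: "n \<ge> 3" and d: "d \<in> AC n \<union> HC n"
  shows "closing_angles {..<n} (\<lambda>i. half_sinh (d i)) (ngon_angles n d)"
proof -
  have "\<exists>\<alpha>. closing_angles {..<n} (\<lambda>i. half_sinh (d i)) \<alpha>"
  proof (cases "d \<in> AC n")
    case True
    obtain \<kappa> \<alpha> where "circular_angles {..<n} (\<lambda>i. half_sinh (d i)) \<kappa> \<alpha>"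
      by (rule circular_angles_of_AC[OF n True])
    from circular_angles_imp_closing_angles[OF finite_lessThan this] show ?thesis by blast
  next
    case False
    then have "d \<in> HC n" using d by simp
    then show ?thesis using closing_angles_of_HC(1)[OF n \<open>d \<in> HC n\<close>] HC_maximum[OF n \<open>d \<in> HC n\<close>] by metis
  qed
  then show ?thesis using AC_HC_not_HI[OF d] by (simp add: ngon_angles_def someI_ex)
qed

lemma ngon_angles_unique:
  assumes n: "n \<ge> 3" and d: "d \<in> AC n \<union> HC n"
    and "closing_angles {..<n} (\<lambda>i. half_sinh (d i)) \<alpha>" "i < n"
  shows "ngon_angles n d i = \<alpha> i"
  using n assms(3,4) AC_HC_bounds(3)[OF d] ngon_angles_closing[OF n d]
  by (intro closing_angles_unique[of "{..<n}" "\<lambda>i. half_sinh (d i)"]) auto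

lemma ngon_area_AC:
  assumes n: "n \<ge> 3" and d: "d \<in> AC n" and \<alpha>: "circular_angles {..<n} (\<lambda>i. half_sinh (d i)) \<kappa> \<alpha>"
  shows "ngon_area n d = 2 * ((\<Sum>i<n. arccos (cos (\<alpha> i) / sqrt (1 + (half_sinh (d i))\<^sup>2))) - pi)"
proof -
  have d': "d \<in> AC n \<union> HC n" using d by simp
  have "closing_angles {..<n} (\<lambda>i. half_sinh (d i)) \<alpha>"
    using \<alpha> by (intro circular_angles_imp_closing_angles) auto
  then have "ngon_angles n d i = \<alpha> i" if "i < n" for i using ngon_angles_unique[OF n d'] that by blast
  then show ?thesis
    unfolding ngon_area_def using AC_HC_bounds(2)[OF d'] by (simp add: half_sech_eq)
qed

text \<open>The definite description is justified by the angles: they exist, which yields a polygon,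
  and they are unique, which gives all such polygons the same area.\<close>

lemma ngon_area_eq_cyclic_area:
  assumes n: "n \<ge> 3" and d: "d \<in> AC n"
  shows "ngon_area n d = cyclic_area n d"
proof -
  have fin: "\<bar>d i\<bar> \<noteq> \<infinity>" if "i < n" for i
    using AC_HC_bounds(1,2)[of d n i] d that by (cases "d i") auto
  obtain \<kappa> \<alpha> where \<alpha>: "circular_angles {..<n} (\<lambda>i. half_sinh (d i)) \<kappa> \<alpha>"
    by (rule circular_angles_of_AC[OF n d])
  have n2: "n \<ge> 2" using n by simp
  obtain x where x: "cyclic_ngon n d x" by (rule cyclic_ngon_exists[OF n2 fin \<alpha>])
  have area: "measure hyp_area (hconvex hull (y ` {..<n})) = ngon_area n d" if "cyclic_ngon n d y" for y
  proof (rule cyclic_ngon_area[OF n2 that])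
    fix \<kappa> \<alpha>
    assume "circular_angles {..<n} (\<lambda>i. half_sinh (d i)) \<kappa> \<alpha>"
      "measure hyp_area (hconvex hull (y ` {..<n})) =
        2 * ((\<Sum>i<n. arccos (cos (\<alpha> i) / sqrt (1 + (half_sinh (d i))\<^sup>2))) - pi)"
    then show ?thesis using ngon_area_AC[OF n d, of \<kappa> \<alpha>] by simp
  qed
  show ?thesis unfolding cyclic_area_def
    by (rule the_equality[symmetric]) (use x area in auto)
qed

text \<open>The longest side has angle \<pi> and contributes
  \<open>arccos (- half_sech (d m)) = pi - tangent_angle (d m)\<close>; this \<pi> cancels the one
  that is subtracted.\<close>

lemma ngon_area_HC:
  assumes n: "n \<ge> 3" and d: "d \<in> HC n" and m: "m < n" "d m = Max (d ` {..<n})"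
  shows "ngon_area n d = 2 * ((\<Sum>i\<in>{..<n} - {m}. tangent_angle (d i)) - tangent_angle (d m))"
proof -
  have d': "d \<in> AC n \<union> HC n" using d by simp
  have ang: "ngon_angles n d i = (if i = m then pi else 0)" if "i < n" for i
    by (rule ngon_angles_unique[OF n d' closing_angles_of_HC(1)[OF n d m] that])
  have "(\<Sum>i<n. arccos (cos (ngon_angles n d i) * half_sech (d i))) =
      arccos (- half_sech (d m)) + (\<Sum>i\<in>{..<n} - {m}. tangent_angle (d i))"
    using m(1) ang by (subst sum.remove[of _ m]) (auto simp: tangent_angle_def intro!: sum.cong)
  also have "arccos (- half_sech (d m)) = pi - tangent_angle (d m)"
    unfolding tangent_angle_def using half_sech_bounds[of "d m"] by (intro arccos_minus) auto
  finally show ?thesis by (simp add: ngon_area_def)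
qed

lemma ngon_area_HI:
  assumes d: "d \<in> HI n"
  shows "ngon_area n d = 2 * ((\<Sum>i<n. tangent_angle (d i)) - pi)"
  using d by (simp add: ngon_area_def ngon_angles_def tangent_angle_def)

lemma sum_remove2:
  fixes f :: "nat \<Rightarrow> real"
  assumes "p < n" "q < n" "p \<noteq> q"
  shows "(\<Sum>i<n. f i) = f p + f q + (\<Sum>i\<in>{..<n} - {p, q}. f i)"
proof -
  have "(\<Sum>i<n. f i) = f p + (\<Sum>i\<in>{..<n} - {p}. f i)" using assms by (intro sum.remove) auto
  also have "(\<Sum>i\<in>{..<n} - {p}. f i) = f q + (\<Sum>i\<in>{..<n} - {p} - {q}. f i)" using assms by (intro sum.remove) auto
  also have "{..<n} - {p} - {q} = {..<n} - {p, q}" by auto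
  finally show ?thesis by simp
qed

lemma ngon_area_HI_remove:
  assumes d: "d \<in> HI n" and "p < n" "q < n" "p \<noteq> q" "d p = \<infinity>" "d q = \<infinity>"
  shows "ngon_area n d = 2 * (\<Sum>i\<in>{..<n} - {p, q}. tangent_angle (d i))"
  unfolding ngon_area_HI[OF d] using sum_remove2[OF assms(2-4), of "\<lambda>i. tangent_angle (d i)"] assms
  by (simp add: tangent_angle_infinity)

lemma ngon_area_HC_horo:
  assumes n: "n \<ge> 3" and d: "d \<in> HC n" and m: "m < n" "d m = Max (d ` {..<n})"
  shows "ngon_area n d = (real n - 2) * pi + 2 * (horo_angle (d m) - (\<Sum>i\<in>{..<n} - {m}. horo_angle (d i)))"
proof -
  have fin: "d i \<noteq> \<infinity>" if "i < n" for i using AC_HC_bounds(2)[of d n i] d that by auto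
  have "(\<Sum>i\<in>{..<n} - {m}. tangent_angle (d i)) = (\<Sum>i\<in>{..<n} - {m}. pi / 2 - horo_angle (d i))"
    using fin by (intro sum.cong) (auto simp: tangent_angle_horo)
  also have "\<dots> = (real n - 1) * (pi / 2) - (\<Sum>i\<in>{..<n} - {m}. horo_angle (d i))"
    using m n by (simp add: sum_subtractf of_nat_diff)
  finally show ?thesis
    unfolding ngon_area_HC[OF n d m] tangent_angle_horo[OF fin[OF m(1)]] by (simp add: field_simps)
qed

lemma ngon_area_HI_horo:
  assumes n: "n \<ge> 3" and d: "d \<in> HI n" and p: "p < n" "d p = \<infinity>" "d ((p + 1) mod n) = \<infinity>"
  shows "ngon_area n d = (real n - 2) * pi - 2 * (\<Sum>i\<in>{..<n} - {p, (p + 1) mod n}. horo_angle (d i))"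
proof -
  let ?q = "(p + 1) mod n"
  have pq: "?q < n" "p \<noteq> ?q" using n p(1) by (auto) (cases "p + 1 = n"; auto)
  \<comment> \<open>The given \<open>p\<close> need not be the index that witnesses
    \<open>d \<in> HI n\<close>. There are exactly two infinite entries, so the index pairs agree as
    sets and all remaining entries are finite.\<close>
  obtain p' q' where *: "p' < n" "q' < n" "p' \<noteq> q'" "d p' = \<infinity>" "d q' = \<infinity>"
    "q' = (p' + 1) mod n" "\<forall>i<n. i \<noteq> p' \<longrightarrow> i \<noteq> q' \<longrightarrow> d i < \<infinity>"
    by (rule HI_infinities[OF n d])
  have "p \<in> {p', q'}" "?q \<in> {p', q'}"
    using *(7)[rule_format, OF p(1)] *(7)[rule_format, OF pq(1)] p by auto
  then have "{p, ?q} = {p', q'}" using pq(2) by auto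
  then have fin: "d i \<noteq> \<infinity>" if "i \<in> {..<n} - {p, ?q}" for i using *(7) that by auto
  have "(\<Sum>i\<in>{..<n} - {p, ?q}. tangent_angle (d i)) = (\<Sum>i\<in>{..<n} - {p, ?q}. pi / 2 - horo_angle (d i))"
    using fin by (intro sum.cong) (auto simp: tangent_angle_horo)
  also have "\<dots> = (real n - 2) * (pi / 2) - (\<Sum>i\<in>{..<n} - {p, ?q}. horo_angle (d i))"
    using n p(1) pq by (simp add: sum_subtractf of_nat_diff card_Diff_subset)
  finally show ?thesis
    unfolding ngon_area_HI_remove[OF d p(1) pq p(2,3)] by (simp add: field_simps)
qed

text \<open>Each stratum has its own reason: the angle excess on \<open>AC\<close>, strict
  subadditivity of \<open>arctan\<close> on \<open>HC\<close>, and a nonempty sum of positive terms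
  on \<open>HI\<close>.\<close>

lemma ngon_area_pos:
  assumes n: "n \<ge> 3" and d: "d \<in> boundary_union n"
  shows "0 < ngon_area n d"
proof -
  consider "d \<in> AC n" | "d \<in> HC n" | "d \<in> HI n" using d by blast
  then show ?thesis
  proof cases
    case 1
    obtain \<kappa> \<alpha> where \<alpha>: "circular_angles {..<n} (\<lambda>i. half_sinh (d i)) \<kappa> \<alpha>"
      by (rule circular_angles_of_AC[OF n 1])
    show ?thesis
      unfolding ngon_area_AC[OF n 1 \<alpha>] using circular_angles_area_pos[OF _ _ \<alpha>] n by simp
  next
    case 2
    obtain m where m: "m < n" "d m = Max (d ` {..<n})"
      "half_sinh (d m) = (\<Sum>i\<in>{..<n} - {m}. half_sinh (d i))" using HC_maximum[OF n 2] by metis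
    have b: "0 < d i" "d i < \<infinity>" "0 < half_sinh (d i)" if "i < n" for i using AC_HC_bounds[of d n i] 2 that by auto
    have "arctan (\<Sum>i\<in>{..<n} - {m}. half_sinh (d i)) < (\<Sum>i\<in>{..<n} - {m}. arctan (half_sinh (d i)))"
      using n m b by (intro arctan_sum_less) auto
    also have "\<dots> = (\<Sum>i\<in>{..<n} - {m}. tangent_angle (d i))"
      using b by (intro sum.cong) (auto simp: tangent_angle_eq)
    finally show ?thesis
      unfolding ngon_area_HC[OF n 2 m(1,2)] using b[OF m(1)] by (simp add: m(3)[symmetric] tangent_angle_eq)
  next
    case 3
    obtain p q where *: "p < n" "q < n" "p \<noteq> q" "d p = \<infinity>" "d q = \<infinity>" by (rule HI_infinities[OF n 3])
    have ne: "{..<n} - {p, q} \<noteq> {}" using n card_mono[of "{p, q}" "{..<n}"] *(3) by auto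
    have "0 < (\<Sum>i\<in>{..<n} - {p, q}. tangent_angle (d i))"
      using ne boundary_union_pos[OF d] by (intro sum_pos tangent_angle_pos) auto
    then show ?thesis unfolding ngon_area_HI_remove[OF 3 *] by simp
  qed
qed

section \<open>Symmetry\<close>

lemma sum_permutes_remove:
  fixes f :: "nat \<Rightarrow> real"
  assumes "q permutes {..<n}" "m < n"
  shows "(\<Sum>i\<in>{..<n} - {m}. f (q i)) = (\<Sum>i\<in>{..<n} - {q m}. f i)"
proof -
  have "(\<Sum>i<n. f (q i)) = (\<Sum>i<n. f i)" using sum.permute[OF assms(1), of f] by (simp add: o_def)
  moreover have "q m < n" using permutes_in_image[OF assms(1), of m] assms(2) by simp
  ultimately show ?thesis
    using sum.remove[of "{..<n}" m "\<lambda>i. f (q i)"] sum.remove[of "{..<n}" "q m" f] assms(2) by simp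
qed

lemma closing_angles_permute:
  fixes n :: nat
  assumes p: "p permutes {..<n}" and \<alpha>: "closing_angles {..<n} a \<alpha>"
  shows "closing_angles {..<n} (\<lambda>i. a (p i)) (\<lambda>i. \<alpha> (p i))"
proof -
  have pn: "p i < n" if "i < n" for i using permutes_in_image[OF p, of i] that by simp
  have "(\<Sum>i<n. \<alpha> (p i)) = (\<Sum>i<n. \<alpha> i)" using sum.permute[OF p, of \<alpha>] by (simp add: o_def)
  then show ?thesis
    using \<alpha> pn by (simp add: closing_angles_def sum_permutes_remove[OF p])
qed

text \<open>\<open>HI\<close> is not invariant under permutations, since its infinite entries are
  adjacent; but a point of the union with an infinite entry can only be in \<open>HI\<close>. For
  finite entries the permuted angles solve the permuted equations, and uniqueness applies.\<close>

lemma ngon_area_permute: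
  assumes n: "n \<ge> 3" and d: "d \<in> boundary_union n" "d' \<in> boundary_union n"
    and p: "p permutes {..<n}" "\<forall>i<n. d' i = d (p i)"
  shows "ngon_area n d' = ngon_area n d"
proof -
  have pn: "p i < n" if "i < n" for i using permutes_in_image[OF p(1), of i] that by simp
  have perm: "(\<Sum>i<n. f (p i)) = (\<Sum>i<n. f i)" for f :: "nat \<Rightarrow> real"
    using sum.permute[OF p(1), of f] by (simp add: o_def)
  show ?thesis
  proof (cases "d \<in> HI n")
    case True
    obtain k where k: "k < n" "d k = \<infinity>" using HI_infinities[OF n True] by metis
    obtain i where i: "p i = k" "i < n"
      using p(1) k(1) by (metis lessThan_iff permutes_in_image permutes_surj surjD)
    have "d' \<in> HI n" using d(2) AC_HC_bounds(2)[of d' n i] i k p(2) by auto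
    then show ?thesis
      using True p(2) perm[of "\<lambda>i. tangent_angle (d i)"] by (simp add: ngon_area_HI)
  next
    case False
    then have dd: "d \<in> AC n \<union> HC n" using d by simp
    have dd': "d' \<in> AC n \<union> HC n"
      using d(2) p(2) pn AC_HC_bounds(2)[OF dd] by (intro finite_imp_AC_HC) auto
    have "closing_angles {..<n} (\<lambda>i. half_sinh (d' i)) (\<lambda>i. ngon_angles n d (p i))"
      using closing_angles_permute[OF p(1) ngon_angles_closing[OF n dd]] p(2)
      by (simp add: closing_angles_def)
    then have "ngon_angles n d' i = ngon_angles n d (p i)" if "i < n" for i
      using ngon_angles_unique[OF n dd'] that by simp
    then show ?thesis
      unfolding ngon_area_def using p(2) perm[of "\<lambda>i. arccos (cos (ngon_angles n d i) * half_sech (d i))"] by simp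
  qed
qed

section \<open>Strict monotonicity on \<open>HC\<close> and \<open>HI\<close>\<close>

text \<open>The comparison of defects needs the longest side matched with the longest side, which
  \<open>p\<close> does not promise.\<close>

lemma ngon_area_less_HC_HC:
  assumes n: "n \<ge> 3" and d: "d \<in> HC n" "d' \<in> HC n"
    and p: "p permutes {..<n}" "\<forall>i<n. d i \<le> d' (p i)" "\<exists>i<n. d i < d' (p i)"
  shows "ngon_area n d < ngon_area n d'"
proof -
  obtain m where m: "m < n" "d m = Max (d ` {..<n})"
    "half_sinh (d m) = (\<Sum>i\<in>{..<n} - {m}. half_sinh (d i))" "\<forall>i<n. i \<noteq> m \<longrightarrow> d i < d m"
    by (rule HC_maximum[OF n d(1)])
  obtain m' where m': "m' < n" "d' m' = Max (d' ` {..<n})"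
    "half_sinh (d' m') = (\<Sum>i\<in>{..<n} - {m'}. half_sinh (d' i))" "\<forall>i<n. i \<noteq> m' \<longrightarrow> d' i < d' m'"
    by (rule HC_maximum[OF n d(2)])
  have pn: "p i < n" if "i < n" for i using permutes_in_image[OF p(1), of i] that by simp
  obtain j where j: "p j = m'" "j < n"
    using p(1) m'(1) by (metis lessThan_iff permutes_in_image permutes_surj surjD)
  \<comment> \<open>Exchanging the partners of \<open>m\<close> and \<open>j\<close> matches the two
    longest sides. The comparison survives, because \<open>d m\<close> is below the largest entry of
    \<open>d'\<close> and \<open>d j \<le> d m \<le> d' (p m)\<close>.\<close>
  define q where "q = p \<circ> Transposition.transpose m j"
  have q: "q permutes {..<n}" unfolding q_def
    using m(1) j(2) by (intro permutes_compose[OF _ p(1)] permutes_swap_id) auto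
  have qm: "q m = m'" "q j = p m" "\<And>i. i \<noteq> m \<Longrightarrow> i \<noteq> j \<Longrightarrow> q i = p i" using j by (auto simp: q_def)
  have qle: "d i \<le> d' (q i)" if "i < n" for i
  proof -
    consider "i = m" | "i = j" "j \<noteq> m" | "i \<noteq> m" "i \<noteq> j" by blast
    then show ?thesis
    proof cases
      case 1
      have "d m \<le> d' (p m)" using p(2) m(1) by blast
      also have "\<dots> \<le> d' m'" using m'(4)[rule_format, OF pn[OF m(1)]] by (cases "p m = m'") auto
      finally show ?thesis using 1 qm(1) by simp
    next
      case 2
      have "d j \<le> d m" using m(4)[rule_format, OF j(2)] 2 by simp
      also have "\<dots> \<le> d' (p m)" using p(2) m(1) by blast
      finally show ?thesis using 2 qm(2) by simp
    qed (use p(2) qm(3) that in auto)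
  qed
  have qless: "\<exists>i<n. d i < d' (q i)"
  proof (cases "j = m")
    case True
    then show ?thesis using p(3) by (simp add: q_def)
  next
    case False
    then have "p m \<noteq> m'" using j p(1) by (metis permutes_inj injD)
    then have "d m < d' m'" using m'(4)[rule_format, OF pn[OF m(1)]] p(2) m(1) by (meson le_less_trans)
    then show ?thesis using m(1) qm(1) by metis
  qed
  define a where "a i = half_sinh (d i)" for i
  define b where "b i = half_sinh (d' (q i))" for i
  have qn: "q i < n" if "i < n" for i using permutes_in_image[OF q, of i] that by simp
  have bd: "0 < d i" "d i < \<infinity>" "0 < d' i" "d' i < \<infinity>" if "i < n" for i
    using AC_HC_bounds[of d n i] AC_HC_bounds[of d' n i] d that by auto
  have ab: "0 < a i" "a i \<le> b i" "d i < d' (q i) \<Longrightarrow> a i < b i" if "i < n" for i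
    using bd[OF that] bd[OF qn[OF that]] qle[OF that] unfolding a_def b_def
    by (auto intro: half_sinh_pos half_sinh_le half_sinh_less)
  have sums: "sum a ({..<n} - {m}) = a m" "sum b ({..<n} - {m}) = b m"
    using m(3) m'(3) sum_permutes_remove[OF q m(1), of "\<lambda>i. half_sinh (d' i)"] qm(1) by (auto simp: a_def b_def)
  \<comment> \<open>A strict increase cannot occur at \<open>m\<close> alone, since the entry there
    is the sum of the others.\<close>
  have "\<exists>i\<in>{..<n} - {m}. a i < b i"
  proof (rule ccontr)
    assume no: "\<not> ?thesis"
    have "sum a ({..<n} - {m}) = sum b ({..<n} - {m})"
    proof (rule sum.cong[OF refl])
      fix x assume x: "x \<in> {..<n} - {m}"
      then have "\<not> a x < b x" using no by blast
      then show "a x = b x" using ab(2)[of x] x by auto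
    qed
    moreover have "a m < b m" using qless ab(3) no by (metis Diff_iff lessThan_iff singletonD)
    ultimately show False using sums by simp
  qed
  then have "(\<Sum>i\<in>{..<n} - {m}. arctan (a i)) - arctan (sum a ({..<n} - {m})) <
      (\<Sum>i\<in>{..<n} - {m}. arctan (b i)) - arctan (sum b ({..<n} - {m}))"
    using n m(1) ab by (intro arctan_defect_strict_mono) auto
  moreover have "(\<Sum>i\<in>{..<n} - {m}. arctan (a i)) = (\<Sum>i\<in>{..<n} - {m}. tangent_angle (d i))"
    using bd by (intro sum.cong) (auto simp: tangent_angle_eq a_def)
  moreover have "(\<Sum>i\<in>{..<n} - {m}. arctan (b i)) = (\<Sum>i\<in>{..<n} - {m}. tangent_angle (d' (q i)))"
    using bd qn by (intro sum.cong) (auto simp: tangent_angle_eq b_def)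
  moreover have "\<dots> = (\<Sum>i\<in>{..<n} - {m'}. tangent_angle (d' i))"
    using sum_permutes_remove[OF q m(1), of "\<lambda>i. tangent_angle (d' i)"] qm(1) by simp
  moreover have "arctan (a m) = tangent_angle (d m)" "arctan (b m) = tangent_angle (d' m')"
    using bd m(1) m'(1) qm(1) by (auto simp: tangent_angle_eq a_def b_def)
  ultimately show ?thesis
    unfolding ngon_area_HC[OF n d(1) m(1,2)] ngon_area_HC[OF n d(2) m'(1,2)] sums by simp
qed

lemma ngon_area_strict_mono:
  assumes n: "n \<ge> 3" and d: "d \<in> HC n \<union> HI n" "d' \<in> HC n \<union> HI n"
    and p: "p permutes {..<n}" "\<forall>i<n. d i \<le> d' (p i)" "\<exists>i<n. d i < d' (p i)"
  shows "ngon_area n d < ngon_area n d'"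
proof -
  have pn: "p i < n" if "i < n" for i using permutes_in_image[OF p(1), of i] that by simp
  have perm: "(\<Sum>i<n. f (p i)) = (\<Sum>i<n. f i)" for f :: "nat \<Rightarrow> real"
    using sum.permute[OF p(1), of f] by (simp add: o_def)
  have dpos: "0 < d i" if "i < n" for i using boundary_union_pos[of d n i] d(1) that by auto
  consider "d \<in> HC n" "d' \<in> HC n" | "d \<in> HI n" "d' \<in> HC n" | "d \<in> HC n" "d' \<in> HI n" | "d \<in> HI n" "d' \<in> HI n"
    using d by blast
  then show ?thesis
  proof cases
    case 1
    then show ?thesis using ngon_area_less_HC_HC[OF n _ _ p] by blast
  next
    case 2
    obtain k where k: "k < n" "d k = \<infinity>" using HI_infinities[OF n 2(1)] by metis
    then have "d' (p k) = \<infinity>" using p(2) by auto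
    then show ?thesis using AC_HC_bounds(2)[of d' n "p k"] 2(2) pn[OF k(1)] by auto
  next
    case 3
    obtain m where m: "m < n" "d m = Max (d ` {..<n})"
      "half_sinh (d m) = (\<Sum>i\<in>{..<n} - {m}. half_sinh (d i))" "\<forall>i<n. i \<noteq> m \<longrightarrow> d i < d m"
      by (rule HC_maximum[OF n 3(1)])
    obtain k1 k2 where k: "k1 < n" "k2 < n" "k1 \<noteq> k2" "d' k1 = \<infinity>" "d' k2 = \<infinity>"
      by (rule HI_infinities[OF n 3(2)])
    obtain j1 j2 where j: "p j1 = k1" "j1 < n" "p j2 = k2" "j2 < n"
      using p(1) k(1,2) by (metis lessThan_iff permutes_in_image permutes_surj surjD)
    have "j1 \<noteq> j2" using j k(3) by auto
    define h where "h i = tangent_angle (d i)" for i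
    define h' where "h' i = tangent_angle (d' (p i))" for i
    define J where "J = {..<n} - {j1, j2}"
    \<comment> \<open>The partners of the two infinite sides are distinct, so at most one of them is
      the longest side \<open>m\<close>. Removing both from the sum therefore costs less than the
      \<open>2 * h m\<close> by which the area on \<open>HC\<close> falls short of the full
      sum.\<close>
    have "h j1 \<le> h m" "h j2 \<le> h m" "h j1 < h m \<or> h j2 < h m"
      using m(4)[rule_format, OF j(2)] m(4)[rule_format, OF j(4)] dpos[OF j(2)] dpos[OF j(4)] \<open>j1 \<noteq> j2\<close>
      unfolding h_def by (cases "j1 = m"; cases "j2 = m"; auto intro: tangent_angle_less less_imp_le)+
    then have "h j1 + h j2 < 2 * h m" by linarith
    moreover have "sum h {..<n} = h m + sum h ({..<n} - {m})"
      using m(1) by (intro sum.remove) auto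
    moreover have "sum h {..<n} = h j1 + h j2 + sum h J"
      unfolding J_def by (rule sum_remove2[OF j(2,4) \<open>j1 \<noteq> j2\<close>])
    moreover have "sum h J \<le> sum h' J"
      unfolding J_def h_def h'_def using p(2) dpos by (intro sum_mono tangent_angle_le) auto
    moreover have "sum h' {..<n} = h' j1 + h' j2 + sum h' J"
      unfolding J_def by (rule sum_remove2[OF j(2,4) \<open>j1 \<noteq> j2\<close>])
    moreover have "h' j1 = pi / 2" "h' j2 = pi / 2" using j k by (simp_all add: h'_def tangent_angle_infinity)
    moreover have "ngon_area n d = 2 * (sum h ({..<n} - {m}) - h m)"
      unfolding ngon_area_HC[OF n 3(1) m(1,2)] by (simp add: h_def)
    moreover have "ngon_area n d' = 2 * (sum h' {..<n} - pi)"
      unfolding ngon_area_HI[OF 3(2)] using perm[of "\<lambda>i. tangent_angle (d' i)"] by (simp add: h'_def)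
    ultimately show ?thesis by argo
  next
    case 4
    obtain i where i: "i < n" "d i < d' (p i)" using p(3) by blast
    have "(\<Sum>i<n. tangent_angle (d i)) < (\<Sum>i<n. tangent_angle (d' (p i)))"
    proof (rule sum_strict_mono_ex1)
      show "\<forall>i\<in>{..<n}. tangent_angle (d i) \<le> tangent_angle (d' (p i))"
        using p(2) dpos by (auto intro: tangent_angle_le)
      show "\<exists>i\<in>{..<n}. tangent_angle (d i) < tangent_angle (d' (p i))"
        using i dpos by (intro bexI[of _ i] tangent_angle_less) auto
    qed simp
    then show ?thesis
      unfolding ngon_area_HI[OF 4(1)] ngon_area_HI[OF 4(2)] using perm[of "\<lambda>i. tangent_angle (d' i)"] by simp
  qed
qed

section \<open>Continuity\<close>

lemma tendsto_coordinate:
  fixes d :: "'a \<Rightarrow> 'b :: topological_space"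
  assumes "(X \<longlongrightarrow> d) F"
  shows "((\<lambda>k. X k i) \<longlongrightarrow> d i) F"
  by (rule continuous_on_tendsto_compose[OF continuous_on_product_coordinates assms]) auto

lemma compact_nonneg_le_pi: "compact {f :: nat \<Rightarrow> real. \<forall>i. f i \<in> {0..pi}}"
proof -
  have "compactin (product_topology (\<lambda>_. euclidean) UNIV) (PiE UNIV (\<lambda>_::nat. {0..pi}))"
    by (simp add: compactin_PiE)
  moreover have "PiE UNIV (\<lambda>_::nat. {0..pi}) = {f :: nat \<Rightarrow> real. \<forall>i. f i \<in> {0..pi}}"
    by (auto simp: PiE_iff)
  ultimately show ?thesis by (simp add: euclidean_product_topology)
qed

text \<open>Every clause is an equation or a weak inequality between continuous expressions, so it
  passes to the limit.\<close>

lemma closing_angles_limit: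
  fixes A \<alpha> :: "nat \<Rightarrow> nat \<Rightarrow> real"
  assumes a: "\<And>i. i < n \<Longrightarrow> (\<lambda>k. A k i) \<longlonglongrightarrow> a i" and \<alpha>: "\<And>i. i < n \<Longrightarrow> (\<lambda>k. \<alpha> k i) \<longlonglongrightarrow> \<beta> i"
    and cl: "\<And>k. closing_angles {..<n} (A k) (\<alpha> k)"
  shows "closing_angles {..<n} a \<beta>"
  unfolding closing_angles_def
proof (intro conjI ballI)
  fix i assume i: "i \<in> {..<n}"
  show "0 \<le> \<beta> i" using cl i by (intro LIMSEQ_le_const[OF \<alpha>]) (auto simp: closing_angles_def)
  show "\<beta> i \<le> pi" using cl i by (intro LIMSEQ_le_const2[OF \<alpha>]) (auto simp: closing_angles_def)
  show "- cos (\<beta> i) * sum a ({..<n} - {i}) \<le> a i"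
  proof (rule LIMSEQ_le)
    show "(\<lambda>k. - cos (\<alpha> k i) * sum (A k) ({..<n} - {i})) \<longlonglongrightarrow> - cos (\<beta> i) * sum a ({..<n} - {i})"
      using i a \<alpha> by (intro tendsto_intros) auto
    show "(\<lambda>k. A k i) \<longlonglongrightarrow> a i" using a i by simp
    show "\<exists>N. \<forall>k\<ge>N. - cos (\<alpha> k i) * sum (A k) ({..<n} - {i}) \<le> A k i"
      using cl i by (auto simp: closing_angles_def)
  qed
  fix j assume j: "j \<in> {..<n}"
  show "a j * sin (\<beta> i) = a i * sin (\<beta> j)"
  proof (rule LIMSEQ_unique)
    show "(\<lambda>k. A k j * sin (\<alpha> k i)) \<longlonglongrightarrow> a j * sin (\<beta> i)" using i j a \<alpha> by (intro tendsto_intros) auto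
    have "(\<lambda>k. A k i * sin (\<alpha> k j)) \<longlonglongrightarrow> a i * sin (\<beta> j)" using i j a \<alpha> by (intro tendsto_intros) auto
    moreover have "A k j * sin (\<alpha> k i) = A k i * sin (\<alpha> k j)" for k
      using cl[of k] i j by (auto simp: closing_angles_def)
    ultimately show "(\<lambda>k. A k j * sin (\<alpha> k i)) \<longlonglongrightarrow> a i * sin (\<beta> j)" by simp
  qed
next
  show "sum \<beta> {..<n} = pi"
  proof (rule LIMSEQ_unique)
    show "(\<lambda>k. sum (\<alpha> k) {..<n}) \<longlonglongrightarrow> sum \<beta> {..<n}" using \<alpha> by (intro tendsto_sum) auto
    show "(\<lambda>k. sum (\<alpha> k) {..<n}) \<longlonglongrightarrow> pi" using cl by (simp add: closing_angles_def)
  qed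
qed

lemma LIMSEQ_by_subsequences:
  fixes x :: "nat \<Rightarrow> real"
  assumes "\<And>r. strict_mono (r :: nat \<Rightarrow> nat) \<Longrightarrow> \<exists>r'. strict_mono (r' :: nat \<Rightarrow> nat) \<and> (\<lambda>k. x (r (r' k))) \<longlonglongrightarrow> L"
  shows "x \<longlonglongrightarrow> L"
proof (rule ccontr)
  assume "\<not> x \<longlonglongrightarrow> L"
  then obtain e where e: "0 < e" "\<forall>N. \<exists>k\<ge>N. \<not> dist (x k) L < e" unfolding lim_sequentially by blast
  then have "infinite {k. \<not> dist (x k) L < e}"
    by (auto simp: infinite_nat_iff_unbounded_le)
  then obtain r :: "nat \<Rightarrow> nat" where r: "strict_mono r" "\<And>k. \<not> dist (x (r k)) L < e"
    using infinite_enumerate by blast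
  obtain r' :: "nat \<Rightarrow> nat" where "(\<lambda>k. x (r (r' k))) \<longlonglongrightarrow> L" using assms[OF r(1)] by blast
  then obtain N where "dist (x (r (r' N))) L < e" using e(1) unfolding lim_sequentially by blast
  then show False using r(2) by blast
qed

text \<open>The solutions of \<^const>\<open>closing_angles\<close> form a closed relation with values in a compact set;
  since they are unique, they depend continuously on the side lengths.\<close>

lemma ngon_angles_LIMSEQ:
  assumes n: "n \<ge> 3" and d: "d \<in> AC n \<union> HC n" and X: "\<And>k. X k \<in> AC n \<union> HC n" "X \<longlonglongrightarrow> d" and i: "i < n"
  shows "(\<lambda>k. ngon_angles n (X k) i) \<longlonglongrightarrow> ngon_angles n d i"
proof (rule LIMSEQ_by_subsequences)
  fix r :: "nat \<Rightarrow> nat" assume r: "strict_mono r"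
  \<comment> \<open>Compactness is available for functions on all of \<open>nat\<close>, while the
    chosen angles are arbitrary outside \<open>{..<n}\<close>; they are cut off to 0 there.\<close>
  define B where "B k j = (if j < n then ngon_angles n (X (r k)) j else 0)" for k j
  have cl: "closing_angles {..<n} (\<lambda>j. half_sinh (X k j)) (ngon_angles n (X k))" for k
    by (rule ngon_angles_closing[OF n X(1)])
  then have "B k \<in> {f. \<forall>i. f i \<in> {0..pi}}" for k
    by (auto simp: B_def closing_angles_def)
  then have "\<forall>k. B k \<in> {f. \<forall>i. f i \<in> {0..pi}}" by blast
  then obtain \<beta> r' where "\<beta> \<in> {f. \<forall>i. f i \<in> {0..pi}}"
    and r': "strict_mono (r' :: nat \<Rightarrow> nat)" "(B \<circ> r') \<longlonglongrightarrow> \<beta>"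
    by (rule seq_compactE[OF compact_imp_seq_compact[OF compact_nonneg_le_pi]])
  have lim: "(\<lambda>k. B (r' k) j) \<longlonglongrightarrow> \<beta> j" for j
    using tendsto_coordinate[OF r'(2), of j] by (simp add: o_def)
  have "closing_angles {..<n} (\<lambda>j. half_sinh (d j)) \<beta>"
  proof (rule closing_angles_limit[OF _ lim])
    fix j assume j: "j < n"
    have "\<bar>d j\<bar> \<noteq> \<infinity>" using AC_HC_bounds(1,2)[OF d j] by auto
    then have "(\<lambda>k. half_sinh (X k j)) \<longlonglongrightarrow> half_sinh (d j)"
      by (rule tendsto_half_sinh[OF tendsto_coordinate[OF X(2)]])
    from LIMSEQ_subseq_LIMSEQ[OF this strict_mono_o[OF r r'(1)]]
    show "(\<lambda>k. half_sinh (X (r (r' k)) j)) \<longlonglongrightarrow> half_sinh (d j)" by (simp add: o_def)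
  next
    fix k
    show "closing_angles {..<n} (\<lambda>j. half_sinh (X (r (r' k)) j)) (B (r' k))"
      using cl[of "r (r' k)"] by (simp add: closing_angles_def B_def)
  qed
  then have "ngon_angles n d i = \<beta> i" using ngon_angles_unique[OF n d] i by blast
  then show "\<exists>r'. strict_mono (r' :: nat \<Rightarrow> nat) \<and> (\<lambda>k. ngon_angles n (X (r (r' k))) i) \<longlonglongrightarrow> ngon_angles n d i"
    using lim[of i] r'(1) i by (auto simp: B_def)
qed

text \<open>Finiteness of the entries is an open condition, and the finite points of the union are
  those of \<open>AC\<close> and \<open>HC\<close>; hence \<open>HI\<close> stays away from
  them.\<close>

lemma eventually_AC_HC:
  assumes d: "d \<in> AC n \<union> HC n"
  shows "eventually (\<lambda>e. e \<in> AC n \<union> HC n) (at d within boundary_union n)"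
proof -
  have "eventually (\<lambda>e. \<forall>i\<in>{..<n}. e i < \<infinity>) (at d within boundary_union n)"
  proof (intro eventually_ball_finite ballI)
    fix i assume "i \<in> {..<n}"
    then have "d i < \<infinity>" using AC_HC_bounds(2)[OF d] by simp
    then show "eventually (\<lambda>e. e i < \<infinity>) (at d within boundary_union n)"
      by (rule order_tendstoD(2)[OF tendsto_coordinate[OF tendsto_ident_at]])
  qed simp
  moreover have "eventually (\<lambda>e. e \<in> boundary_union n) (at d within boundary_union n)"
    by (simp add: eventually_at_filter)
  ultimately show ?thesis
    by eventually_elim (intro finite_imp_AC_HC; simp)
qed

lemma ngon_angles_tendsto:
  assumes n: "n \<ge> 3" and d: "d \<in> AC n \<union> HC n" and i: "i < n"
  shows "((\<lambda>e. ngon_angles n e i) \<longlongrightarrow> ngon_angles n d i) (at d within boundary_union n)"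
proof -
  have "((\<lambda>e. ngon_angles n e i) \<longlongrightarrow> ngon_angles n d i) (at d within AC n \<union> HC n)"
    unfolding tendsto_at_iff_sequentially o_def
    using ngon_angles_LIMSEQ[OF n d _ _ i] by blast
  \<comment> \<open>The sequential limit is known only along \<open>AC\<close> and
    \<open>HC\<close>. Restricting the filter to these sets changes nothing, as their union contains
    all nearby points.\<close>
  then have "((\<lambda>e. ngon_angles n e i) \<longlongrightarrow> ngon_angles n d i) (inf (at d within boundary_union n) (principal (AC n \<union> HC n)))"
    by (simp add: at_within_def inf.assoc) (rule tendsto_mono[rotated], assumption, auto intro: le_infI2)
  moreover have "inf (at d within boundary_union n) (principal (AC n \<union> HC n)) = at d within boundary_union n"
    using eventually_AC_HC[OF d] by (simp add: inf.absorb1 le_principal)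
  ultimately show ?thesis by simp
qed

text \<open>The ratio equation together with \<open>sin \<le> 1\<close> bounds the sine. Being
  shorter than another side keeps the angle in the range where \<open>arcsin\<close> inverts the
  sine.\<close>

lemma ngon_angles_small:
  assumes n: "n \<ge> 3" and e: "e \<in> boundary_union n" and ij: "i < n" "j < n" "e i < e j"
  shows "0 \<le> ngon_angles n e i" "ngon_angles n e i \<le> pi / 2"
    "sin (ngon_angles n e i) \<le> half_sinh (e i) * half_csch (e j)"
proof -
  have "0 \<le> ngon_angles n e i \<and> ngon_angles n e i \<le> pi / 2 \<and>
      sin (ngon_angles n e i) \<le> half_sinh (e i) * half_csch (e j)"
  proof (cases "e \<in> HI n")
    case True
    have "0 < e i" "e i < \<infinity>" "0 < e j" using boundary_union_pos[OF e] ij by (auto intro: less_le_trans)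
    then have "0 \<le> half_sinh (e i) * half_csch (e j)"
      using half_sinh_pos half_csch_nonneg by (intro mult_nonneg_nonneg) (auto intro: less_imp_le)
    then show ?thesis using True by (simp add: ngon_angles_def)
  next
    case False
    then have e': "e \<in> AC n \<union> HC n" using e by simp
    note bd = AC_HC_bounds[OF e']
    have cl: "closing_angles {..<n} (\<lambda>i. half_sinh (e i)) (ngon_angles n e)"
      by (rule ngon_angles_closing[OF n e'])
    have "half_sinh (e i) < half_sinh (e j)" using bd ij by (intro half_sinh_less) auto
    then have "ngon_angles n e i \<le> pi / 2"
      using closing_angles_le_pi_half[OF _ _ _ cl, of i j] n bd ij by auto
    moreover have "half_sinh (e j) * sin (ngon_angles n e i) = half_sinh (e i) * sin (ngon_angles n e j)"
      using cl ij by (auto simp: closing_angles_def)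
    then have "half_sinh (e j) * sin (ngon_angles n e i) \<le> half_sinh (e i) * 1"
      using bd(3)[OF ij(1)] by (metis less_imp_le mult_left_mono sin_le_one)
    then have "sin (ngon_angles n e i) \<le> half_sinh (e i) * half_csch (e j)"
      using bd[OF ij(2)] by (simp add: half_csch_def field_simps)
    moreover have "0 \<le> ngon_angles n e i" using cl ij by (auto simp: closing_angles_def)
    ultimately show ?thesis by blast
  qed
  then show "0 \<le> ngon_angles n e i" "ngon_angles n e i \<le> pi / 2"
    "sin (ngon_angles n e i) \<le> half_sinh (e i) * half_csch (e j)" by auto
qed

lemma tendsto_arccos:
  assumes "(f \<longlongrightarrow> l) F" "eventually (\<lambda>x. \<bar>f x\<bar> \<le> 1) F" "\<bar>l\<bar> \<le> 1"
  shows "((\<lambda>x. arccos (f x)) \<longlongrightarrow> arccos l) F"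
  using assms by (intro continuous_on_tendsto_compose[OF continuous_on_arccos']) (auto simp: abs_le_iff elim: eventually_mono)

lemma abs_cos_half_sech_le: "\<bar>cos x * half_sech e\<bar> \<le> 1"
  using half_sech_bounds[of e] by (simp add: abs_mult mult_le_one)

lemma ngon_area_tendsto:
  assumes n: "n \<ge> 3" and d: "d \<in> boundary_union n"
  shows "(ngon_area n \<longlongrightarrow> ngon_area n d) (at d within boundary_union n)"
proof -
  let ?F = "at d within boundary_union n"
  have inU: "eventually (\<lambda>e. e \<in> boundary_union n) ?F" by (simp add: eventually_at_filter)
  have coord: "((\<lambda>e. e i) \<longlongrightarrow> d i) ?F" for i by (rule tendsto_coordinate[OF tendsto_ident_at])
  have pos: "eventually (\<lambda>e. 0 < e i) ?F" if "i < n" for i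
    using inU by eventually_elim (rule boundary_union_pos[OF _ that])
  have sech: "((\<lambda>e. half_sech (e i)) \<longlongrightarrow> half_sech (d i)) ?F" if "i < n" for i
    using boundary_union_pos[OF d that] by (intro tendsto_half_sech coord pos that)
  have key: "((\<lambda>e. cos (ngon_angles n e i) * half_sech (e i)) \<longlongrightarrow> cos (ngon_angles n d i) * half_sech (d i)) ?F"
    if i: "i < n" for i
  proof (cases "d \<in> HI n")
    case False
    then have "d \<in> AC n \<union> HC n" using d by simp
    from isCont_tendsto_compose[OF isCont_cos ngon_angles_tendsto[OF n this i]] show ?thesis
      by (intro tendsto_mult sech i)
  next
    case True
    show ?thesis
    proof (cases "d i = \<infinity>")
      \<comment> \<open>No limit of the angle is claimed here: the cosine is bounded and its factor
        tends to 0.\<close>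
      case inf: True
      have "((\<lambda>e. half_sech (e i)) \<longlongrightarrow> 0) ?F" using sech[OF i] inf by (simp add: half_sech_def)
      then have "((\<lambda>e. cos (ngon_angles n e i) * half_sech (e i)) \<longlongrightarrow> 0) ?F"
        by (rule Lim_null_comparison[rotated])
          (auto simp: abs_mult half_sech_bounds intro!: always_eventually mult_left_le_one_le)
      then show ?thesis using inf by (simp add: half_sech_def)
    next
      case fin: False
      then have "d i < \<infinity>" by auto
      obtain j where j: "j < n" "d j = \<infinity>" using HI_infinities[OF n True] by metis
      have finab: "\<bar>d i\<bar> \<noteq> \<infinity>" using boundary_union_pos[OF d i] fin by auto
      \<comment> \<open>\<open>R\<close> separates the two coordinates near \<open>d\<close>, so
        that side \<open>i\<close> is shorter than side \<open>j\<close> at all nearby points,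
        whichever stratum they belong to.\<close>
      obtain R where R: "d i < ereal R" using \<open>d i < \<infinity>\<close> by (meson ereal_dense2)
      have "eventually (\<lambda>e. e i < ereal R) ?F" by (rule order_tendstoD(2)[OF coord R])
      moreover have "eventually (\<lambda>e. ereal R < e j) ?F"
        using coord[of j] j by (simp add: tendsto_PInfty)
      ultimately have ev: "eventually (\<lambda>e. e \<in> boundary_union n \<and> e i < e j) ?F"
        using inU by eventually_elim (auto intro: less_trans)
      have "((\<lambda>e. half_sinh (e i) * half_csch (e j)) \<longlongrightarrow> half_sinh (d i) * 0) ?F"
        using j coord[of j] by (intro tendsto_mult tendsto_half_sinh coord finab tendsto_half_csch_infinity pos) auto
      then have up: "((\<lambda>e. half_sinh (e i) * half_csch (e j)) \<longlongrightarrow> 0) ?F" by simp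
      have sin0: "((\<lambda>e. sin (ngon_angles n e i)) \<longlongrightarrow> 0) ?F"
      proof (rule tendsto_sandwich[OF _ _ tendsto_const up])
        show "eventually (\<lambda>e. 0 \<le> sin (ngon_angles n e i)) ?F"
          using ev
        proof eventually_elim
          case (elim e)
          then show ?case using ngon_angles_small[OF n, of e i j] i j pi_gt_zero by (intro sin_ge_zero) auto
        qed
        show "eventually (\<lambda>e. sin (ngon_angles n e i) \<le> half_sinh (e i) * half_csch (e j)) ?F"
          using ev by eventually_elim (use ngon_angles_small[OF n] i j in auto)
      qed
      \<comment> \<open>The angle is at most \<open>pi / 2\<close>, so it tends to 0 along with its
        sine.\<close>
      have "((\<lambda>e. arcsin (sin (ngon_angles n e i))) \<longlongrightarrow> arcsin 0) ?F"
        by (rule continuous_on_tendsto_compose[OF continuous_on_arcsin' sin0]) auto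
      moreover have "eventually (\<lambda>e. arcsin (sin (ngon_angles n e i)) = ngon_angles n e i) ?F"
        using ev
      proof eventually_elim
        case (elim e)
        then show ?case using ngon_angles_small[OF n, of e i j] i j by (intro arcsin_sin) auto
      qed
      ultimately have "((\<lambda>e. ngon_angles n e i) \<longlongrightarrow> 0) ?F"
        by (simp add: tendsto_cong)
      then have "((\<lambda>e. ngon_angles n e i) \<longlongrightarrow> ngon_angles n d i) ?F" using True by (simp add: ngon_angles_def)
      from isCont_tendsto_compose[OF isCont_cos this] show ?thesis by (intro tendsto_mult sech i)
    qed
  qed
  have "((\<lambda>e. arccos (cos (ngon_angles n e i) * half_sech (e i))) \<longlongrightarrow> arccos (cos (ngon_angles n d i) * half_sech (d i))) ?F"
    if "i < n" for i
    by (intro tendsto_arccos key that always_eventually allI abs_cos_half_sech_le)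
  then show ?thesis
    unfolding ngon_area_def[abs_def] by (intro tendsto_intros) auto
qed

theorem proposition3p7:
  fixes n :: nat
  assumes "n \<ge> 3"
  shows "\<exists>D :: (nat \<Rightarrow> ereal) \<Rightarrow> real.
    (\<forall>d \<in> AC n. D d = cyclic_area n d) \<and>
    (\<forall>d \<in> HC n. \<forall>i0<n. d i0 = Max (d ` {..<n}) \<longrightarrow>
       D d = (real n - 2) * pi + 2 * (horo_angle (d i0) - (\<Sum>i\<in>{..<n} - {i0}. horo_angle (d i)))) \<and>
    (\<forall>d \<in> HI n. \<forall>i0<n. d i0 = \<infinity> \<and> d ((i0 + 1) mod n) = \<infinity> \<longrightarrow>
       D d = (real n - 2) * pi - 2 * (\<Sum>i\<in>{..<n} - {i0, (i0 + 1) mod n}. horo_angle (d i))) \<and>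
    (\<forall>d \<in> AC n \<union> HC n \<union> HI n. 0 < D d) \<and>
    continuous_on (AC n \<union> HC n \<union> HI n) D \<and>
    (\<forall>d \<in> AC n \<union> HC n \<union> HI n. \<forall>d' \<in> AC n \<union> HC n \<union> HI n. \<forall>p.
       p permutes {..<n} \<and> (\<forall>i<n. d' i = d (p i)) \<longrightarrow> D d' = D d) \<and>
    (\<forall>d \<in> HC n \<union> HI n. \<forall>d' \<in> HC n \<union> HI n. \<forall>p.
       p permutes {..<n} \<and> (\<forall>i<n. d i \<le> d' (p i)) \<and> (\<exists>i<n. d i < d' (p i)) \<longrightarrow> D d < D d')"
proof (intro exI[of _ "ngon_area n"] conjI ballI allI impI)
  show "ngon_area n d = cyclic_area n d" if "d \<in> AC n" for d
    by (rule ngon_area_eq_cyclic_area[OF assms that])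
next
  fix d i0 assume "d \<in> HC n" "i0 < n" "d i0 = Max (d ` {..<n})"
  then show "ngon_area n d = (real n - 2) * pi + 2 * (horo_angle (d i0) - (\<Sum>i\<in>{..<n} - {i0}. horo_angle (d i)))"
    by (rule ngon_area_HC_horo[OF assms])
next
  fix d i0 assume "d \<in> HI n" "i0 < n" "d i0 = \<infinity> \<and> d ((i0 + 1) mod n) = \<infinity>"
  then show "ngon_area n d = (real n - 2) * pi - 2 * (\<Sum>i\<in>{..<n} - {i0, (i0 + 1) mod n}. horo_angle (d i))"
    using ngon_area_HI_horo[OF assms] by blast
next
  show "0 < ngon_area n d" if "d \<in> AC n \<union> HC n \<union> HI n" for d by (rule ngon_area_pos[OF assms that])
next
  show "continuous_on (AC n \<union> HC n \<union> HI n) (ngon_area n)"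
    unfolding continuous_on_def using ngon_area_tendsto[OF assms] by blast
next
  fix d d' p assume "d \<in> AC n \<union> HC n \<union> HI n" "d' \<in> AC n \<union> HC n \<union> HI n" "p permutes {..<n} \<and> (\<forall>i<n. d' i = d (p i))"
  then show "ngon_area n d' = ngon_area n d" using ngon_area_permute[OF assms] by blast
next
  fix d d' p assume "d \<in> HC n \<union> HI n" "d' \<in> HC n \<union> HI n"
    "p permutes {..<n} \<and> (\<forall>i<n. d i \<le> d' (p i)) \<and> (\<exists>i<n. d i < d' (p i))"
  then show "ngon_area n d < ngon_area n d'" using ngon_area_strict_mono[OF assms] by blast
qed

end
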